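(* Let $M$ be a Kähler manifold of complex dimension $n\ge 2$ with Kähler form $\omega$, let $N$ be a Kähler manifold with Kähler metric $h$, and let $f:M\to N$ be a smooth harmonic map. Then $$d\,\{\bar\partial_{E'}\partial f,\ \bar\partial f-\partial f\}\wedge\frac{\omega^{n-2}}{(n-2)!}=\left(8\,\bigl|\partial_{E'}\bar\partial f\bigr|^2+2Q\right)\frac{\omega^n}{n!},$$ where the function $Q:M\to\mathbb R$ is defined by $$Q\,\frac{\omega^n}{n!}=-R_{i\bar jk\bar l}\,\bar\partial f^i\wedge\partial\bar f^j\wedge\partial f^k\wedge\bar\partial\bar f^l\wedge\frac{\omega^{n-2}}{(n-2)!}.$$
   Context: Harmonic means that the tension field vanishes: $\tau(f)=\star d_\nabla\star df=0$, where $\nabla$ is the pullback to $f^*TN$ of the Levi-Civita connection of $N$. $E=f^*(TN\otimes\mathbb C)=E'\oplus E''$ with $E'=f^*T^{(1,0)}N$, $E''=f^*T^{(0,1)}N$. The pulled-back, complex-linearly extended Levi-Civita connection preserves $E'$. It induces the exterior covariant derivative on $E'$-valued forms, whose $(1,0)$ and $(0,1)$ parts are $\partial_{E'}:\Omega^{p,q}(E')\to\Omega^{p+1,q}(E')$ and $\bar\partial_{E'}:\Omega^{p,q}(E')\to\Omega^{p,q+1}(E')$. In local holomorphic coordinates $(w^i)$ on $N$, write $f^i=w^i\circ f$, $\bar f^i=\overline{f^i}$, $\frac{\partial}{\partial f^i}=\frac{\partial}{\partial w^i}\circ f$. Then $\partial f=\partial f^i\otimes\frac{\partial}{\partial f^i}\in\Omega^{1,0}(E')$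 and $\bar\partial f=\bar\partial f^i\otimes\frac{\partial}{\partial f^i}\in\Omega^{0,1}(E')$. For $E'$-valued forms $\psi=\psi^i\otimes\frac{\partial}{\partial f^i}$ and $\xi=\xi^j\otimes\frac{\partial}{\partial f^j}$, set $\{\psi,\xi\}=(h_{i\bar j}\circ f)\,\psi^i\wedge\overline{\xi^j}$. The curvature tensor of $N$ is $R_{i\bar jk\bar l}=-\frac{\partial^2h_{i\bar j}}{\partial w^k\partial\bar w^l}+h^{p\bar q}\frac{\partial h_{k\bar q}}{\partial w^i}\frac{\partial h_{p\bar l}}{\partial\bar w^j}$, evaluated along $f$. Repeated indices are summed. Normalization: at a point $x\in M$ take holomorphic coordinates $(z^p)$ with $\omega=\frac{\sqrt{-1}}2\sum_pdz^p\wedge d\bar z^p$ at $x$. For an $E'$-valued $(1,1)$-form $\phi=\phi_{p\bar q}\,dz^p\wedge d\bar z^q$, $|\phi|^2=\sum_{p,q}|\phi_{p\bar q}|^2$ at $x$, where $|\cdot|$ on $E'$ is the norm of the Hermitian metric $h_{i\bar j}$. *)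

theory Defs
  imports "HOL-Analysis.Analysis"
begin

section \<open>Smooth maps and complex manifolds\<close>

primrec ck_on :: "nat \<Rightarrow> ('a::real_normed_vector \<Rightarrow> 'b::real_normed_vector) \<Rightarrow> 'a set \<Rightarrow> bool" where
  "ck_on 0 \<phi> S = continuous_on S \<phi>"
| "ck_on (Suc k) \<phi> S = ((\<forall>x\<in>S. \<phi> differentiable (at x)) \<and>
     (\<forall>v. ck_on k (\<lambda>x. frechet_derivative \<phi> (at x) v) S))"

text \<open>Only used for open sets \<open>S\<close>.\<close>

definition smooth_on :: "('a::real_normed_vector \<Rightarrow> 'b::real_normed_vector) \<Rightarrow> 'a set \<Rightarrow> bool" where
  "smooth_on \<phi> S \<longleftrightarrow> (\<forall>k. ck_on k \<phi> S)"

text \<open>A holomorphic map is a smooth map whose differential is complex linear.\<close>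

definition holomorphic_map_on :: "(complex^'n \<Rightarrow> complex^'m) \<Rightarrow> (complex^'n) set \<Rightarrow> bool" where
  "holomorphic_map_on \<phi> S \<longleftrightarrow> smooth_on \<phi> S \<and>
     (\<forall>x\<in>S. \<forall>c v. frechet_derivative \<phi> (at x) (c *s v) = c *s frechet_derivative \<phi> (at x) v)"

text \<open>A chart is a pair of its domain and its coordinate map. A manifold is a whole type
  together with an atlas, not necessarily maximal.\<close>

type_synonym ('a, 'n) chart = "'a set \<times> ('a \<Rightarrow> complex^'n)"

definition chart_rep :: "('a, 'n::finite) chart \<Rightarrow> ('b, 'm::finite) chart \<Rightarrow> ('a \<Rightarrow> 'b)
    \<Rightarrow> complex^'n \<Rightarrow> complex^'m" where
  "chart_rep c c' f = snd c' \<circ> f \<circ> inv_into (fst c) (snd c)"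

definition complex_atlas :: "('a::{t2_space,second_countable_topology}, 'n::finite) chart set \<Rightarrow> bool" where
  "complex_atlas \<A> \<longleftrightarrow>
     (\<forall>(U, z)\<in>\<A>. open U \<and> open (z ` U) \<and> homeomorphism U (z ` U) z (inv_into U z)) \<and>
     (\<Union>(U, z)\<in>\<A>. U) = UNIV \<and>
     (\<forall>c\<in>\<A>. \<forall>c'\<in>\<A>. holomorphic_map_on (chart_rep c c' id) (snd c ` (fst c \<inter> fst c')))"

definition smooth_map :: "('a::{t2_space,second_countable_topology}, 'n::finite) chart set
    \<Rightarrow> ('b::{t2_space,second_countable_topology}, 'm::finite) chart set \<Rightarrow> ('a \<Rightarrow> 'b) \<Rightarrow> bool" where
  "smooth_map \<A> \<B> f \<longleftrightarrow> continuous_on UNIV f \<and>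
     (\<forall>c\<in>\<A>. \<forall>c'\<in>\<B>. smooth_on (chart_rep c c' f) (snd c ` (fst c \<inter> f -` fst c')))"

section \<open>Complex differential forms in holomorphic coordinates\<close>

text \<open>The pair \<open>(a, b)\<close> stands for the complexified tangent vector
  \<open>\<Sum>j. a\<^sub>j \<partial>/\<partial>z\<^sup>j + b\<^sub>j \<partial>/\<partial>\<bar>z\<^sup>j\<close>; a real tangent vector \<open>v\<close> is the pair of \<open>v\<close> and its
  complex conjugate. A complex differential form
  sends a point to a function of the list of its arguments; a \<open>k\<close>-form vanishes on lists of
  length other than \<open>k\<close>. The products below use the determinant convention
  \<open>(\<alpha> \<and> \<beta>)(u, v) = \<alpha>(u) \<beta>(v) - \<alpha>(v) \<beta>(u)\<close>.\<close>

type_synonym 'n tvec = "(complex^'n) \<times> (complex^'n)"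
type_synonym 'n form = "complex^'n \<Rightarrow> 'n tvec list \<Rightarrow> complex"

definition cvec :: "'n::finite + 'n \<Rightarrow> 'n tvec" where
  "cvec A = (case A of Inl j \<Rightarrow> (axis j 1, 0) | Inr j \<Rightarrow> (0, axis j 1))"

text \<open>The complex linear extension of the differential of \<open>\<phi>\<close> at \<open>p\<close>, with
  \<open>\<partial>/\<partial>z = (\<partial>/\<partial>x - \<i> \<partial>/\<partial>y)/2\<close> and \<open>\<partial>/\<partial>\<bar>z = (\<partial>/\<partial>x + \<i> \<partial>/\<partial>y)/2\<close>.\<close>

definition cderiv :: "(complex^'n \<Rightarrow> complex) \<Rightarrow> complex^'n \<Rightarrow> 'n::finite tvec \<Rightarrow> complex" where
  "cderiv \<phi> p v = (let D = frechet_derivative \<phi> (at p) in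
     (\<Sum>j\<in>UNIV. fst v $ j * ((D (axis j 1) - \<i> * D (axis j \<i>)) / 2)
             + snd v $ j * ((D (axis j 1) + \<i> * D (axis j \<i>)) / 2)))"

definition wedge :: "'n::finite form \<Rightarrow> 'n form \<Rightarrow> 'n form" where
  "wedge \<alpha> \<beta> = (\<lambda>p vs. \<Sum>I\<in>Pow {..<length vs}.
     (-1) ^ card {(i, j). i \<in> I \<and> j \<in> {..<length vs} - I \<and> j < i}
       * \<alpha> p (nths vs I) * \<beta> p (nths vs (- I)))"

definition fun_form :: "(complex^'n \<Rightarrow> complex) \<Rightarrow> 'n::finite form" where
  "fun_form \<phi> = (\<lambda>p vs. if vs = [] then \<phi> p else 0)"

primrec wedge_power :: "'n::finite form \<Rightarrow> nat \<Rightarrow> 'n form" where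
  "wedge_power \<alpha> 0 = fun_form (\<lambda>_. 1)"
| "wedge_power \<alpha> (Suc k) = wedge \<alpha> (wedge_power \<alpha> k)"

definition cnj_form :: "'n::finite form \<Rightarrow> 'n form" where
  "cnj_form \<alpha> = (\<lambda>p vs. cnj (\<alpha> p (map (\<lambda>(a, b). (\<chi> j. cnj (b $ j), \<chi> j. cnj (a $ j))) vs)))"

text \<open>The exterior derivative in which the direction of differentiation is first projected
  by \<open>\<pi>\<close>: the identity gives \<open>d\<close>, and the projections to the span of the \<open>\<partial>/\<partial>z\<^sup>j\<close> and of the
  \<open>\<partial>/\<partial>\<bar>z\<^sup>j\<close> give the parts \<open>\<partial>\<close> and \<open>\<bar>\<partial>\<close> of \<open>d\<close> of bidegree \<open>(1,0)\<close> and \<open>(0,1)\<close>.\<close>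

definition d_along :: "('n::finite tvec \<Rightarrow> 'n tvec) \<Rightarrow> 'n form \<Rightarrow> 'n form" where
  "d_along \<pi> \<alpha> = (\<lambda>p vs. \<Sum>i<length vs.
     (-1) ^ i * cderiv (\<lambda>q. \<alpha> q (take i vs @ drop (Suc i) vs)) p (\<pi> (vs ! i)))"

definition pr10 :: "'n::finite tvec \<Rightarrow> 'n tvec" where "pr10 v = (fst v, 0)"
definition pr01 :: "'n::finite tvec \<Rightarrow> 'n tvec" where "pr01 v = (0, snd v)"

abbreviation ext_d :: "'n::finite form \<Rightarrow> 'n form" where "ext_d \<equiv> d_along id"
abbreviation del :: "'n::finite form \<Rightarrow> 'n form" where "del \<equiv> d_along pr10"
abbreviation delbar :: "'n::finite form \<Rightarrow> 'n form" where "delbar \<equiv> d_along pr01"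

section \<open>Kaehler metrics\<close>

text \<open>A Hermitian metric is given by its matrices: \<open>g c p $ i $ j\<close> is \<open>g\<^bsub>i\<bar>j\<^esub>\<close> in the
  coordinates of the chart \<open>c\<close>, at the point with coordinates \<open>p\<close>. Its Kaehler form is
  \<open>\<omega> = (\<i>/2) \<Sum> g\<^bsub>i\<bar>j\<^esub> dz\<^sup>i \<and> d\<bar>z\<^sup>j\<close>.\<close>

type_synonym 'n metric = "complex^'n \<Rightarrow> complex^'n^'n"

definition dz :: "'n::finite \<Rightarrow> 'n form" where "dz i = ext_d (fun_form (\<lambda>q. q $ i))"
definition dzbar :: "'n::finite \<Rightarrow> 'n form" where "dzbar i = ext_d (fun_form (\<lambda>q. cnj (q $ i)))"

definition kaehler_form :: "'n::finite metric \<Rightarrow> 'n form" where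
  "kaehler_form g = (\<lambda>p vs. (\<i> / 2) *
     (\<Sum>i\<in>UNIV. \<Sum>j\<in>UNIV. g p $ i $ j * wedge (dz i) (dzbar j) p vs))"

definition kaehler_manifold :: "('a::{t2_space,second_countable_topology}, 'n::finite) chart set
    \<Rightarrow> (('a, 'n) chart \<Rightarrow> 'n metric) \<Rightarrow> bool" where
  "kaehler_manifold \<A> g \<longleftrightarrow> complex_atlas \<A> \<and>
     (\<forall>c\<in>\<A>. smooth_on (g c) (snd c ` fst c) \<and>
        (\<forall>p\<in>snd c ` fst c.
           (\<forall>i j. g c p $ j $ i = cnj (g c p $ i $ j)) \<and>
           (\<forall>v. v \<noteq> 0 \<longrightarrow> Re (\<Sum>i\<in>UNIV. \<Sum>j\<in>UNIV. g c p $ i $ j * v $ i * cnj (v $ j)) > 0) \<and>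
           (\<forall>vs. ext_d (kaehler_form (g c)) p vs = 0))) \<and>
     (\<forall>c\<in>\<A>. \<forall>c'\<in>\<A>. \<forall>x\<in>fst c \<inter> fst c'. \<forall>i j.
        (let J = (\<lambda>k l. frechet_derivative (chart_rep c c' id) (at (snd c x)) (axis l 1) $ k) in
          g c (snd c x) $ i $ j =
            (\<Sum>k\<in>UNIV. \<Sum>l\<in>UNIV. g c' (snd c' x) $ k $ l * J k i * cnj (J l j))))"

text \<open>\<open>\<omega>\<^sup>n/n!\<close>, which is also the Riemannian volume form.\<close>

definition volume_form :: "'n::finite metric \<Rightarrow> 'n form" where
  "volume_form g = (\<lambda>p vs. wedge_power (kaehler_form g) CARD('n) p vs / fact CARD('n))"

text \<open>\<open>h\<^bsup>p\<bar>q\<^esup>\<close>, characterised by \<open>\<Sum>q. h\<^bsup>p\<bar>q\<^esup> h\<^bsub>k\<bar>q\<^esub> = \<delta>\<^bsub>pk\<^esub>\<close>; whence the transposition.\<close>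

definition inv_metric :: "complex^'n^'n \<Rightarrow> 'n::finite \<Rightarrow> 'n \<Rightarrow> complex" where
  "inv_metric H p q = matrix_inv H $ q $ p"

text \<open>The complex bilinear extension of the Riemannian metric
  \<open>Re (\<Sum> h\<^bsub>i\<bar>j\<^esub> dw\<^sup>i \<otimes> d\<bar>w\<^sup>j)\<close>, in the frame \<open>\<partial>/\<partial>w\<^sup>i\<close> (index \<open>Inl i\<close>), \<open>\<partial>/\<partial>\<bar>w\<^sup>i\<close> (index \<open>Inr i\<close>).\<close>

definition riem :: "complex^'n^'n \<Rightarrow> complex^('n::finite + 'n)^('n + 'n)" where
  "riem H = (\<chi> A B. case (A, B) of
       (Inl i, Inr j) \<Rightarrow> H $ i $ j / 2
     | (Inr i, Inl j) \<Rightarrow> H $ j $ i / 2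
     | _ \<Rightarrow> 0)"

text \<open>The Christoffel symbols \<open>\<Gamma>\<^sup>A\<^bsub>BC\<^esub>\<close> of the complex linearly extended Levi-Civita connection
  in that frame.\<close>

definition christoffel :: "'n::finite metric \<Rightarrow> complex^'n \<Rightarrow> 'n + 'n \<Rightarrow> 'n + 'n \<Rightarrow> 'n + 'n \<Rightarrow> complex" where
  "christoffel h y A B C = (\<Sum>D\<in>UNIV. matrix_inv (riem (h y)) $ A $ D *
     (cderiv (\<lambda>u. riem (h u) $ C $ D) y (cvec B) + cderiv (\<lambda>u. riem (h u) $ B $ D) y (cvec C)
        - cderiv (\<lambda>u. riem (h u) $ B $ C) y (cvec D)) / 2)"

text \<open>\<open>R\<^bsub>i\<bar>jk\<bar>l\<^esub>\<close>\<close>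

definition curvature :: "'n::finite metric \<Rightarrow> complex^'n \<Rightarrow> 'n \<Rightarrow> 'n \<Rightarrow> 'n \<Rightarrow> 'n \<Rightarrow> complex" where
  "curvature h y i j k l =
     - cderiv (\<lambda>u. cderiv (\<lambda>u'. h u' $ i $ j) u (cvec (Inr l))) y (cvec (Inl k))
     + (\<Sum>p\<in>UNIV. \<Sum>q\<in>UNIV. inv_metric (h y) p q
          * cderiv (\<lambda>u. h u $ k $ q) y (cvec (Inl i))
          * cderiv (\<lambda>u. h u $ p $ l) y (cvec (Inr j)))"

section \<open>Forms with values in the pulled-back tangent bundle\<close>

text \<open>Here \<open>F\<close> is a coordinate expression of \<open>f\<close>. Forms with values in \<open>E\<close>, respectively \<open>E'\<close>, are
  given by their components in the frame \<open>\<partial>/\<partial>f\<^sup>i\<close>, \<open>\<partial>/\<partial>\<bar>f\<^sup>i\<close>, respectively \<open>\<partial>/\<partial>f\<^sup>i\<close>.\<close>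

type_synonym ('n, 'm) E_form = "'m + 'm \<Rightarrow> 'n form"
type_synonym ('n, 'm) E'_form = "'m \<Rightarrow> 'n form"

definition coord_form :: "(complex^'n \<Rightarrow> complex^'m) \<Rightarrow> 'm + 'm \<Rightarrow> 'n::finite form" where
  "coord_form F A = fun_form (\<lambda>q. case A of Inl i \<Rightarrow> F q $ i | Inr i \<Rightarrow> cnj (F q $ i))"

text \<open>The exterior covariant derivative \<open>(d\<^sub>\<nabla> \<psi>)\<^sup>A = d\<psi>\<^sup>A + \<Gamma>\<^sup>A\<^bsub>BC\<^esub>(f) df\<^sup>B \<and> \<psi>\<^sup>C\<close> for \<open>\<pi>\<close> the
  identity, and its parts of bidegree \<open>(1,0)\<close> and \<open>(0,1)\<close> for \<open>\<pi> = pr10\<close> and \<open>\<pi> = pr01\<close>.\<close>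

definition cov_d :: "('n::finite tvec \<Rightarrow> 'n tvec) \<Rightarrow> 'm::finite metric \<Rightarrow> (complex^'n \<Rightarrow> complex^'m)
    \<Rightarrow> ('n, 'm) E_form \<Rightarrow> ('n, 'm) E_form" where
  "cov_d \<pi> h F \<psi> A = (\<lambda>p vs. d_along \<pi> (\<psi> A) p vs
     + (\<Sum>B\<in>UNIV. \<Sum>C\<in>UNIV. christoffel h (F p) A B C * wedge (d_along \<pi> (coord_form F B)) (\<psi> C) p vs))"

definition incl_E :: "('n::finite, 'm) E'_form \<Rightarrow> ('n, 'm) E_form" where
  "incl_E \<psi> A = (case A of Inl i \<Rightarrow> \<psi> i | Inr _ \<Rightarrow> (\<lambda>_ _. 0))"

definition del_E' :: "'m::finite metric \<Rightarrow> (complex^'n \<Rightarrow> complex^'m)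
    \<Rightarrow> ('n::finite, 'm) E'_form \<Rightarrow> ('n, 'm) E'_form" where
  "del_E' h F \<psi> i = cov_d pr10 h F (incl_E \<psi>) (Inl i)"

definition delbar_E' :: "'m::finite metric \<Rightarrow> (complex^'n \<Rightarrow> complex^'m)
    \<Rightarrow> ('n::finite, 'm) E'_form \<Rightarrow> ('n, 'm) E'_form" where
  "delbar_E' h F \<psi> i = cov_d pr01 h F (incl_E \<psi>) (Inl i)"

text \<open>The \<open>E'\<close>-valued forms \<open>\<partial>f\<close> and \<open>\<bar>\<partial>f\<close>.\<close>

definition del_map :: "(complex^'n \<Rightarrow> complex^'m) \<Rightarrow> ('n::finite, 'm) E'_form" where
  "del_map F i = del (coord_form F (Inl i))"

definition delbar_map :: "(complex^'n \<Rightarrow> complex^'m) \<Rightarrow> ('n::finite, 'm) E'_form" where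
  "delbar_map F i = delbar (coord_form F (Inl i))"

text \<open>\<open>{\<psi>, \<xi>}\<close>\<close>

definition bracket :: "'m::finite metric \<Rightarrow> (complex^'n \<Rightarrow> complex^'m)
    \<Rightarrow> ('n::finite, 'm) E'_form \<Rightarrow> ('n, 'm) E'_form \<Rightarrow> 'n form" where
  "bracket h F \<psi> \<xi> = (\<lambda>p vs. \<Sum>i\<in>UNIV. \<Sum>j\<in>UNIV.
     h (F p) $ i $ j * wedge (\<psi> i) (cnj_form (\<xi> j)) p vs)"

text \<open>The square norm of a \<open>(1,1)\<close>-form in arbitrary coordinates: with
  \<open>\<phi>\<^sup>i\<^bsub>p\<bar>q\<^esub> = \<phi>\<^sup>i(\<partial>/\<partial>z\<^sup>p, \<partial>/\<partial>\<bar>z\<^sup>q)\<close> it is the contraction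
  \<open>h\<^bsub>i\<bar>j\<^esub> g\<^bsup>p\<bar>r\<^esup> g\<^bsup>s\<bar>q\<^esup> \<phi>\<^sup>i\<^bsub>p\<bar>q\<^esub> cnj (\<phi>\<^sup>j\<^bsub>r\<bar>s\<^esub>)\<close>. The lemma below identifies it with
  \<open>\<Sum> \<bar>\<phi>\<^bsub>p\<bar>q\<^esub>\<bar>\<^sup>2\<close> in coordinates in which \<open>\<omega>\<close> is \<open>(\<i>/2) \<Sum> dz\<^sup>p \<and> d\<bar>z\<^sup>p\<close> at the point.\<close>

definition form11_norm2 :: "'n::finite metric \<Rightarrow> 'm::finite metric \<Rightarrow> (complex^'n \<Rightarrow> complex^'m)
    \<Rightarrow> ('n, 'm) E'_form \<Rightarrow> complex^'n \<Rightarrow> real" where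
  "form11_norm2 g h F \<phi> x = Re (\<Sum>i\<in>UNIV. \<Sum>j\<in>UNIV. \<Sum>p\<in>UNIV. \<Sum>q\<in>UNIV. \<Sum>r\<in>UNIV. \<Sum>s\<in>UNIV.
     h (F x) $ i $ j * inv_metric (g x) p r * inv_metric (g x) s q
       * \<phi> i x [cvec (Inl p), cvec (Inr q)] * cnj (\<phi> j x [cvec (Inl r), cvec (Inr s)]))"


lemma form11_norm2_normalized:
  assumes "g x = mat 1"
  shows "form11_norm2 g h F \<phi> x = (\<Sum>p\<in>UNIV. \<Sum>q\<in>UNIV. Re (\<Sum>i\<in>UNIV. \<Sum>j\<in>UNIV. h (F x) $ i $ j
    * \<phi> i x [cvec (Inl p), cvec (Inr q)] * cnj (\<phi> j x [cvec (Inl p), cvec (Inr q)])))"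
proof -
  have "matrix_inv (mat 1 :: complex^'a^'a) = mat 1"
    unfolding matrix_inv_def by (rule some_equality) simp_all
  then have inv: "inv_metric (g x) p q = (if p = q then 1 else 0)" for p q
    using assms by (auto simp: inv_metric_def mat_def)
  let ?t = "\<lambda>i j p q. h (F x) $ i $ j
    * \<phi> i x [cvec (Inl p), cvec (Inr q)] * cnj (\<phi> j x [cvec (Inl p), cvec (Inr q)])"
  have "form11_norm2 g h F \<phi> x = Re (\<Sum>i\<in>UNIV. \<Sum>j\<in>UNIV. \<Sum>p\<in>UNIV. \<Sum>q\<in>UNIV. ?t i j p q)"
  proof -
    have "(\<Sum>r\<in>UNIV. \<Sum>s\<in>UNIV. a * inv_metric (g x) p r * inv_metric (g x) s q * b * c r s) = a * b * c p q"
      for a b c p q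
    proof -
      have "(\<Sum>r\<in>UNIV. \<Sum>s\<in>UNIV. a * inv_metric (g x) p r * inv_metric (g x) s q * b * c r s)
          = (\<Sum>r\<in>UNIV. \<Sum>s\<in>UNIV. if p = r then if s = q then a * b * c r s else 0 else 0)"
        by (intro sum.cong refl) (simp add: inv)
      also have "\<dots> = (\<Sum>r\<in>UNIV. if p = r then a * b * c r q else 0)"
        by (intro sum.cong refl) simp
      finally show ?thesis
        by simp
    qed
    then show ?thesis
      unfolding form11_norm2_def by simp
  qed
  also have "(\<Sum>i\<in>UNIV. \<Sum>j\<in>UNIV. \<Sum>p\<in>UNIV. \<Sum>q\<in>UNIV. ?t i j p q)
      = (\<Sum>i\<in>UNIV. \<Sum>p\<in>UNIV. \<Sum>q\<in>UNIV. \<Sum>j\<in>UNIV. ?t i j p q)"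
    by (intro sum.cong refl, subst sum.swap, intro sum.cong refl, rule sum.swap)
  also have "\<dots> = (\<Sum>p\<in>UNIV. \<Sum>q\<in>UNIV. \<Sum>i\<in>UNIV. \<Sum>j\<in>UNIV. ?t i j p q)"
    by (subst sum.swap, intro sum.cong refl, rule sum.swap)
  finally show ?thesis by simp
qed

section \<open>Harmonic maps\<close>

text \<open>The Hodge star of a \<open>k\<close>-form (\<open>N = 2n\<close> is the real dimension), extended complex linearly:
  \<open>(\<star>\<beta>)(v\<^bsub>k+1\<^esub>, \<dots>, v\<^sub>N) = (1/k!) G\<^bsup>A1 B1\<^esup> \<dots> G\<^bsup>Ak Bk\<^esup> \<beta>(e\<^bsub>A1\<^esub>, \<dots>, e\<^bsub>Ak\<^esub>) vol(e\<^bsub>B1\<^esub>, \<dots>, e\<^bsub>Bk\<^esub>, v\<^bsub>k+1\<^esub>, \<dots>, v\<^sub>N)\<close>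
  in the frame \<open>cvec\<close>.\<close>

definition hodge_star :: "'n::finite metric \<Rightarrow> nat \<Rightarrow> 'n form \<Rightarrow> 'n form" where
  "hodge_star g k \<beta> = (\<lambda>p vs. (1 / fact k) *
     (\<Sum>As\<in>{As. length As = k}. \<Sum>Bs\<in>{Bs. length Bs = k}.
        (\<Prod>i<k. matrix_inv (riem (g p)) $ (As ! i) $ (Bs ! i))
          * \<beta> p (map cvec As) * volume_form g p (map cvec Bs @ vs)))"

text \<open>\<open>\<tau>(f) = \<star> d\<^sub>\<nabla> \<star> df\<close>, where \<open>df\<close> is an \<open>E\<close>-valued 1-form.\<close>

definition tension :: "'n::finite metric \<Rightarrow> 'm::finite metric \<Rightarrow> (complex^'n \<Rightarrow> complex^'m)
    \<Rightarrow> ('n, 'm) E_form" where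
  "tension g h F A = hodge_star g (2 * CARD('n))
     (cov_d id h F (\<lambda>B. hodge_star g 1 (ext_d (coord_form F B))) A)"

definition harmonic_map :: "('a::{t2_space,second_countable_topology}, 'n::finite) chart set
    \<Rightarrow> (('a, 'n) chart \<Rightarrow> 'n metric)
    \<Rightarrow> ('b::{t2_space,second_countable_topology}, 'm::finite) chart set
    \<Rightarrow> (('b, 'm) chart \<Rightarrow> 'm metric) \<Rightarrow> ('a \<Rightarrow> 'b) \<Rightarrow> bool" where
  "harmonic_map \<A> g \<B> h f \<longleftrightarrow> smooth_map \<A> \<B> f \<and>
     (\<forall>c\<in>\<A>. \<forall>c'\<in>\<B>. \<forall>x\<in>fst c \<inter> f -` fst c'. \<forall>A vs.
        tension (g c) (h c') (chart_rep c c' f) A (snd c x) vs = 0)"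

section \<open>The function Q\<close>

text \<open>\<open>\<omega>\<^bsup>n-2\<^esup>/(n-2)!\<close>\<close>

definition omega_n2 :: "'n::finite metric \<Rightarrow> 'n form" where
  "omega_n2 g = (\<lambda>p vs. wedge_power (kaehler_form g) (CARD('n) - 2) p vs / fact (CARD('n) - 2))"

text \<open>\<open>- R\<^bsub>i\<bar>jk\<bar>l\<^esub> \<bar>\<partial>f\<^sup>i \<and> \<partial>\<bar>f\<^sup>j \<and> \<partial>f\<^sup>k \<and> \<bar>\<partial>\<bar>f\<^sup>l \<and> \<omega>\<^bsup>n-2\<^esup>/(n-2)!\<close>\<close>

definition curvature_form :: "'n::finite metric \<Rightarrow> 'm::finite metric \<Rightarrow> (complex^'n \<Rightarrow> complex^'m)
    \<Rightarrow> 'n form" where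
  "curvature_form g h F = (\<lambda>p vs. - (\<Sum>i\<in>UNIV. \<Sum>j\<in>UNIV. \<Sum>k\<in>UNIV. \<Sum>l\<in>UNIV.
     curvature h (F p) i j k l *
       wedge (wedge (wedge (wedge (delbar (coord_form F (Inl i))) (del (coord_form F (Inr j))))
         (del (coord_form F (Inl k)))) (delbar (coord_form F (Inr l)))) (omega_n2 g) p vs))"

text \<open>\<open>Q \<omega>\<^sup>n/n!\<close> is the preceding form, in all charts.\<close>

definition defines_Q :: "('a, 'n::finite) chart set \<Rightarrow> (('a, 'n) chart \<Rightarrow> 'n metric)
    \<Rightarrow> ('b, 'm::finite) chart set \<Rightarrow> (('b, 'm) chart \<Rightarrow> 'm metric) \<Rightarrow> ('a \<Rightarrow> 'b)
    \<Rightarrow> ('a \<Rightarrow> real) \<Rightarrow> bool" where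
  "defines_Q \<A> g \<B> h f Q \<longleftrightarrow>
     (\<forall>c\<in>\<A>. \<forall>c'\<in>\<B>. \<forall>x\<in>fst c \<inter> f -` fst c'. \<forall>vs.
        of_real (Q x) * volume_form (g c) (snd c x) vs
          = curvature_form (g c) (h c') (chart_rep c c' f) (snd c x) vs)"

end

theory Submission
  imports Defs
begin

text \<open>At a point, forms are elements of a graded commutative algebra in which contraction with a
  vector is an antiderivation; both facts, and the Leibniz rule for the exterior derivative, follow
  by induction on the list of arguments once the shuffle product is written recursively.

  Lowering the index of \<open>\<bar>\<partial>\<^bsub>E'\<^esub>\<partial>f\<close> removes the inverse metric from the bracket, and the symmetries
  of the derivatives of a Kaehler metric give the exact identity
  \<open>d{\<bar>\<partial>\<^bsub>E'\<^esub>\<partial>f, \<bar>\<partial>f - \<partial>f} = -2 {\<phi>, \<phi>} - 2 R\<^bsub>i\<bar>jk\<bar>l\<^esub> \<bar>\<partial>f\<^sup>i \<and> \<partial>\<bar>f\<^sup>j \<and> \<partial>f\<^sup>k \<and> \<bar>\<partial>\<bar>f\<^sup>l\<close> of 4-forms, where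
  \<open>\<phi> = \<partial>\<^bsub>E'\<^esub>\<bar>\<partial>f = - \<bar>\<partial>\<^bsub>E'\<^esub>\<partial>f\<close>. Harmonicity says that \<open>\<phi>\<close> is trace free, and for trace free \<open>\<phi>\<close> the
  form \<open>{\<phi>, \<phi>} \<and> \<omega>\<^bsup>n-2\<^esup>/(n-2)!\<close> is \<open>-4\<bar>\<phi>\<bar>\<^sup>2 \<omega>\<^sup>n/n!\<close>. Finally \<open>Q\<close> is well defined because the
  curvature form is real and transforms as a tensor.\<close>

text \<open>The forms of the statement are arbitrary functions of lists of vectors, so nothing
  vanishes merely because its degree is too large. Arguments by degree are confined to the span
  \<open>ext_form\<close> of products of coordinate covectors. There every computation against
  powers of \<omega> reduces to contracting a form of degree 2n + 1, and no determinant is expanded.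

  The 8 is (-2)(-4): the -2 counts the two equal mixed products of the (1,0) and (0,1) parts of the
  differential of the conjugate of f, and the 4 is (2\<i>)(-2\<i>), from inverting the factor \<i>/2
  in \<omega>.

  The obstacle lies in Q. It is one function on M, yet every pair of charts prescribes its value, so
  the prescriptions have to agree. The curvature is given by its coordinate formula and not as that
  of a connection; its tensor law is obtained by differentiating the transformation rule of the
  metric twice. The second derivatives of the transition map then occur in both terms of the formula
  and cancel.

  Harmonicity enters through the (1,0) components of \<tau>(f), evaluated on the empty list because
  the star of a form of degree 2n is a function.\<close>

abbreviation sum_univ :: "('i::finite \<Rightarrow> 'a::comm_monoid_add) \<Rightarrow> 'a" (binder "\<Sum>" 10) where
  "sum_univ t \<equiv> sum t UNIV"

section \<open>The algebra of forms at a point\<close>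

text \<open>An argument given to \<beta> has to pass all the arguments that \<alpha> receives later,
  whence the sign on \<alpha>. Recursion on the arguments instead of a sum over subsets makes each
  law of the product an induction that generalizes over both factors.\<close>

primrec wedge_rec :: "'v list \<Rightarrow> ('v list \<Rightarrow> complex) \<Rightarrow> ('v list \<Rightarrow> complex) \<Rightarrow> complex" where
  "wedge_rec [] \<alpha> \<beta> = \<alpha> [] * \<beta> []"
| "wedge_rec (X # vs) \<alpha> \<beta> = wedge_rec vs (\<lambda>ws. \<alpha> (X # ws)) \<beta>
     + wedge_rec vs (\<lambda>ws. (-1) ^ length ws * \<alpha> ws) (\<lambda>ws. \<beta> (X # ws))"

lemma wedge_rec_add_left:
  "wedge_rec vs (\<lambda>ws. \<alpha> ws + \<alpha>' ws) \<beta> = wedge_rec vs \<alpha> \<beta> + wedge_rec vs \<alpha>' \<beta>"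
  by (induction vs arbitrary: \<alpha> \<alpha>' \<beta>) (simp_all add: algebra_simps)

lemma wedge_rec_add_right:
  "wedge_rec vs \<alpha> (\<lambda>ws. \<beta> ws + \<beta>' ws) = wedge_rec vs \<alpha> \<beta> + wedge_rec vs \<alpha> \<beta>'"
  by (induction vs arbitrary: \<alpha> \<beta> \<beta>') (simp_all add: algebra_simps)

lemma wedge_rec_scale_left: "wedge_rec vs (\<lambda>ws. c * \<alpha> ws) \<beta> = c * wedge_rec vs \<alpha> \<beta>"
proof (induction vs arbitrary: \<alpha> \<beta>)
  case (Cons X vs)
  have "wedge_rec vs (\<lambda>ws. (-1) ^ length ws * (c * \<alpha> ws)) \<gamma>
      = c * wedge_rec vs (\<lambda>ws. (-1) ^ length ws * \<alpha> ws) \<gamma>" for \<gamma>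
    using Cons[of "\<lambda>ws. (-1) ^ length ws * \<alpha> ws" \<gamma>] by (simp add: mult.left_commute)
  with Cons[of "\<lambda>ws. \<alpha> (X # ws)" \<beta>] show ?case by (simp add: algebra_simps)
qed simp

lemma wedge_rec_scale_right: "wedge_rec vs \<alpha> (\<lambda>ws. c * \<beta> ws) = c * wedge_rec vs \<alpha> \<beta>"
  by (induction vs arbitrary: \<alpha> \<beta>) (simp_all add: algebra_simps)

text \<open>Each argument goes to exactly one factor, so the lengths seen by the two factors add up
  to \<open>length vs\<close>. This moves the sign of the recursion inside a product, which is what
  associativity requires.\<close>

lemma wedge_rec_sign:
  "(-1) ^ length vs * wedge_rec vs \<alpha> \<beta>
    = wedge_rec vs (\<lambda>ws. (-1) ^ length ws * \<alpha> ws) (\<lambda>ws. (-1) ^ length ws * \<beta> ws)"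
proof (induction vs arbitrary: \<alpha> \<beta>)
  case (Cons X vs)
  have left: "wedge_rec vs (\<lambda>ws. - ((-1) ^ length ws * \<alpha> (X # ws))) \<gamma>
      = - wedge_rec vs (\<lambda>ws. (-1) ^ length ws * \<alpha> (X # ws)) \<gamma>" for \<gamma>
    using wedge_rec_scale_left[of vs "-1" "\<lambda>ws. (-1) ^ length ws * \<alpha> (X # ws)" \<gamma>] by simp
  have right: "wedge_rec vs \<gamma> (\<lambda>ws. - ((-1) ^ length ws * \<beta> (X # ws)))
      = - wedge_rec vs \<gamma> (\<lambda>ws. (-1) ^ length ws * \<beta> (X # ws))" for \<gamma>
    using wedge_rec_scale_right[of vs \<gamma> "-1" "\<lambda>ws. (-1) ^ length ws * \<beta> (X # ws)"] by simp
  show ?case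
    using Cons[of "\<lambda>ws. \<alpha> (X # ws)" \<beta>] Cons[of "\<lambda>ws. (-1) ^ length ws * \<alpha> ws" "\<lambda>ws. \<beta> (X # ws)"]
    by (simp add: left right distrib_left)
qed simp

lemma wedge_rec_assoc:
  "wedge_rec vs (\<lambda>ws. wedge_rec ws \<alpha> \<beta>) \<gamma> = wedge_rec vs \<alpha> (\<lambda>ws. wedge_rec ws \<beta> \<gamma>)"
  by (induction vs arbitrary: \<alpha> \<beta> \<gamma>)
    (simp_all add: wedge_rec_sign wedge_rec_add_left wedge_rec_add_right)

lemma wedge_rec_one_left: "wedge_rec vs (\<lambda>ws. if ws = [] then c else 0) \<beta> = c * \<beta> vs"
proof (induction vs arbitrary: \<beta>)
  case (Cons X vs)
  have 1: "(\<lambda>ws. (-1) ^ length ws * (if ws = [] then c else 0)) = (\<lambda>ws. if ws = [] then c else (0::complex))"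
    by auto
  have 2: "wedge_rec vs (\<lambda>ws. 0) \<beta> = 0"
    using wedge_rec_scale_left[of vs 0 "\<lambda>_. 0" \<beta>] by simp
  show ?case by (simp only: wedge_rec.simps 1 Cons) (simp add: 2)
qed simp

lemma wedge_rec_one_right: "wedge_rec vs \<alpha> (\<lambda>ws. if ws = [] then c else 0) = c * \<alpha> vs"
proof (induction vs arbitrary: \<alpha>)
  case (Cons X vs)
  have "wedge_rec vs \<gamma> (\<lambda>ws. 0) = 0" for \<gamma>
    using wedge_rec_scale_right[of vs \<gamma> 0 "\<lambda>_. 0"] by simp
  with Cons show ?case by simp
qed simp

text \<open>Splitting the sum over \<open>I\<close> according to whether the first argument goes to \<open>\<alpha>\<close> or to \<open>\<beta>\<close>
  turns the shuffle product into the recursion.\<close>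

lemma wedge_eq_wedge_rec: "wedge \<alpha> \<beta> p vs = wedge_rec vs (\<alpha> p) (\<beta> p)"
proof -
  define S where "S vs \<alpha> \<beta> = (\<Sum>I\<in>Pow {..<length vs}.
     (-1) ^ card {(i, j). i \<in> I \<and> j \<in> {..<length vs} - I \<and> j < i}
       * \<alpha> (nths vs I) * \<beta> (nths vs (- I)))"
    for vs :: "'a tvec list" and \<alpha> \<beta> :: "'a tvec list \<Rightarrow> complex"
  have "S vs \<alpha> \<beta> = wedge_rec vs \<alpha> \<beta>" for \<alpha> \<beta>
  proof (induction vs arbitrary: \<alpha> \<beta>)
    case Nil
    then show ?case by (simp add: S_def)
  next
    case (Cons X vs)
    define n where "n = length vs"
    define inv where "inv k I = {(i, j). i \<in> I \<and> j \<in> {..<k} - I \<and> j < (i::nat)}" for k I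
    define s :: "nat \<Rightarrow> nat set \<Rightarrow> complex" where "s k I = (-1) ^ card (inv k I)" for k I
    have fin: "finite (inv n J)" if "J \<subseteq> {..<n}" for J
      by (rule finite_subset[of _ "{..<n} \<times> {..<n}"]) (use that in \<open>auto simp: inv_def\<close>)
    have Pow_eq: "Pow {..<Suc n} = ((`) Suc) ` Pow {..<n} \<union> (\<lambda>J. insert 0 (Suc ` J)) ` Pow {..<n}"
    proof -
      have 1: "{..<Suc n} = insert 0 (Suc ` {..<n})"
        using lessThan_Suc_eq_insert_0 by blast
      show ?thesis unfolding 1 Pow_insert image_Pow_surj[OF refl, symmetric] by auto
    qed
    have inj: "inj_on ((`) Suc) (Pow {..<n})" "inj_on (\<lambda>J. insert 0 (Suc ` J)) (Pow {..<n})"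
      by (auto simp: inj_on_def)
    have disj: "((`) Suc) ` Pow {..<n} \<inter> (\<lambda>J. insert 0 (Suc ` J)) ` Pow {..<n} = {}"
      by auto
    have s_ins: "s (Suc n) (insert 0 (Suc ` J)) = s n J" if "J \<subseteq> {..<n}" for J
    proof -
      have "inv (Suc n) (insert 0 (Suc ` J)) = (\<lambda>(i, j). (Suc i, Suc j)) ` inv n J"
      proof (intro set_eqI iffI; clarify)
        fix i j assume ij: "(i, j) \<in> inv (Suc n) (insert 0 (Suc ` J))"
        then obtain i' j' where "i = Suc i'" "j = Suc j'"
          by (cases i; cases j) (auto simp: inv_def)
        with ij show "(i, j) \<in> (\<lambda>(i, j). (Suc i, Suc j)) ` inv n J"
          by (auto simp: inv_def image_iff)
      qed (auto simp: inv_def)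
      moreover have "inj_on (\<lambda>(i, j). (Suc i, Suc j)) (inv n J)" by (auto simp: inj_on_def)
      ultimately show ?thesis by (simp add: s_def card_image)
    qed
    have len: "length (nths vs J) = card J" if "J \<subseteq> {..<n}" for J
    proof -
      have "{i. i < length vs \<and> i \<in> J} = J" using that by (auto simp: n_def)
      then show ?thesis by (simp add: length_nths)
    qed
    \<comment> \<open>Here 0 is outside the subset. Besides the shifted inversions of
      \<open>J\<close>, each of its elements forms one inversion with 0; these produce the sign of
      the recursion.\<close>
    have s_shift: "s (Suc n) (Suc ` J) = (-1) ^ length (nths vs J) * s n J" if "J \<subseteq> {..<n}" for J
    proof -
      have eq: "inv (Suc n) (Suc ` J) = (\<lambda>(i, j). (Suc i, Suc j)) ` inv n J \<union> (\<lambda>i. (Suc i, 0)) ` J"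
      proof (intro set_eqI iffI; clarify)
        fix i j assume ij: "(i, j) \<in> inv (Suc n) (Suc ` J)"
          and "(i, j) \<notin> (\<lambda>i. (Suc i, 0)) ` J"
        then obtain i' j' where "i = Suc i'" "j = Suc j'"
          by (cases i; cases j) (auto simp: inv_def)
        with ij show "(i, j) \<in> (\<lambda>(i, j). (Suc i, Suc j)) ` inv n J"
          by (auto simp: inv_def image_iff)
      qed (auto simp: inv_def)
      have inj2: "inj_on (\<lambda>(i, j). (Suc i, Suc j)) (inv n J)" by (auto simp: inj_on_def)
      have inj3: "inj_on (\<lambda>i. (Suc i, 0::nat)) J" by (auto simp: inj_on_def)
      have "finite J" using that finite_subset by blast
      then have "card (inv (Suc n) (Suc ` J)) = card (inv n J) + card J"
        unfolding eq using fin[OF that]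
        by (subst card_Un_disjoint) (auto simp: card_image[OF inj2] card_image[OF inj3])
      then show ?thesis by (simp add: s_def len[OF that] power_add)
    qed
    have nths1: "nths (X # vs) (Suc ` J) = nths vs J" "nths (X # vs) (- (Suc ` J)) = X # nths vs (- J)"
      "nths (X # vs) (insert 0 (Suc ` J)) = X # nths vs J"
      "nths (X # vs) (- (insert 0 (Suc ` J))) = nths vs (- J)" for J
    proof -
      have "{j. Suc j \<in> Suc ` J} = J" "{j. Suc j \<in> - (Suc ` J)} = - J"
        "{j. Suc j \<in> insert 0 (Suc ` J)} = J" "{j. Suc j \<in> - (insert 0 (Suc ` J))} = - J" by auto
      then show "nths (X # vs) (Suc ` J) = nths vs J" "nths (X # vs) (- (Suc ` J)) = X # nths vs (- J)"
        "nths (X # vs) (insert 0 (Suc ` J)) = X # nths vs J"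
        "nths (X # vs) (- (insert 0 (Suc ` J))) = nths vs (- J)"
        by (simp_all only: nths_Cons) auto
    qed
    have S_s: "S vs \<alpha> \<beta> = (\<Sum>I\<in>Pow {..<length vs}. s (length vs) I * \<alpha> (nths vs I) * \<beta> (nths vs (- I)))"
      for vs \<alpha> \<beta> by (simp add: S_def s_def inv_def)
    have "S (X # vs) \<alpha> \<beta> = (\<Sum>I\<in>Pow {..<Suc n}. s (Suc n) I * \<alpha> (nths (X # vs) I) * \<beta> (nths (X # vs) (- I)))"
      by (simp only: S_s n_def list.size add_Suc_right add_0_right)
    also have "\<dots> = (\<Sum>J\<in>Pow {..<n}. s (Suc n) (Suc ` J) * \<alpha> (nths vs J) * \<beta> (X # nths vs (- J)))
       + (\<Sum>J\<in>Pow {..<n}. s (Suc n) (insert 0 (Suc ` J)) * \<alpha> (X # nths vs J) * \<beta> (nths vs (- J)))"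
      unfolding Pow_eq
      by (subst sum.union_disjoint) (simp_all add: disj sum.reindex inj nths1)
    also have "(\<Sum>J\<in>Pow {..<n}. s (Suc n) (Suc ` J) * \<alpha> (nths vs J) * \<beta> (X # nths vs (- J)))
      = S vs (\<lambda>ws. (-1) ^ length ws * \<alpha> ws) (\<lambda>ws. \<beta> (X # ws))"
      unfolding S_s by (intro sum.cong refl) (simp_all add: s_shift[unfolded n_def] n_def)
    also have "(\<Sum>J\<in>Pow {..<n}. s (Suc n) (insert 0 (Suc ` J)) * \<alpha> (X # nths vs J) * \<beta> (nths vs (- J)))
      = S vs (\<lambda>ws. \<alpha> (X # ws)) \<beta>"
      unfolding S_s by (intro sum.cong refl) (simp_all add: s_ins[unfolded n_def] n_def)
    finally show ?case by (simp add: Cons)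
  qed
  then show ?thesis by (simp add: wedge_def S_def)
qed

text \<open>Arbitrary functions of the list of arguments: all degrees live in one ring, and neither
  linearity nor alternation is required.\<close>

typedef 'v cochain = "UNIV :: ('v list \<Rightarrow> complex) set"
  morphisms ev Cochain by simp

lemmas ev_Cochain [simp] = Cochain_inverse[OF UNIV_I]

lemma cochain_eqI: "(\<And>vs. ev a vs = ev b vs) \<Longrightarrow> a = b"
  by (metis ev_inverse ext)

instantiation cochain :: (type) ring_1
begin

definition "0 = Cochain (\<lambda>_. 0)"
definition "1 = Cochain (\<lambda>vs. if vs = [] then 1 else 0)"
definition "a + b = Cochain (\<lambda>vs. ev a vs + ev b vs)"
definition "- a = Cochain (\<lambda>vs. - ev a vs)"
definition "a - b = Cochain (\<lambda>vs. ev a vs - ev b vs)"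
definition "a * b = Cochain (\<lambda>vs. wedge_rec vs (ev a) (ev b))"

instance
proof
  fix a b c :: "'a cochain"
  show "a * b * c = a * (b * c)"
    by (simp add: times_cochain_def wedge_rec_assoc)
  show "1 * a = a" "a * 1 = a"
    by (simp_all add: times_cochain_def one_cochain_def wedge_rec_one_left wedge_rec_one_right ev_inverse)
  show "(a + b) * c = a * c + b * c" "a * (b + c) = a * b + a * c"
    by (simp_all add: times_cochain_def plus_cochain_def wedge_rec_add_left wedge_rec_add_right)
  show "a + b + c = a + (b + c)" "a + b = b + a" "0 + a = a" "- a + a = 0" "a - b = a + - b"
    by (simp_all add: plus_cochain_def zero_cochain_def uminus_cochain_def minus_cochain_def ev_inverse
        ac_simps)
  have "ev (0::'a cochain) [] \<noteq> ev (1::'a cochain) []"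
    by (simp add: zero_cochain_def one_cochain_def)
  then show "(0::'a cochain) \<noteq> 1" by metis
qed

end

lemma ev_0 [simp]: "ev 0 vs = 0" by (simp add: zero_cochain_def)
lemma ev_1: "ev 1 vs = (if vs = [] then 1 else 0)" by (simp add: one_cochain_def)
lemma ev_add [simp]: "ev (a + b) vs = ev a vs + ev b vs" by (simp add: plus_cochain_def)
lemma ev_minus [simp]: "ev (- a) vs = - ev a vs" by (simp add: uminus_cochain_def)
lemma ev_diff [simp]: "ev (a - b) vs = ev a vs - ev b vs" by (simp add: minus_cochain_def)
lemma ev_mult: "ev (a * b) vs = wedge_rec vs (ev a) (ev b)" by (simp add: times_cochain_def)

lemma ev_sum [simp]: "ev (sum a S) vs = (\<Sum>i\<in>S. ev (a i) vs)"
  by (induction S rule: infinite_finite_induct) simp_all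

section \<open>Scalars, contraction and the degree involution\<close>

definition cst :: "complex \<Rightarrow> 'v cochain" where
  "cst c = Cochain (\<lambda>vs. if vs = [] then c else 0)"

definition iota :: "'v \<Rightarrow> 'v cochain \<Rightarrow> 'v cochain" where
  "iota X a = Cochain (\<lambda>vs. ev a (X # vs))"

definition sg :: "'v cochain \<Rightarrow> 'v cochain" where
  "sg a = Cochain (\<lambda>vs. (-1) ^ length vs * ev a vs)"

lemma ev_cst_mult [simp]: "ev (cst c * a) vs = c * ev a vs"
  by (simp add: ev_mult cst_def wedge_rec_one_left)

lemma ev_cst: "ev (cst c) vs = (if vs = [] then c else 0)" by (simp add: cst_def)

lemma cst_commute: "a * cst c = cst c * a"
  by (rule cochain_eqI) (simp add: ev_mult cst_def wedge_rec_one_left wedge_rec_one_right)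

lemma cst_left_commute: "a * (cst c * b) = cst c * (a * b)"
  by (metis cst_commute mult.assoc)

lemma cst_0 [simp]: "cst 0 = 0" and cst_1 [simp]: "cst 1 = 1"
  by (simp_all add: cst_def zero_cochain_def one_cochain_def)

lemma cst_add: "cst (c + d) = cst c + cst d"
  and cst_mult: "cst (c * d) = cst c * cst d"
  and cst_minus: "cst (- c) = - cst c"
  and cst_diff: "cst (c - d) = cst c - cst d"
  by (rule cochain_eqI; simp add: ev_cst)+

lemma cst_cst: "cst c * (cst d * a) = cst (c * d) * a"
  by (simp add: cst_mult mult.assoc)

lemma cst_mult_mult: "cst c * a * (cst d * b) = cst (c * d) * (a * b)"
  by (metis cst_left_commute cst_mult mult.assoc)

lemma cst_sum: "cst (sum c S) = (\<Sum>i\<in>S. cst (c i))"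
  by (rule cochain_eqI) (simp add: ev_cst)

lemma cst_cancel: "cst c * a = cst c * b \<Longrightarrow> c \<noteq> 0 \<Longrightarrow> a = b"
  by (rule cochain_eqI) (metis ev_cst_mult mult_cancel_left)

lemma cochain_double_eq_0: "a = - a \<Longrightarrow> a = (0::'v cochain)"
proof (rule cochain_eqI)
  fix vs assume "a = - a"
  then have "ev a vs = - ev a vs" by (metis ev_minus)
  then show "ev a vs = ev 0 vs" by simp
qed

lemma ev_iota [simp]: "ev (iota X a) vs = ev a (X # vs)" by (simp add: iota_def)
lemma ev_sg [simp]: "ev (sg a) vs = (-1) ^ length vs * ev a vs" by (simp add: sg_def)

lemma iota_add [simp]: "iota X (a + b) = iota X a + iota X b"
  and iota_diff [simp]: "iota X (a - b) = iota X a - iota X b"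
  and iota_minus [simp]: "iota X (- a) = - iota X a"
  and iota_0 [simp]: "iota X 0 = 0"
  and iota_1 [simp]: "iota X 1 = 0"
  and iota_cst [simp]: "iota X (cst c) = 0"
  and iota_scale [simp]: "iota X (cst c * a) = cst c * iota X a"
  by (rule cochain_eqI; simp add: ev_1 ev_cst)+

lemma iota_sum [simp]: "iota X (sum a S) = (\<Sum>i\<in>S. iota X (a i))"
  by (rule cochain_eqI) simp

lemma sg_add [simp]: "sg (a + b) = sg a + sg b"
  and sg_minus [simp]: "sg (- a) = - sg a"
  and sg_cst [simp]: "sg (cst c) = cst c"
  and sg_sg [simp]: "sg (sg a) = a"
  and iota_sg: "iota X (sg a) = - sg (iota X a)"
  by (rule cochain_eqI; simp add: ev_1 ev_cst algebra_simps flip: power_mult_distrib)+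

lemma sg_mult [simp]: "sg (a * b) = sg a * sg b"
  by (rule cochain_eqI) (simp add: ev_mult wedge_rec_sign sg_def)

lemma sg_sum [simp]: "sg (sum a S) = (\<Sum>i\<in>S. sg (a i))"
  by (rule cochain_eqI) (simp add: sum_distrib_left)

text \<open>This is the recursion of \<open>wedge_rec\<close> itself. It turns later inductions on
  the list of arguments into inductions by contraction.\<close>

lemma iota_mult: "iota X (a * b) = iota X a * b + sg a * iota X b"
  by (rule cochain_eqI) (simp add: ev_mult iota_def sg_def)

lemma ev_mult_Nil: "ev (a * b) [] = ev a [] * ev b []"
  by (simp add: ev_mult)

lemma ev_mult_Cons: "ev (a * b) (X # vs) = ev (iota X a * b) vs + ev (sg a * iota X b) vs"
  by (metis ev_iota ev_add iota_mult)

section \<open>Parity, graded commutativity and degree\<close>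

definition even_form :: "'v cochain \<Rightarrow> bool" where "even_form a \<longleftrightarrow> sg a = a"
definition odd_form :: "'v cochain \<Rightarrow> bool" where "odd_form a \<longleftrightarrow> sg a = - a"

text \<open>Contraction exchanges the parities, so the two claims feed each other and are proved in
  one induction. The factor \<open>b\<close> may be of mixed degree: in the odd case
  \<open>sg b\<close> carries its sign.\<close>

lemma graded_commute:
  "(even_form a \<longrightarrow> a * b = b * a) \<and> (odd_form a \<longrightarrow> a * b = sg b * a)"
proof -
  have "(even_form a \<longrightarrow> ev (a * b) vs = ev (b * a) vs) \<and> (odd_form a \<longrightarrow> ev (a * b) vs = ev (sg b * a) vs)"
    for vs
  proof (induction vs arbitrary: a b)
    case Nil
    then show ?case by (simp add: ev_mult_Nil)
  next
    case (Cons X vs)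
    show ?case
    proof (intro conjI impI)
      assume a: "even_form a"
      then have "odd_form (iota X a)"
        by (metis even_form_def odd_form_def iota_sg minus_minus)
      then have "ev (iota X a * b) vs = ev (sg b * iota X a) vs"
        using Cons by blast
      moreover have "ev (a * iota X b) vs = ev (iota X b * a) vs" using Cons a by blast
      ultimately show "ev (a * b) (X # vs) = ev (b * a) (X # vs)"
        using a by (simp add: ev_mult_Cons even_form_def)
    next
      assume a: "odd_form a"
      then have "even_form (iota X a)"
        by (metis even_form_def odd_form_def iota_sg iota_minus minus_minus)
      then have "ev (iota X a * b) vs = ev (b * iota X a) vs"
        using Cons by blast
      moreover have "ev (a * iota X b) vs = ev (sg (iota X b) * a) vs" using Cons a by blast
      ultimately show "ev (a * b) (X # vs) = ev (sg b * a) (X # vs)"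
        using a by (simp add: ev_mult_Cons odd_form_def iota_sg)
    qed
  qed
  then show ?thesis by (blast intro: cochain_eqI)
qed

lemma even_commute: "even_form a \<Longrightarrow> a * b = b * a"
  using graded_commute by blast

lemma odd_anticommute: "odd_form a \<Longrightarrow> odd_form b \<Longrightarrow> a * b = - (b * a)"
  using graded_commute by (metis odd_form_def mult_minus_left)

lemma odd_square: "odd_form a \<Longrightarrow> a * a = 0"
  by (rule cochain_double_eq_0, rule odd_anticommute)

lemma odd_odd_mult: "odd_form a \<Longrightarrow> odd_form b \<Longrightarrow> even_form (a * b)"
  by (simp_all add: even_form_def odd_form_def)

lemma even_form_scale: "even_form a \<Longrightarrow> even_form (cst c * a)"
  by (simp add: even_form_def)

lemma even_form_sum: "(\<And>i. i \<in> S \<Longrightarrow> even_form (a i)) \<Longrightarrow> even_form (sum a S)"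
  by (simp add: even_form_def)

definition homog :: "nat \<Rightarrow> 'v cochain \<Rightarrow> bool" where
  "homog k a \<longleftrightarrow> (\<forall>vs. length vs \<noteq> k \<longrightarrow> ev a vs = 0)"

lemma homog_mult: "homog j a \<Longrightarrow> homog k b \<Longrightarrow> homog (j + k) (a * b)"
proof -
  have "homog j a \<Longrightarrow> homog k b \<Longrightarrow> length vs \<noteq> j + k \<Longrightarrow> ev (a * b) vs = 0" for vs
  proof (induction vs arbitrary: a b j k)
    case Nil
    then show ?case by (cases "j = 0") (auto simp: ev_mult_Nil homog_def)
  next
    case (Cons X vs)
    have "ev (iota X a * b) vs = 0"
    proof (cases j)
      case 0
      then have "iota X a = 0" using Cons.prems(1) by (intro cochain_eqI) (simp add: homog_def)
      then show ?thesis by simp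
    next
      case (Suc j')
      then have "homog j' (iota X a)" using Cons.prems(1) by (simp add: homog_def)
      then show ?thesis using Cons.IH[of j' "iota X a" k b] Cons.prems Suc by simp
    qed
    moreover have "ev (sg a * iota X b) vs = 0"
    proof (cases k)
      case 0
      then have "iota X b = 0" using Cons.prems(2) by (intro cochain_eqI) (simp add: homog_def)
      then show ?thesis by simp
    next
      case (Suc k')
      then have "homog k' (iota X b)" "homog j (sg a)" using Cons.prems by (simp_all add: homog_def)
      then show ?thesis using Cons.IH[of j "sg a" k' "iota X b"] Cons.prems Suc by simp
    qed
    ultimately show ?case by (simp add: ev_mult_Cons)
  qed
  then show "homog j a \<Longrightarrow> homog k b \<Longrightarrow> ?thesis" by (simp add: homog_def)
qed

lemma homog_even: "homog k a \<Longrightarrow> even k \<Longrightarrow> even_form a"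
  and homog_odd: "homog k a \<Longrightarrow> odd k \<Longrightarrow> odd_form a"
proof -
  have *: "ev (sg a) vs = (-1) ^ k * ev a vs" if "homog k a" for vs
    using that by (cases "length vs = k") (auto simp: homog_def)
  show "homog k a \<Longrightarrow> even k \<Longrightarrow> even_form a" "homog k a \<Longrightarrow> odd k \<Longrightarrow> odd_form a"
    unfolding even_form_def odd_form_def by (rule cochain_eqI; simp only: *; simp)+
qed

section \<open>Pullback and conjugation of cochains\<close>

definition pull :: "('v \<Rightarrow> 'w) \<Rightarrow> 'w cochain \<Rightarrow> 'v cochain" where
  "pull T a = Cochain (\<lambda>vs. ev a (map T vs))"

lemma ev_pull [simp]: "ev (pull T a) vs = ev a (map T vs)" by (simp add: pull_def)

lemma iota_pull: "iota X (pull T a) = pull T (iota (T X) a)"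
  by (rule cochain_eqI) simp

lemma pull_add [simp]: "pull T (a + b) = pull T a + pull T b"
  and pull_0 [simp]: "pull T 0 = 0"
  and pull_minus [simp]: "pull T (- a) = - pull T a"
  and pull_1 [simp]: "pull T 1 = 1"
  and pull_cst [simp]: "pull T (cst c) = cst c"
  and pull_sg: "pull T (sg a) = sg (pull T a)"
  by (rule cochain_eqI; simp add: ev_1 ev_cst)+

text \<open>Shuffling splits the list of arguments without looking at the vectors in it, so it
  commutes with applying \<open>T\<close> to each of them.\<close>

lemma pull_mult [simp]: "pull T (a * b) = pull T a * pull T b"
proof (rule cochain_eqI)
  fix vs show "ev (pull T (a * b)) vs = ev (pull T a * pull T b) vs"
    by (induction vs arbitrary: a b) (simp_all add: ev_mult_Nil ev_mult_Cons iota_pull flip: pull_sg)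
qed

lemma pull_sum [simp]: "pull T (sum a S) = (\<Sum>i\<in>S. pull T (a i))"
  by (rule cochain_eqI) simp

lemma pull_power [simp]: "pull T (a ^ k) = pull T a ^ k"
  by (induction k) simp_all

text \<open>With \<open>T = tconj\<close> this is the conjugation \<open>cnj_form\<close> of complex
  forms.\<close>

definition conj_pull :: "('v \<Rightarrow> 'w) \<Rightarrow> 'w cochain \<Rightarrow> 'v cochain" where
  "conj_pull T a = Cochain (\<lambda>vs. cnj (ev a (map T vs)))"

lemma ev_conj_pull [simp]: "ev (conj_pull T a) vs = cnj (ev a (map T vs))" by (simp add: conj_pull_def)

lemma iota_conj_pull: "iota X (conj_pull T a) = conj_pull T (iota (T X) a)"
  by (rule cochain_eqI) simp

lemma conj_pull_add [simp]: "conj_pull T (a + b) = conj_pull T a + conj_pull T b"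
  and conj_pull_diff [simp]: "conj_pull T (a - b) = conj_pull T a - conj_pull T b"
  and conj_pull_minus [simp]: "conj_pull T (- a) = - conj_pull T a"
  and conj_pull_1 [simp]: "conj_pull T 1 = 1"
  and conj_pull_cst [simp]: "conj_pull T (cst c) = cst (cnj c)"
  and conj_pull_sg: "conj_pull T (sg a) = sg (conj_pull T a)"
  by (rule cochain_eqI; simp add: ev_1 ev_cst)+

lemma conj_pull_mult [simp]: "conj_pull T (a * b) = conj_pull T a * conj_pull T b"
proof (rule cochain_eqI)
  fix vs show "ev (conj_pull T (a * b)) vs = ev (conj_pull T a * conj_pull T b) vs"
    by (induction vs arbitrary: a b)
      (simp_all add: ev_mult_Nil ev_mult_Cons iota_conj_pull flip: conj_pull_sg)
qed

lemma conj_pull_sum [simp]: "conj_pull T (sum a S) = (\<Sum>i\<in>S. conj_pull T (a i))"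
  by (rule cochain_eqI) simp

lemma conj_pull_power [simp]: "conj_pull T (a ^ k) = conj_pull T a ^ k"
  by (induction k) simp_all

section \<open>Complexified derivatives\<close>

definition tcomp :: "'n::finite + 'n \<Rightarrow> 'n tvec \<Rightarrow> complex" where
  "tcomp A v = (case A of Inl j \<Rightarrow> fst v $ j | Inr j \<Rightarrow> snd v $ j)"

definition tconj :: "'n::finite tvec \<Rightarrow> 'n tvec" where
  "tconj v = (\<chi> j. cnj (snd v $ j), \<chi> j. cnj (fst v $ j))"

lemma sum_UNIV_sum: "(\<Sum>A. t A) = (\<Sum>j. t (Inl j)) + (\<Sum>j. t (Inr j))"
  for t :: "'a::finite + 'b::finite \<Rightarrow> 'c::comm_monoid_add"
  by (subst UNIV_sum, subst sum.union_disjoint) (auto simp: sum.reindex)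

lemma tcomp_cvec: "tcomp A (cvec B) = (if A = B then 1 else 0)"
  by (auto simp: tcomp_def cvec_def axis_def split: sum.splits)

lemma sum_delta_mult:
  "(\<Sum>j. (if i = j then 1 else 0) * t j) = (t i :: complex)"
  "(\<Sum>j. (if j = i then 1 else 0) * t j) = (t i :: complex)" for i :: "'a::finite"
  by (simp_all add: if_distrib[of "\<lambda>x. x * _"] cong: if_cong)

text \<open>The complexification of a real linear map \<open>D\<close>. It is kept apart from
  differentiation so that it can also be applied to one slot of a second derivative.\<close>

definition clin :: "(complex^'n \<Rightarrow> complex) \<Rightarrow> 'n::finite tvec \<Rightarrow> complex" where
  "clin D v = (\<Sum>j. fst v $ j * ((D (axis j 1) - \<i> * D (axis j \<i>)) / 2)
             + snd v $ j * ((D (axis j 1) + \<i> * D (axis j \<i>)) / 2))"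

lemma cderiv_clin: "cderiv \<phi> p v = clin (frechet_derivative \<phi> (at p)) v"
  by (simp add: cderiv_def clin_def Let_def)

lemma cderiv_has_derivative: "(\<phi> has_derivative D) (at p) \<Longrightarrow> cderiv \<phi> p v = clin D v"
  by (simp add: cderiv_clin flip: frechet_derivative_at)

lemma clin_alt: "clin D v = (\<Sum>j. fst v $ j / 2 * D (axis j 1)
      + (- \<i> * fst v $ j / 2) * D (axis j \<i>)
      + (snd v $ j / 2 * D (axis j 1) + (\<i> * snd v $ j / 2) * D (axis j \<i>)))"
  by (simp add: clin_def field_simps)

lemma clin_add: "clin (\<lambda>w. D w + D' w) v = clin D v + clin D' v"
  unfolding clin_alt sum.distrib[symmetric] by (rule sum.cong) (simp_all add: field_simps)

lemma clin_scale: "clin (\<lambda>w. c * D w) v = c * clin D v" "clin (\<lambda>w. D w * c) v = clin D v * c"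
  unfolding clin_alt sum_distrib_left sum_distrib_right by (rule sum.cong; simp add: field_simps)+

lemma clin_cvec: "clin D (cvec (Inl j)) = (D (axis j 1) - \<i> * D (axis j \<i>)) / 2"
  "clin D (cvec (Inr j)) = (D (axis j 1) + \<i> * D (axis j \<i>)) / 2"
  by (simp_all add: clin_def cvec_def axis_def sum_delta_mult del: times_divide_eq_right)

lemma clin_expand: "clin D v = (\<Sum>A. tcomp A v * clin D (cvec A))"
  by (simp only: sum_UNIV_sum clin_cvec) (simp add: tcomp_def sum.distrib clin_def)

lemma cderiv_expand: "cderiv \<phi> p v = (\<Sum>A. tcomp A v * cderiv \<phi> p (cvec A))"
  unfolding cderiv_clin by (rule clin_expand)

text \<open>A pair of a vector and its conjugate is a real tangent vector, and there the
  complexification is the original map. The chain rule needs this to rewrite the outer derivative as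
  an expression to which \<open>clin\<close> can be applied again.\<close>

lemma clin_real:
  assumes "linear D"
  shows "clin D (w, \<chi> j. cnj (w $ j)) = D w"
proof -
  have w: "w = (\<Sum>j. Re (w $ j) *\<^sub>R axis j 1 + Im (w $ j) *\<^sub>R axis j \<i>)"
  proof (subst vec_eq_iff, rule allI)
    fix i
    have "(Re (w $ j) *\<^sub>R axis j 1 + Im (w $ j) *\<^sub>R axis j \<i>) $ i = (if i = j then w $ j else 0)" for j
      by (simp add: axis_def complex_eq_iff)
    then show "w $ i = (\<Sum>j. Re (w $ j) *\<^sub>R axis j 1 + Im (w $ j) *\<^sub>R axis j \<i>) $ i"
      by simp
  qed
  have "D w = (\<Sum>j. Re (w $ j) *\<^sub>R D (axis j 1) + Im (w $ j) *\<^sub>R D (axis j \<i>))"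
    by (subst w) (simp add: linear_sum[OF assms] linear_add[OF assms] linear_scale[OF assms])
  also have "\<dots> = clin D (w, \<chi> j. cnj (w $ j))"
    unfolding clin_def
  proof (rule sum.cong[OF refl])
    fix j
    have gen: "a *\<^sub>R P + b *\<^sub>R Q
        = (of_real a + \<i> * of_real b) * ((P - \<i> * Q) / 2) + (of_real a - \<i> * of_real b) * ((P + \<i> * Q) / 2)"
      for a b and P Q :: complex
      by (simp add: scaleR_conv_of_real field_simps)
    have "of_real (Re (w $ j)) + \<i> * of_real (Im (w $ j)) = w $ j"
      "of_real (Re (w $ j)) - \<i> * of_real (Im (w $ j)) = cnj (w $ j)"
      by (simp_all add: complex_eq_iff)
    then show "Re (w $ j) *\<^sub>R D (axis j 1) + Im (w $ j) *\<^sub>R D (axis j \<i>)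
      = fst (w, \<chi> j. cnj (w $ j)) $ j * ((D (axis j 1) - \<i> * D (axis j \<i>)) / 2)
        + snd (w, \<chi> j. cnj (w $ j)) $ j * ((D (axis j 1) + \<i> * D (axis j \<i>)) / 2)"
      by (simp add: gen)
  qed
  finally show ?thesis by simp
qed

section \<open>Rules for the complexified derivative\<close>

lemma cderiv_const [simp]: "cderiv (\<lambda>_. c) p v = 0"
  by (subst cderiv_has_derivative[OF has_derivative_const]) (simp add: clin_def)

lemma differentiable_frechet: "\<phi> differentiable (at p) \<Longrightarrow> (\<phi> has_derivative frechet_derivative \<phi> (at p)) (at p)"
  by (simp add: frechet_derivative_works)

lemma cderiv_add:
  assumes "\<phi> differentiable (at p)" "\<psi> differentiable (at p)"
  shows "cderiv (\<lambda>q. \<phi> q + \<psi> q) p v = cderiv \<phi> p v + cderiv \<psi> p v"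
  by (subst cderiv_has_derivative[OF has_derivative_add[OF assms[THEN differentiable_frechet]]])
    (simp add: cderiv_clin clin_add)

lemma cderiv_mult:
  assumes "\<phi> differentiable (at p)" "\<psi> differentiable (at p)"
  shows "cderiv (\<lambda>q. \<phi> q * \<psi> q) p v = cderiv \<phi> p v * \<psi> p + \<phi> p * cderiv \<psi> p v"
  by (subst cderiv_has_derivative[OF has_derivative_mult[OF assms[THEN differentiable_frechet]]])
    (simp add: cderiv_clin clin_add clin_scale)

lemma cderiv_cmult:
  assumes "\<phi> differentiable (at p)"
  shows "cderiv (\<lambda>q. c * \<phi> q) p v = c * cderiv \<phi> p v"
  using cderiv_mult[of "\<lambda>_. c" p \<phi> v] assms by simp

lemma cderiv_minus:
  assumes "\<phi> differentiable (at p)"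
  shows "cderiv (\<lambda>q. - \<phi> q) p v = - cderiv \<phi> p v"
  using cderiv_cmult[OF assms, of "-1" v] by simp

lemma cderiv_sum:
  assumes "\<And>i. i \<in> S \<Longrightarrow> \<phi> i differentiable (at p)"
  shows "cderiv (\<lambda>q. \<Sum>i\<in>S. \<phi> i q) p v = (\<Sum>i\<in>S. cderiv (\<phi> i) p v)"
  using assms
proof (induction S rule: infinite_finite_induct)
  case (insert i S)
  then have "(\<lambda>q. \<Sum>i\<in>S. \<phi> i q) differentiable (at p)" by (intro differentiable_sum) auto
  with insert show ?case by (simp add: cderiv_add)
qed simp_all

lemma cderiv_cnj:
  assumes "\<phi> differentiable (at p)"
  shows "cderiv (\<lambda>q. cnj (\<phi> q)) p v = cnj (cderiv \<phi> p (tconj v))"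
  by (subst cderiv_has_derivative[OF has_derivative_cnj[OF differentiable_frechet[OF assms]]])
    (simp add: cderiv_clin clin_def tconj_def add.commute)

lemma cderiv_cong:
  assumes "open W" "p \<in> W" "\<And>q. q \<in> W \<Longrightarrow> \<phi> q = \<psi> q"
  shows "cderiv \<phi> p v = cderiv \<psi> p v"
proof -
  have "(\<phi> has_derivative D) (at p) \<longleftrightarrow> (\<psi> has_derivative D) (at p)" for D
    using has_derivative_transform_within_open[of _ D p _ W] assms by metis
  then have "frechet_derivative \<phi> (at p) = frechet_derivative \<psi> (at p)"
    by (simp add: frechet_derivative_def)
  then show ?thesis by (simp add: cderiv_clin)
qed

text \<open>The complexified differential of \<open>G\<close>. As \<open>G\<close> need not be
  holomorphic, each component may depend on both halves of \<open>v\<close>.\<close>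

definition push :: "(complex^'n \<Rightarrow> complex^'m) \<Rightarrow> complex^'n \<Rightarrow> 'n::finite tvec \<Rightarrow> 'm::finite tvec" where
  "push G p v = (\<chi> a. cderiv (\<lambda>q. G q $ a) p v, \<chi> a. cderiv (\<lambda>q. cnj (G q $ a)) p v)"

text \<open>The real chain rule gives \<open>D (DG w)\<close> for real \<open>w\<close>. By
  \<open>clin_real\<close> this is a combination of the components of \<open>DG w\<close> and their
  conjugates with constant coefficients, and \<open>clin\<close> passes through such a combination
  term by term.\<close>

lemma cderiv_chain:
  fixes G :: "complex^'n::finite \<Rightarrow> complex^'m::finite"
  assumes G: "G differentiable (at p)" and \<phi>: "\<phi> differentiable (at (G p))"
  shows "cderiv (\<lambda>q. \<phi> (G q)) p v = cderiv \<phi> (G p) (push G p v)"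
proof -
  define DG where "DG = frechet_derivative G (at p)"
  define D where "D = frechet_derivative \<phi> (at (G p))"
  have DG: "(G has_derivative DG) (at p)" unfolding DG_def by (rule differentiable_frechet[OF G])
  have D: "(\<phi> has_derivative D) (at (G p))" unfolding D_def by (rule differentiable_frechet[OF \<phi>])
  have lin: "linear D" using D has_derivative_linear by blast
  have comp: "((\<lambda>q. \<phi> (G q)) has_derivative (\<lambda>w. D (DG w))) (at p)"
    using diff_chain_at[OF DG D] by (simp add: o_def)
  have c1: "((\<lambda>q. G q $ a) has_derivative (\<lambda>w. DG w $ a)) (at p)" for a
    using DG by (rule bounded_linear.has_derivative[OF bounded_linear_vec_nth])
  have c2: "((\<lambda>q. cnj (G q $ a)) has_derivative (\<lambda>w. cnj (DG w $ a))) (at p)" for a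
    using c1 by (rule has_derivative_cnj)
  have e1: "cderiv (\<lambda>q. \<phi> (G q)) p v = clin (\<lambda>w. clin D (DG w, \<chi> a. cnj (DG w $ a))) v"
    by (simp only: cderiv_has_derivative[OF comp] clin_real[OF lin])
  define t where "t A = clin D (cvec A)" for A :: "'m + 'm"
  have tt: "clin D v = (\<Sum>a. fst v $ a * t (Inl a)) + (\<Sum>a. snd v $ a * t (Inr a))" for v
    by (subst clin_expand) (simp add: sum_UNIV_sum tcomp_def t_def)
  have sm: "clin (\<lambda>w. \<Sum>a\<in>S. F a w) v = (\<Sum>a\<in>S. clin (F a) v)"
    for F :: "'m \<Rightarrow> complex^'n \<Rightarrow> complex" and S
  proof (induction S rule: infinite_finite_induct)
    case (insert x S)
    then show ?case by (simp add: clin_add)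
  qed (simp_all add: clin_def)
  have "cderiv (\<lambda>q. \<phi> (G q)) p v = (\<Sum>a. clin (\<lambda>w. DG w $ a) v * t (Inl a))
      + (\<Sum>a. clin (\<lambda>w. cnj (DG w $ a)) v * t (Inr a))"
    unfolding e1 tt by (simp add: clin_add sm clin_scale)
  also have "\<dots> = clin D (push G p v)"
    unfolding tt by (simp add: push_def cderiv_has_derivative[OF c1] cderiv_has_derivative[OF c2])
  also have "\<dots> = cderiv \<phi> (G p) (push G p v)" by (simp add: cderiv_clin D_def)
  finally show ?thesis .
qed

section \<open>Smooth functions and symmetry of second derivatives\<close>

lemma ck_on_cong:
  assumes "open S" "\<And>x. x \<in> S \<Longrightarrow> \<phi> x = \<psi> x"
  shows "ck_on k \<phi> S \<longleftrightarrow> ck_on k \<psi> S"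
  using assms(2)
proof (induction k arbitrary: \<phi> \<psi>)
  case 0
  then show ?case by (simp cong: continuous_on_cong)
next
  case (Suc k)
  have der: "(\<phi> has_derivative D) (at x) \<longleftrightarrow> (\<psi> has_derivative D) (at x)" if "x \<in> S" for x D
    using has_derivative_transform_within_open[of _ D x _ S] assms(1) Suc.prems that by metis
  then have "\<phi> differentiable (at x) \<longleftrightarrow> \<psi> differentiable (at x)"
    and fr: "frechet_derivative \<phi> (at x) = frechet_derivative \<psi> (at x)" if "x \<in> S" for x
    using that by (simp_all add: differentiable_def frechet_derivative_def)
  moreover have "ck_on k (\<lambda>x. frechet_derivative \<phi> (at x) v) S \<longleftrightarrow> ck_on k (\<lambda>x. frechet_derivative \<psi> (at x) v) S"
      for v
    by (rule Suc.IH) (simp add: fr)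
  ultimately show ?case by auto
qed

lemma ck_on_bounded_linear:
  assumes "open S" "bounded_linear L" "ck_on k \<phi> S"
  shows "ck_on k (\<lambda>x. L (\<phi> x)) S"
  using assms(3)
proof (induction k arbitrary: \<phi>)
  case 0
  then show ?case using bounded_linear.continuous_on[OF assms(2)] by simp
next
  case (Suc k)
  have d: "((\<lambda>x. L (\<phi> x)) has_derivative (\<lambda>w. L (frechet_derivative \<phi> (at x) w))) (at x)" if "x \<in> S" for x
    using Suc.prems that by (intro bounded_linear.has_derivative[OF assms(2)] differentiable_frechet) auto
  have "ck_on k (\<lambda>x. frechet_derivative (\<lambda>x. L (\<phi> x)) (at x) v) S" for v
    using Suc.IH[of "\<lambda>x. frechet_derivative \<phi> (at x) v"] Suc.prems
    by (subst ck_on_cong[OF assms(1)]) (auto simp flip: frechet_derivative_at[OF d])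
  moreover have "\<forall>x\<in>S. (\<lambda>x. L (\<phi> x)) differentiable (at x)" using d differentiable_def by blast
  ultimately show ?case by simp
qed

lemma ck_on_add:
  assumes "open S" "ck_on k \<phi> S" "ck_on k \<psi> S"
  shows "ck_on k (\<lambda>x. \<phi> x + \<psi> x) S"
  using assms(2,3)
proof (induction k arbitrary: \<phi> \<psi>)
  case 0
  then show ?case by (simp add: continuous_on_add)
next
  case (Suc k)
  have d: "((\<lambda>x. \<phi> x + \<psi> x) has_derivative
      (\<lambda>w. frechet_derivative \<phi> (at x) w + frechet_derivative \<psi> (at x) w)) (at x)" if "x \<in> S" for x
    using Suc.prems that by (intro has_derivative_add differentiable_frechet) auto
  have "ck_on k (\<lambda>x. frechet_derivative (\<lambda>x. \<phi> x + \<psi> x) (at x) v) S" for v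
    using Suc.IH[of "\<lambda>x. frechet_derivative \<phi> (at x) v" "\<lambda>x. frechet_derivative \<psi> (at x) v"] Suc.prems
    by (subst ck_on_cong[OF assms(1)]) (auto simp flip: frechet_derivative_at[OF d])
  moreover have "\<forall>x\<in>S. (\<lambda>x. \<phi> x + \<psi> x) differentiable (at x)" using d differentiable_def by blast
  ultimately show ?case by simp
qed

lemma smooth_on_bounded_linear:
  "open S \<Longrightarrow> bounded_linear L \<Longrightarrow> smooth_on \<phi> S \<Longrightarrow> smooth_on (\<lambda>x. L (\<phi> x)) S"
  unfolding smooth_on_def using ck_on_bounded_linear by blast

lemma smooth_on_add:
  "open S \<Longrightarrow> smooth_on \<phi> S \<Longrightarrow> smooth_on \<psi> S \<Longrightarrow> smooth_on (\<lambda>x. \<phi> x + \<psi> x) S"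
  unfolding smooth_on_def using ck_on_add by blast

lemma ck_on_const: "ck_on k (\<lambda>_. c) S"
  by (induction k arbitrary: c) (simp_all add: frechet_derivative_at[OF has_derivative_const, symmetric])

lemma smooth_on_const [simp]: "smooth_on (\<lambda>_. c) S"
  by (simp add: smooth_on_def ck_on_const)

lemma smooth_on_sum:
  assumes "open S" "\<And>i. i \<in> I \<Longrightarrow> smooth_on (\<phi> i) S"
  shows "smooth_on (\<lambda>x. \<Sum>i\<in>I. \<phi> i x) S"
  using assms(2) by (induction I rule: infinite_finite_induct) (simp_all add: smooth_on_add assms(1))

lemma ck_on_mono: "ck_on k \<phi> S \<Longrightarrow> T \<subseteq> S \<Longrightarrow> ck_on k \<phi> T"
  by (induction k arbitrary: \<phi>) (auto intro: continuous_on_subset)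

lemma smooth_on_mono: "smooth_on \<phi> S \<Longrightarrow> T \<subseteq> S \<Longrightarrow> smooth_on \<phi> T"
  unfolding smooth_on_def using ck_on_mono by blast

lemma smooth_on_frechet: "smooth_on \<phi> S \<Longrightarrow> smooth_on (\<lambda>x. frechet_derivative \<phi> (at x) v) S"
  unfolding smooth_on_def
proof
  fix k assume "\<forall>k. ck_on k \<phi> S"
  then have "ck_on (Suc k) \<phi> S" by blast
  then show "ck_on k (\<lambda>x. frechet_derivative \<phi> (at x) v) S" by simp
qed

lemma smooth_on_differentiable: "smooth_on \<phi> S \<Longrightarrow> x \<in> S \<Longrightarrow> \<phi> differentiable (at x)"
  unfolding smooth_on_def by (meson ck_on.simps(2))

lemma smooth_on_continuous: "smooth_on \<phi> S \<Longrightarrow> continuous_on S \<phi>"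
  unfolding smooth_on_def by (meson ck_on.simps(1))

lemma smooth_on_cmult: "open S \<Longrightarrow> smooth_on \<phi> S \<Longrightarrow> smooth_on (\<lambda>x. c * \<phi> x :: complex) S"
  by (rule smooth_on_bounded_linear[OF _ bounded_linear_mult_right])

lemma smooth_on_cnj: "open S \<Longrightarrow> smooth_on \<phi> S \<Longrightarrow> smooth_on (\<lambda>x. cnj (\<phi> x)) S"
  by (rule smooth_on_bounded_linear[OF _ bounded_linear_cnj])

lemma smooth_on_nth: "open S \<Longrightarrow> smooth_on \<phi> S \<Longrightarrow> smooth_on (\<lambda>x. \<phi> x $ i) S"
  by (rule smooth_on_bounded_linear[OF _ bounded_linear_vec_nth])

lemma smooth_on_cderiv:
  assumes "open S" "smooth_on \<phi> S"
  shows "smooth_on (\<lambda>x. cderiv \<phi> x v) S"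
  unfolding cderiv_clin clin_alt
  by (intro smooth_on_sum smooth_on_add smooth_on_cmult smooth_on_frechet assms)

text \<open>Two applications of the mean value theorem: in direction \<open>u\<close> to the
  difference of \<phi> over the step \<open>h *\<^sub>R w\<close>, then in direction
  \<open>w\<close> to the derivative along \<open>u\<close>.\<close>

lemma mixed_difference_quotient:
  fixes \<phi> :: "'a::real_normed_vector \<Rightarrow> real"
  assumes h: "h > 0"
    and W: "\<And>s t. 0 \<le> s \<Longrightarrow> s \<le> h \<Longrightarrow> 0 \<le> t \<Longrightarrow> t \<le> h \<Longrightarrow> p + s *\<^sub>R u + t *\<^sub>R w \<in> W"
    and d1: "\<And>x. x \<in> W \<Longrightarrow> \<phi> differentiable (at x)"
    and d2: "\<And>x. x \<in> W \<Longrightarrow> (\<lambda>x. frechet_derivative \<phi> (at x) u) differentiable (at x)"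
  shows "\<exists>s t. 0 < s \<and> s < h \<and> 0 < t \<and> t < h \<and>
    \<phi> (p + h *\<^sub>R u + h *\<^sub>R w) - \<phi> (p + h *\<^sub>R u) - \<phi> (p + h *\<^sub>R w) + \<phi> p
     = h * h * frechet_derivative (\<lambda>x. frechet_derivative \<phi> (at x) u) (at (p + s *\<^sub>R u + t *\<^sub>R w)) w"
proof -
  have line: "((\<lambda>s. \<psi> (y + s *\<^sub>R v)) has_real_derivative frechet_derivative \<psi> (at (y + s *\<^sub>R v)) v) (at s)"
    if "\<psi> differentiable (at (y + s *\<^sub>R v))" for \<psi> :: "'a \<Rightarrow> real" and y v s
  proof -
    have "((\<lambda>s. y + s *\<^sub>R v) has_derivative (\<lambda>r. r *\<^sub>R v)) (at s)"
      by (auto intro!: derivative_eq_intros)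
    from diff_chain_at[OF this differentiable_frechet[OF that]]
    show ?thesis
      by (simp add: o_def has_field_derivative_def linear_scale[OF linear_frechet_derivative[OF that]]
          mult_commute_abs)
  qed
  let ?g = "\<lambda>x. frechet_derivative \<phi> (at x) u"
  have k: "((\<lambda>s. \<phi> (p + h *\<^sub>R w + s *\<^sub>R u) - \<phi> (p + s *\<^sub>R u)) has_real_derivative
      ?g (p + h *\<^sub>R w + s *\<^sub>R u) - ?g (p + s *\<^sub>R u)) (at s)" if "0 \<le> s" "s \<le> h" for s
    using that h W[of s h] W[of s 0]
    by (intro DERIV_diff line d1) (simp_all add: ac_simps)
  obtain s where s: "0 < s" "s < h" and s_eq:
    "(\<phi> (p + h *\<^sub>R w + h *\<^sub>R u) - \<phi> (p + h *\<^sub>R u)) - (\<phi> (p + h *\<^sub>R w + 0 *\<^sub>R u) - \<phi> (p + 0 *\<^sub>R u))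
      = (h - 0) * (?g (p + h *\<^sub>R w + s *\<^sub>R u) - ?g (p + s *\<^sub>R u))"
    using MVT2[OF h k] by blast
  have k2: "((\<lambda>t. ?g (p + s *\<^sub>R u + t *\<^sub>R w)) has_real_derivative
      frechet_derivative ?g (at (p + s *\<^sub>R u + t *\<^sub>R w)) w) (at t)" if "0 \<le> t" "t \<le> h" for t
    using that s W[of s t] by (intro line d2) simp_all
  obtain t where t: "0 < t" "t < h" and t_eq:
    "?g (p + s *\<^sub>R u + h *\<^sub>R w) - ?g (p + s *\<^sub>R u + 0 *\<^sub>R w)
      = (h - 0) * frechet_derivative ?g (at (p + s *\<^sub>R u + t *\<^sub>R w)) w"
    using MVT2[OF h k2] by blast
  show ?thesis
    using s t s_eq t_eq by (intro exI[of _ s] exI[of _ t]) (simp add: ac_simps)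
qed

text \<open>The second difference over a parallelogram is symmetric in \<open>u\<close> and
  \<open>w\<close>, so on every small parallelogram the two mixed derivatives agree at some pair of
  points; continuity carries this to \<open>p\<close>.\<close>

lemma frechet_commute_real:
  fixes \<phi> :: "'a::real_normed_vector \<Rightarrow> real"
  assumes W: "open W" "p \<in> W" and sm: "smooth_on \<phi> W"
  shows "frechet_derivative (\<lambda>x. frechet_derivative \<phi> (at x) u) (at p) w
    = frechet_derivative (\<lambda>x. frechet_derivative \<phi> (at x) w) (at p) u"
proof (rule ccontr)
  define G where "G u w x = frechet_derivative (\<lambda>x. frechet_derivative \<phi> (at x) u) (at x) w" for u w x
  assume "\<not> ?thesis"
  \<comment> \<open>Half the gap between the two values: if each mixed derivative stays within it of
    its value at \<open>p\<close>, the two cannot agree at nearby points.\<close>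
  then have e: "\<bar>G u w p - G w u p\<bar> / 2 > 0" (is "?e > 0") by (simp add: G_def)
  have cont: "continuous_on W (G u w)" for u w
    unfolding G_def by (intro smooth_on_continuous smooth_on_frechet sm)
  then have "isCont (G u w) p" for u w
    using W continuous_on_eq_continuous_at by blast
  then obtain d1 d2 where d1: "d1 > 0" "\<And>x. dist x p < d1 \<Longrightarrow> dist (G u w x) (G u w p) < ?e"
    and d2: "d2 > 0" "\<And>x. dist x p < d2 \<Longrightarrow> dist (G w u x) (G w u p) < ?e"
    using e unfolding continuous_at_eps_delta by meson
  obtain d3 where d3: "d3 > 0" "ball p d3 \<subseteq> W" using W openE by blast
  define d where "d = min d1 (min d2 d3)"
  have d: "d > 0" using d1 d2 d3 by (simp add: d_def)
  \<comment> \<open>Small enough for the whole parallelogram to lie within distance \<open>d\<close>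
    of \<open>p\<close>; the summand 1 keeps the denominator positive when both directions are
    zero.\<close>
  define h where "h = d / (2 * (norm u + norm w + 1))"
  have n: "norm u + norm w + 1 > 0" by (smt (verit) norm_ge_zero)
  have h: "h > 0" using d n by (simp add: h_def)
  have near: "dist (p + s *\<^sub>R u + t *\<^sub>R w) p < d"
    if "0 \<le> s" "s \<le> h" "0 \<le> t" "t \<le> h" for s t
  proof -
    have "dist (p + s *\<^sub>R u + t *\<^sub>R w) p = norm (s *\<^sub>R u + t *\<^sub>R w)"
      by (simp add: dist_norm add.assoc)
    also have "\<dots> \<le> s * norm u + t * norm w"
      using norm_triangle_ineq[of "s *\<^sub>R u" "t *\<^sub>R w"] that by simp
    also have "\<dots> \<le> h * norm u + h * norm w"
      using that by (intro add_mono mult_right_mono) auto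
    also have "\<dots> < h * (2 * (norm u + norm w + 1))"
    proof -
      have "h * (2 * (norm u + norm w + 1)) = (h * norm u + h * norm w) + (h * norm u + h * norm w) + 2 * h"
        by (simp add: algebra_simps)
      moreover have "h * norm u \<ge> 0" "h * norm w \<ge> 0" using h by simp_all
      ultimately show ?thesis using h by linarith
    qed
    also have "\<dots> = d" using n by (simp add: h_def)
    finally show ?thesis .
  qed
  have inW: "p + s *\<^sub>R u + t *\<^sub>R w \<in> W" "p + s *\<^sub>R w + t *\<^sub>R u \<in> W"
    if "0 \<le> s" "s \<le> h" "0 \<le> t" "t \<le> h" for s t
    using near[OF that] near[OF that(3,4,1,2)] d3
    by (auto simp: d_def dist_commute ac_simps subset_iff)
  have df: "\<And>x. x \<in> W \<Longrightarrow> \<phi> differentiable (at x)"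
    "\<And>x v. x \<in> W \<Longrightarrow> (\<lambda>x. frechet_derivative \<phi> (at x) v) differentiable (at x)"
    using sm smooth_on_differentiable smooth_on_frechet by blast+
  obtain s t where st: "0 < s" "s < h" "0 < t" "t < h" and st_eq:
    "\<phi> (p + h *\<^sub>R u + h *\<^sub>R w) - \<phi> (p + h *\<^sub>R u) - \<phi> (p + h *\<^sub>R w) + \<phi> p
      = h * h * G u w (p + s *\<^sub>R u + t *\<^sub>R w)"
    unfolding G_def using mixed_difference_quotient[OF h, of p u w W \<phi>] inW df by blast
  obtain s' t' where st': "0 < s'" "s' < h" "0 < t'" "t' < h" and st'_eq:
    "\<phi> (p + h *\<^sub>R w + h *\<^sub>R u) - \<phi> (p + h *\<^sub>R w) - \<phi> (p + h *\<^sub>R u) + \<phi> p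
      = h * h * G w u (p + s' *\<^sub>R w + t' *\<^sub>R u)"
    unfolding G_def using mixed_difference_quotient[OF h, of p w u W \<phi>] inW df by blast
  have "h * h * G u w (p + s *\<^sub>R u + t *\<^sub>R w) = h * h * G w u (p + t' *\<^sub>R u + s' *\<^sub>R w)"
  proof -
    have c: "p + h *\<^sub>R w + h *\<^sub>R u = p + h *\<^sub>R u + h *\<^sub>R w"
      "p + s' *\<^sub>R w + t' *\<^sub>R u = p + t' *\<^sub>R u + s' *\<^sub>R w" by simp_all
    show ?thesis using st_eq st'_eq unfolding c by linarith
  qed
  then have "G u w (p + s *\<^sub>R u + t *\<^sub>R w) = G w u (p + t' *\<^sub>R u + s' *\<^sub>R w)"
    using h by simp
  moreover have "dist (G u w (p + s *\<^sub>R u + t *\<^sub>R w)) (G u w p) < ?e"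
    using near[of s t] st by (intro d1) (simp add: d_def)
  moreover have "dist (G w u (p + t' *\<^sub>R u + s' *\<^sub>R w)) (G w u p) < ?e"
    using near[of t' s'] st' by (intro d2) (simp add: d_def)
  ultimately show False by (simp add: dist_real_def abs_if split: if_splits)
qed

lemma frechet_commute:
  fixes \<phi> :: "'a::real_normed_vector \<Rightarrow> complex"
  assumes W: "open W" "p \<in> W" and sm: "smooth_on \<phi> W"
  shows "frechet_derivative (\<lambda>x. frechet_derivative \<phi> (at x) u) (at p) w
    = frechet_derivative (\<lambda>x. frechet_derivative \<phi> (at x) w) (at p) u"
proof -
  have *: "frechet_derivative (\<lambda>x. frechet_derivative (\<lambda>x. L (\<phi> x)) (at x) u) (at p) w
     = L (frechet_derivative (\<lambda>x. frechet_derivative \<phi> (at x) u) (at p) w)"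
    if L: "bounded_linear L" for L :: "complex \<Rightarrow> real" and u w
  proof -
    have 1: "frechet_derivative (\<lambda>x. L (\<phi> x)) (at x) u = L (frechet_derivative \<phi> (at x) u)" if "x \<in> W" for x
      using bounded_linear.has_derivative[OF L differentiable_frechet[OF smooth_on_differentiable[OF sm that]]]
      by (metis frechet_derivative_at)
    have 2: "((\<lambda>x. L (frechet_derivative \<phi> (at x) u)) has_derivative
        (\<lambda>w. L (frechet_derivative (\<lambda>x. frechet_derivative \<phi> (at x) u) (at p) w))) (at p)"
      using sm W by (intro bounded_linear.has_derivative[OF L] differentiable_frechet
          smooth_on_differentiable smooth_on_frechet)
    have "((\<lambda>x. frechet_derivative (\<lambda>x. L (\<phi> x)) (at x) u) has_derivative
        (\<lambda>w. L (frechet_derivative (\<lambda>x. frechet_derivative \<phi> (at x) u) (at p) w))) (at p)"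
      by (rule has_derivative_transform_within_open[OF 2 W]) (simp add: 1)
    then show ?thesis by (metis frechet_derivative_at)
  qed
  have "L (frechet_derivative (\<lambda>x. frechet_derivative \<phi> (at x) u) (at p) w)
     = L (frechet_derivative (\<lambda>x. frechet_derivative \<phi> (at x) w) (at p) u)"
    if L: "bounded_linear L" for L :: "complex \<Rightarrow> real"
    using frechet_commute_real[OF W smooth_on_bounded_linear[OF W(1) L sm], of u w] *[OF L] by simp
  from this[OF bounded_linear_Re] this[OF bounded_linear_Im] show ?thesis
    by (simp add: complex_eq_iff)
qed

text \<open>The complexified second derivative is the bilinear extension of the real Hessian
  \<open>H\<close>. Its symmetry is checked on the frame \<open>cvec\<close>, where it reduces to
  that of \<open>H\<close>, and extended by expanding both slots.\<close>

lemma cderiv_commute: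
  assumes W: "open W" "p \<in> W" and sm: "smooth_on \<phi> W"
  shows "cderiv (\<lambda>q. cderiv \<phi> q u) p v = cderiv (\<lambda>q. cderiv \<phi> q v) p u"
proof -
  define H where "H x y = frechet_derivative (\<lambda>q. frechet_derivative \<phi> (at q) x) (at p) y" for x y
  have H: "H x y = H y x" for x y
    unfolding H_def by (rule frechet_commute[OF W sm])
  have "((\<lambda>q. frechet_derivative \<phi> (at q) x) has_derivative H x) (at p)" for x
    unfolding H_def using sm W by (intro differentiable_frechet smooth_on_differentiable smooth_on_frechet)
  then have "((\<lambda>q. cderiv \<phi> q u) has_derivative (\<lambda>y. clin (\<lambda>x. H x y) u)) (at p)" for u
    unfolding cderiv_clin clin_alt
    by (intro has_derivative_sum has_derivative_add has_derivative_mult_right)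
  then have eq: "cderiv (\<lambda>q. cderiv \<phi> q u) p v = clin (\<lambda>y. clin (\<lambda>x. H x y) u) v" for u v
    by (rule cderiv_has_derivative)
  define Q where "Q u v = clin (\<lambda>y. clin (\<lambda>x. H x y) u) v" for u v
  have QQ: "Q (cvec A) (cvec B) = Q (cvec B) (cvec A)" for A B
  proof (cases A; cases B)
    fix i j
    note [simp] = Q_def clin_cvec
    note flip = H[of "axis i 1" "axis j 1"] H[of "axis i 1" "axis j \<i>"] H[of "axis i \<i>" "axis j 1"]
      H[of "axis i \<i>" "axis j \<i>"]
    show "Q (cvec A) (cvec B) = Q (cvec B) (cvec A)" if "A = Inl i" "B = Inl j"
      using that flip by (simp add: field_simps)
    show "Q (cvec A) (cvec B) = Q (cvec B) (cvec A)" if "A = Inl i" "B = Inr j"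
      using that flip by (simp add: field_simps)
    show "Q (cvec A) (cvec B) = Q (cvec B) (cvec A)" if "A = Inr i" "B = Inl j"
      using that flip by (simp add: field_simps)
    show "Q (cvec A) (cvec B) = Q (cvec B) (cvec A)" if "A = Inr i" "B = Inr j"
      using that flip by (simp add: field_simps)
  qed
  have clin_sum: "clin (\<lambda>w. \<Sum>a\<in>S. F a w) v = (\<Sum>a\<in>S. clin (F a) v)"
    for F :: "'a + 'a \<Rightarrow> complex^'a \<Rightarrow> complex" and S v
    by (induction S rule: infinite_finite_induct) (simp_all add: clin_add, simp_all add: clin_def)
  have Q1: "Q u v = (\<Sum>A. tcomp A u * Q (cvec A) v)" for u v
    unfolding Q_def by (subst clin_expand[of _ u]) (simp add: clin_sum clin_scale)
  have Q2: "Q u v = (\<Sum>B. tcomp B v * Q u (cvec B))" for u v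
    unfolding Q_def by (rule clin_expand)
  have "Q u v = (\<Sum>A. tcomp A u * (\<Sum>B. tcomp B v * Q (cvec B) (cvec A)))"
    by (subst Q1, subst (1) Q2) (simp only: QQ)
  also have "\<dots> = Q v u"
    by (subst (2) Q2, subst (2) Q1) (rule refl)
  finally show ?thesis by (simp add: eq Q_def)
qed

section \<open>Fields of forms\<close>

type_synonym 'n field = "complex^'n \<Rightarrow> 'n tvec cochain"

definition dfield :: "('n::finite tvec \<Rightarrow> 'n tvec) \<Rightarrow> 'n field \<Rightarrow> 'n field" where
  "dfield \<pi> a p = Cochain (d_along \<pi> (\<lambda>q. ev (a q)) p)"

text \<open>The Lie derivative along the constant vector field \<open>X\<close>. The arguments are
  constant fields too and commute with it, so no brackets occur.\<close>

definition lie :: "'n::finite tvec \<Rightarrow> 'n field \<Rightarrow> 'n field" where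
  "lie X a p = Cochain (\<lambda>vs. cderiv (\<lambda>q. ev (a q) vs) p X)"

lemma ev_lie [simp]: "ev (lie X a p) vs = cderiv (\<lambda>q. ev (a q) vs) p X" by (simp add: lie_def)

lemma Cochain_d_along: "Cochain (d_along \<pi> \<alpha> p) = dfield \<pi> (\<lambda>q. Cochain (\<alpha> q)) p"
  by (simp add: dfield_def)

lemma Cochain_wedge: "Cochain (wedge \<alpha> \<beta> p) = Cochain (\<alpha> p) * Cochain (\<beta> p)"
proof -
  have "wedge \<alpha> \<beta> p = (\<lambda>vs. wedge_rec vs (\<alpha> p) (\<beta> p))"
    by (rule ext) (rule wedge_eq_wedge_rec)
  then show ?thesis by (simp add: times_cochain_def)
qed

lemma ev_dfield_Nil: "ev (dfield \<pi> a p) [] = 0"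
  by (simp add: dfield_def d_along_def)

lemma ev_dfield_Cons:
  "ev (dfield \<pi> a p) (X # vs) = cderiv (\<lambda>q. ev (a q) vs) p (\<pi> X) - ev (dfield \<pi> (\<lambda>q. iota X (a q)) p) vs"
  by (simp add: dfield_def d_along_def sum.lessThan_Suc_shift sum_negf del: sum.lessThan_Suc)

text \<open>Cartan's formula for a constant field, with the direction of differentiation projected.
  It isolates the summand of \<open>d_along\<close> in which the first argument is the
  direction.\<close>

lemma iota_dfield: "iota X (dfield \<pi> a p) = lie (\<pi> X) a p - dfield \<pi> (\<lambda>q. iota X (a q)) p"
  by (rule cochain_eqI) (simp add: ev_dfield_Cons)

section \<open>Differentiable fields of forms and the Leibniz rule\<close>

definition fdiff :: "'n::finite field \<Rightarrow> complex^'n \<Rightarrow> bool" where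
  "fdiff a p \<longleftrightarrow> (\<forall>vs. (\<lambda>q. ev (a q) vs) differentiable (at p))"

lemma fdiffD: "fdiff a p \<Longrightarrow> (\<lambda>q. ev (a q) vs) differentiable (at p)"
  by (simp add: fdiff_def)

lemma fdiff_iota: "fdiff a p \<Longrightarrow> fdiff (\<lambda>q. iota X (a q)) p"
  by (simp add: fdiff_def)

lemma fdiff_sg: "fdiff a p \<Longrightarrow> fdiff (\<lambda>q. sg (a q)) p"
  by (simp add: fdiff_def)

lemma fdiff_add: "fdiff a p \<Longrightarrow> fdiff b p \<Longrightarrow> fdiff (\<lambda>q. a q + b q) p"
  and fdiff_diff: "fdiff a p \<Longrightarrow> fdiff b p \<Longrightarrow> fdiff (\<lambda>q. a q - b q) p"
  and fdiff_minus: "fdiff a p \<Longrightarrow> fdiff (\<lambda>q. - a q) p"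
  by (simp_all add: fdiff_def)

lemma fdiff_const: "fdiff (\<lambda>_. c) p"
  by (simp add: fdiff_def)

lemma fdiff_sum: "(\<And>i. i \<in> S \<Longrightarrow> fdiff (a i) p) \<Longrightarrow> fdiff (\<lambda>q. \<Sum>i\<in>S. a i q) p"
  by (cases "finite S") (auto simp: fdiff_def intro!: differentiable_sum)

lemma fdiff_cst: "fdiff (\<lambda>q. cst (\<phi> q)) p \<longleftrightarrow> \<phi> differentiable (at p)"
proof
  assume "fdiff (\<lambda>q. cst (\<phi> q)) p"
  from fdiffD[OF this, of "[]"] show "\<phi> differentiable (at p)" by (simp add: ev_cst)
next
  assume "\<phi> differentiable (at p)"
  then show "fdiff (\<lambda>q. cst (\<phi> q)) p"
    unfolding fdiff_def by (intro allI, case_tac "vs = []") (simp_all add: ev_cst)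
qed

lemma fdiff_mult: "fdiff a p \<Longrightarrow> fdiff b p \<Longrightarrow> fdiff (\<lambda>q. a q * b q) p"
proof -
  have "fdiff a p \<Longrightarrow> fdiff b p \<Longrightarrow> (\<lambda>q. ev (a q * b q) vs) differentiable (at p)" for vs
  proof (induction vs arbitrary: a b)
    case Nil
    then show ?case by (simp add: ev_mult_Nil fdiffD)
  next
    case (Cons X vs)
    then show ?case by (simp add: ev_mult_Cons fdiff_iota fdiff_sg)
  qed
  then show "fdiff a p \<Longrightarrow> fdiff b p \<Longrightarrow> ?thesis" unfolding fdiff_def[of "\<lambda>q. a q * b q"] by blast
qed

lemma fdiff_power: "fdiff a p \<Longrightarrow> fdiff (\<lambda>q. a q ^ k) p"
  by (induction k) (simp_all add: fdiff_mult fdiff_const)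

lemma dfield_cong:
  assumes "open W" "p \<in> W" "\<And>q. q \<in> W \<Longrightarrow> a q = b q"
  shows "dfield \<pi> a p = dfield \<pi> b p"
  unfolding dfield_def d_along_def
  by (intro arg_cong[of _ _ Cochain] ext sum.cong refl arg_cong2[of _ _ _ _ "(*)"] cderiv_cong[OF assms(1,2)])
    (simp add: assms(3))

lemma dfield_add: "fdiff a p \<Longrightarrow> fdiff b p \<Longrightarrow> dfield \<pi> (\<lambda>q. a q + b q) p = dfield \<pi> a p + dfield \<pi> b p"
  by (rule cochain_eqI)
    (simp add: dfield_def d_along_def cderiv_add fdiffD distrib_left sum.distrib)

lemma dfield_minus: "fdiff a p \<Longrightarrow> dfield \<pi> (\<lambda>q. - a q) p = - dfield \<pi> a p"
  by (rule cochain_eqI) (simp add: dfield_def d_along_def cderiv_minus fdiffD sum_negf)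

lemma dfield_diff: "fdiff a p \<Longrightarrow> fdiff b p \<Longrightarrow> dfield \<pi> (\<lambda>q. a q - b q) p = dfield \<pi> a p - dfield \<pi> b p"
  using dfield_add[of a p "\<lambda>q. - b q" \<pi>] by (simp add: dfield_minus fdiff_minus)

lemma dfield_const [simp]: "dfield \<pi> (\<lambda>_. c) p = 0"
  by (rule cochain_eqI) (simp add: dfield_def d_along_def)

lemma dfield_sum:
  "(\<And>i. i \<in> S \<Longrightarrow> fdiff (a i) p) \<Longrightarrow> dfield \<pi> (\<lambda>q. \<Sum>i\<in>S. a i q) p = (\<Sum>i\<in>S. dfield \<pi> (a i) p)"
  by (induction S rule: infinite_finite_induct) (simp_all add: dfield_add fdiff_sum)

lemma cderiv_linear_add: "cderiv \<phi> p (u + v) = cderiv \<phi> p u + cderiv \<phi> p v"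
  unfolding cderiv_clin clin_alt sum.distrib[symmetric] by (rule sum.cong) (simp_all add: field_simps)

lemma dfield_id: "dfield id a p = dfield pr10 a p + dfield pr01 a p"
proof (rule cochain_eqI)
  have *: "cderiv \<phi> p (pr10 v) + cderiv \<phi> p (pr01 v) = cderiv \<phi> p v" for \<phi> and v :: "'a tvec"
    by (simp add: pr10_def pr01_def flip: cderiv_linear_add)
  show "ev (dfield id a p) vs = ev (dfield pr10 a p + dfield pr01 a p) vs" for vs
    unfolding dfield_def d_along_def ev_Cochain ev_add sum.distrib[symmetric] distrib_left[symmetric] *
    by simp
qed

lemma lie_mult:
  "fdiff a p \<Longrightarrow> fdiff b p \<Longrightarrow> lie X (\<lambda>q. a q * b q) p = lie X a p * b p + a p * lie X b p"
proof (rule cochain_eqI)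
  show "fdiff a p \<Longrightarrow> fdiff b p \<Longrightarrow>
    ev (lie X (\<lambda>q. a q * b q) p) vs = ev (lie X a p * b p + a p * lie X b p) vs" for vs
  proof (induction vs arbitrary: a b)
    case Nil
    then show ?case by (simp add: ev_mult_Nil cderiv_mult fdiffD)
  next
    case (Cons Y vs)
    have 1: "iota Y (lie X c p) = lie X (\<lambda>q. iota Y (c q)) p" for c
      by (rule cochain_eqI) simp
    have 2: "sg (lie X c p) = lie X (\<lambda>q. sg (c q)) p" if "fdiff c p" for c
      by (rule cochain_eqI) (simp add: cderiv_cmult fdiffD[OF that])
    have "(\<lambda>q. ev (iota Y (a q) * b q) vs) differentiable (at p)"
      "(\<lambda>q. ev (sg (a q) * iota Y (b q)) vs) differentiable (at p)"
      using Cons.prems by (auto intro!: fdiffD fdiff_mult fdiff_iota fdiff_sg)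
    then show ?case
      using Cons.IH[of "\<lambda>q. iota Y (a q)" b] Cons.IH[of "\<lambda>q. sg (a q)" "\<lambda>q. iota Y (b q)"] Cons.prems
      by (simp add: ev_mult_Cons cderiv_add fdiff_iota fdiff_sg 1 2)
  qed
qed

text \<open>Contraction with the first argument reduces the claim, by Cartan's formula, to the
  Leibniz rule for \<open>lie\<close> and to the induction hypothesis for the two products in
  \<open>iota_mult\<close>.\<close>

lemma dfield_mult:
  "fdiff a p \<Longrightarrow> fdiff b p \<Longrightarrow>
    dfield \<pi> (\<lambda>q. a q * b q) p = dfield \<pi> a p * b p + sg (a p) * dfield \<pi> b p"
proof (rule cochain_eqI)
  show "fdiff a p \<Longrightarrow> fdiff b p \<Longrightarrow>
    ev (dfield \<pi> (\<lambda>q. a q * b q) p) vs = ev (dfield \<pi> a p * b p + sg (a p) * dfield \<pi> b p) vs" for vs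
  proof (induction vs arbitrary: a b)
    case Nil
    then show ?case by (simp add: ev_mult_Nil ev_dfield_Nil)
  next
    case (Cons X vs)
    \<comment> \<open>The derivative raises the degree by one and hence anticommutes with the degree
      involution.\<close>
    have sgd: "dfield \<pi> (\<lambda>q. sg (a q)) p = - sg (dfield \<pi> a p)" if "fdiff a p" for a
    proof (rule cochain_eqI)
      fix vs :: "'a tvec list"
      have e: "(-1::complex) ^ length (take i vs @ drop (Suc i) vs) = - ((-1) ^ length vs)"
        if "i < length vs" for i
      proof -
        define m where "m = length (take i vs @ drop (Suc i) vs)"
        have "length vs = Suc m" using that by (simp add: m_def)
        then show ?thesis unfolding m_def[symmetric] by simp
      qed
      have "ev (dfield \<pi> (\<lambda>q. sg (a q)) p) vs = (\<Sum>i<length vs. - ((-1) ^ length vs) *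
          ((-1) ^ i * cderiv (\<lambda>q. ev (a q) (take i vs @ drop (Suc i) vs)) p (\<pi> (vs ! i))))"
        unfolding dfield_def d_along_def ev_Cochain ev_sg
        by (intro sum.cong refl) (simp only: lessThan_iff e cderiv_cmult[OF fdiffD[OF that]] mult.left_commute)
      then show "ev (dfield \<pi> (\<lambda>q. sg (a q)) p) vs = ev (- sg (dfield \<pi> a p)) vs"
        by (simp add: dfield_def d_along_def sum_negf flip: sum_distrib_left)
    qed
    have f: "fdiff (\<lambda>q. iota X (a q) * b q) p" "fdiff (\<lambda>q. sg (a q) * iota X (b q)) p"
      using Cons.prems by (auto intro!: fdiff_mult fdiff_iota fdiff_sg)
    have e1: "ev (lie (\<pi> X) (\<lambda>q. a q * b q) p) vs = ev (lie (\<pi> X) a p * b p + a p * lie (\<pi> X) b p) vs"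
      by (simp only: lie_mult[OF Cons.prems])
    have e2: "ev (dfield \<pi> (\<lambda>q. iota X (a q * b q)) p) vs
       = ev (dfield \<pi> (\<lambda>q. iota X (a q)) p * b p + sg (iota X (a p)) * dfield \<pi> b p) vs
        + ev (- sg (dfield \<pi> a p) * iota X (b p) + a p * dfield \<pi> (\<lambda>q. iota X (b q)) p) vs"
      using Cons.IH[of "\<lambda>q. iota X (a q)" b] Cons.IH[of "\<lambda>q. sg (a q)" "\<lambda>q. iota X (b q)"] Cons.prems f
      by (simp add: iota_mult dfield_add fdiff_iota fdiff_sg sgd)
    have "ev (dfield \<pi> (\<lambda>q. a q * b q) p) (X # vs) = ev (iota X (dfield \<pi> (\<lambda>q. a q * b q) p)) vs" by simp
    also have "\<dots> = ev (iota X (dfield \<pi> a p * b p + sg (a p) * dfield \<pi> b p)) vs"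
      unfolding iota_dfield ev_diff e1 e2
      by (simp add: iota_mult iota_dfield iota_sg algebra_simps)
    finally show ?case by simp
  qed
qed

lemma dfield_scale:
  "\<phi> differentiable (at p) \<Longrightarrow> fdiff a p \<Longrightarrow>
    dfield \<pi> (\<lambda>q. cst (\<phi> q) * a q) p = dfield \<pi> (\<lambda>q. cst (\<phi> q)) p * a p + cst (\<phi> p) * dfield \<pi> a p"
  by (simp add: dfield_mult fdiff_cst)

lemma dfield_cscale: "fdiff a p \<Longrightarrow> dfield \<pi> (\<lambda>q. cst c * a q) p = cst c * dfield \<pi> a p"
  by (simp add: dfield_scale)

section \<open>Smooth fields and iterated exterior derivatives\<close>

definition smooth_field :: "'n::finite field \<Rightarrow> (complex^'n) set \<Rightarrow> bool" where
  "smooth_field a W \<longleftrightarrow> (\<forall>vs. smooth_on (\<lambda>q. ev (a q) vs) W)"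

lemma smooth_field_fdiff: "smooth_field a W \<Longrightarrow> p \<in> W \<Longrightarrow> fdiff a p"
  unfolding smooth_field_def fdiff_def using smooth_on_differentiable by blast

lemma smooth_field_cst: "smooth_on \<phi> W \<Longrightarrow> smooth_field (\<lambda>q. cst (\<phi> q)) W"
  unfolding smooth_field_def by (intro allI, case_tac "vs = []") (simp_all add: ev_cst)

lemma smooth_field_iota: "smooth_field a W \<Longrightarrow> smooth_field (\<lambda>q. iota X (a q)) W"
  by (simp add: smooth_field_def)

lemma smooth_field_dfield: "open W \<Longrightarrow> smooth_field a W \<Longrightarrow> smooth_field (dfield \<pi> a) W"
  unfolding smooth_field_def dfield_def d_along_def
  by (auto intro!: smooth_on_sum smooth_on_cmult smooth_on_cderiv)

text \<open>After two uses of Cartan's formula what remains is that partial derivatives in constant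
  directions commute. Suitable \<pi> and \<rho> give the vanishing of the squares of d, \<partial>
  and \<bar>\<partial> and the anticommutation of the last two.\<close>

lemma dfield_anticommute:
  assumes W: "open W" "p \<in> W" and sm: "smooth_field a W"
  shows "dfield \<pi> (dfield \<rho> a) p = - dfield \<rho> (dfield \<pi> a) p"
proof -
  have "ev (dfield \<pi> (dfield \<rho> a) p) vs + ev (dfield \<rho> (dfield \<pi> a) p) vs = 0" for vs
    using sm
  proof (induction vs arbitrary: a)
    case Nil
    then show ?case by (simp add: ev_dfield_Nil)
  next
    case (Cons X vs)
    have smd: "smooth_on (\<lambda>q. ev (a q) us) W" for us using Cons.prems by (simp add: smooth_field_def)
    have sml: "smooth_field (lie Y a) W" for Y
      using smooth_on_cderiv[OF W(1) smd] by (simp add: smooth_field_def)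
    have lie_d: "lie Y (dfield \<rho> a) p = dfield \<rho> (lie Y a) p" for Y \<rho>
    proof (rule cochain_eqI)
      fix vs :: "'a tvec list"
      have "cderiv (\<lambda>q. \<Sum>i<length vs. (- 1) ^ i * cderiv (\<lambda>q. ev (a q) (take i vs @ drop (Suc i) vs)) q (\<rho> (vs !
          i))) p Y
        = (\<Sum>i<length vs. (- 1) ^ i * cderiv (\<lambda>q. cderiv (\<lambda>q. ev (a q) (take i vs @ drop (Suc i) vs)) q (\<rho> (vs !
            i))) p Y)"
        by (subst cderiv_sum)
          (auto intro!: sum.cong cderiv_cmult smooth_on_differentiable[OF _ W(2)] smooth_on_cmult
              smooth_on_cderiv smd W)
      also have "\<dots> = (\<Sum>i<length vs. (- 1) ^ i * cderiv (\<lambda>q. cderiv (\<lambda>q. ev (a q) (take i vs @ drop (Suc i) vs))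
          q Y) p (\<rho> (vs ! i)))"
        by (intro sum.cong refl arg_cong2[of _ _ _ _ "(*)"] cderiv_commute[OF W] smd)
      finally show "ev (lie Y (dfield \<rho> a) p) vs = ev (dfield \<rho> (lie Y a) p) vs"
        by (simp add: dfield_def d_along_def)
    qed
    have smi: "smooth_field (\<lambda>q. iota X (a q)) W" by (rule smooth_field_iota[OF Cons.prems])
    have eq: "dfield \<pi> (\<lambda>q. iota X (dfield \<rho> a q)) p
       = dfield \<pi> (lie (\<rho> X) a) p - dfield \<pi> (dfield \<rho> (\<lambda>q. iota X (a q))) p" for \<pi> \<rho>
      unfolding iota_dfield
      by (intro dfield_diff smooth_field_fdiff[OF _ W(2)] sml smooth_field_dfield[OF W(1)] smi)
    have "ev (iota X (dfield \<pi> (dfield \<rho> a) p)) vs + ev (iota X (dfield \<rho> (dfield \<pi> a) p)) vs = 0"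
    proof -
      have *: "iota X (dfield \<pi> (dfield \<rho> a) p) = dfield \<rho> (lie (\<pi> X) a) p
          - (dfield \<pi> (lie (\<rho> X) a) p - dfield \<pi> (dfield \<rho> (\<lambda>q. iota X (a q))) p)" for \<pi> \<rho>
        by (simp only: iota_dfield[of X \<pi> "dfield \<rho> a"] lie_d eq)
      show ?thesis unfolding * using Cons.IH[OF smi] by (simp del: ev_iota)
    qed
    then show ?case by simp
  qed
  then show ?thesis by (intro cochain_eqI) (simp add: eq_neg_iff_add_eq_0)
qed

lemma dfield_dfield:
  assumes "open W" "p \<in> W" "smooth_field a W"
  shows "dfield \<pi> (dfield \<pi> a) p = 0"
  by (rule cochain_double_eq_0, rule dfield_anticommute[OF assms])

lemma tconj_pr: "tconj (pr10 v) = pr01 (tconj v)" "tconj (pr01 v) = pr10 (tconj v)"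
  by (simp_all add: tconj_def pr10_def pr01_def vec_eq_iff)

lemma tconj_tconj [simp]: "tconj (tconj v) = v"
  by (simp add: tconj_def vec_eq_iff)

text \<open>By \<open>tconj_pr\<close> the hypothesis holds when \<pi> and \<rho> are the two
  opposite type projections; conjugation then exchanges \<partial> and \<bar>\<partial>.\<close>

lemma conj_pull_dfield:
  assumes "fdiff a p" "\<And>v. \<pi> (tconj v) = tconj (\<rho> v)"
  shows "conj_pull tconj (dfield \<pi> a p) = dfield \<rho> (\<lambda>q. conj_pull tconj (a q)) p"
  by (rule cochain_eqI)
    (simp add: dfield_def d_along_def cderiv_cnj[OF fdiffD[OF assms(1)]] take_map drop_map assms(2))

section \<open>Degrees and differentials of functions\<close>

lemma homog_dfield: "(\<And>q. homog k (a q)) \<Longrightarrow> homog (Suc k) (dfield \<pi> a p)"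
proof -
  assume a: "\<And>q. homog k (a q)"
  have "(\<Sum>i<length vs. (- 1) ^ i * cderiv (\<lambda>q. ev (a q) (take i vs @ drop (Suc i) vs)) p (\<pi> (vs ! i))) = 0"
    if "length vs \<noteq> Suc k" for vs
  proof (rule sum.neutral, rule ballI)
    fix i assume "i \<in> {..<length vs}"
    then have "length (take i vs @ drop (Suc i) vs) \<noteq> k" using that by auto
    then have "(\<lambda>q. ev (a q) (take i vs @ drop (Suc i) vs)) = (\<lambda>_. 0)" using a by (auto simp: homog_def)
    then show "(- 1) ^ i * cderiv (\<lambda>q. ev (a q) (take i vs @ drop (Suc i) vs)) p (\<pi> (vs ! i)) = 0" by simp
  qed
  then show ?thesis by (simp add: homog_def dfield_def d_along_def)
qed

lemma homog_cst: "homog 0 (cst c)"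
  by (simp add: homog_def ev_cst)

lemma homog_dfun: "homog 1 (dfield \<pi> (\<lambda>q. cst (\<phi> q)) p)"
  unfolding One_nat_def by (rule homog_dfield) (rule homog_cst)

lemma ev_dfun: "ev (dfield \<pi> (\<lambda>q. cst (\<phi> q)) p) [v] = cderiv \<phi> p (\<pi> v)"
  by (simp add: ev_dfield_Cons ev_dfield_Nil ev_cst)

lemma homog1_eqI:
  assumes "homog 1 a" "homog 1 b" "\<And>v. ev a [v] = ev b [v]"
  shows "a = b"
proof (rule cochain_eqI)
  fix vs show "ev a vs = ev b vs"
  proof (cases "length vs = 1")
    case True
    then obtain v where "vs = [v]" by (metis One_nat_def length_0_conv length_Suc_conv)
    then show ?thesis using assms(3) by simp
  qed (use assms(1,2) in \<open>simp add: homog_def\<close>)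
qed

lemma homog_add: "homog k a \<Longrightarrow> homog k b \<Longrightarrow> homog k (a + b)"
  and homog_scale: "homog k a \<Longrightarrow> homog k (cst c * a)"
  and homog_0: "homog k 0"
  by (simp_all add: homog_def)

lemma homog_sum: "(\<And>i. i \<in> S \<Longrightarrow> homog k (a i)) \<Longrightarrow> homog k (sum a S)"
  by (simp add: homog_def)

lemma odd_dfun: "odd_form (dfield \<pi> (\<lambda>q. cst (\<phi> q)) p)"
  by (rule homog_odd[OF homog_dfun]) simp

lemma homog_ddfun: "homog 2 (dfield \<rho> (dfield \<pi> (\<lambda>q. cst (\<phi> q))) p)"
  unfolding numeral_2_eq_2 by (rule homog_dfield) (use homog_dfun in simp)

lemma even_ddfun: "even_form (dfield \<rho> (dfield \<pi> (\<lambda>q. cst (\<phi> q))) p)"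
  by (rule homog_even[OF homog_ddfun]) simp

lemma dfun_chain:
  assumes G: "G differentiable (at p)" and \<phi>: "\<phi> differentiable (at (G p))"
  shows "dfield \<pi> (\<lambda>q. cst (\<phi> (G q))) p
    = (\<Sum>a. cst (cderiv \<phi> (G p) (cvec (Inl a))) * dfield \<pi> (\<lambda>q. cst (G q $ a)) p)
     + (\<Sum>a. cst (cderiv \<phi> (G p) (cvec (Inr a))) * dfield \<pi> (\<lambda>q. cst (cnj (G q $ a))) p)"
proof (rule homog1_eqI)
  fix v
  show "ev (dfield \<pi> (\<lambda>q. cst (\<phi> (G q))) p) [v]
    = ev ((\<Sum>a. cst (cderiv \<phi> (G p) (cvec (Inl a))) * dfield \<pi> (\<lambda>q. cst (G q $ a)) p)
     + (\<Sum>a. cst (cderiv \<phi> (G p) (cvec (Inr a))) * dfield \<pi> (\<lambda>q. cst (cnj (G q $ a))) p)) [v]"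
    by (simp add: ev_dfun cderiv_chain[OF assms], subst cderiv_expand)
      (simp add: sum_UNIV_sum tcomp_def push_def mult.commute)
qed (intro homog_dfun homog_add homog_sum homog_scale)+

section \<open>Linear algebra of the Kaehler form at a point\<close>

text \<open>The coordinate covectors: \<open>theta (Inl j)\<close> is the value of
  \<open>dz j\<close> and \<open>theta (Inr j)\<close> that of \<open>dzbar j\<close>, at every
  point.\<close>

definition theta :: "'n::finite + 'n \<Rightarrow> 'n tvec cochain" where
  "theta A = Cochain (\<lambda>vs. if length vs = 1 then tcomp A (hd vs) else 0)"

definition thetas :: "('n::finite + 'n) list \<Rightarrow> 'n tvec cochain" where
  "thetas As = prod_list (map theta As)"

lemma thetas_simps [simp]: "thetas [] = 1" "thetas (A # As) = theta A * thetas As"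
  "thetas (As @ Bs) = thetas As * thetas Bs"
  by (simp_all add: thetas_def)

lemma ev_theta: "ev (theta A) [v] = tcomp A v"
  by (simp add: theta_def)

lemma homog_theta: "homog 1 (theta A)"
  by (simp add: homog_def theta_def)

lemma odd_theta: "odd_form (theta A)"
  by (rule homog_odd[OF homog_theta]) simp

lemma sg_theta [simp]: "sg (theta A) = - theta A"
  using odd_theta by (simp add: odd_form_def)

lemma iota_theta [simp]: "iota X (theta A) = cst (tcomp A X)"
  by (rule cochain_eqI) (simp add: theta_def ev_cst)

lemma theta_commute: "theta A * theta B = - (theta B * theta A)"
  by (rule odd_anticommute[OF odd_theta odd_theta])

lemma homog_thetas: "homog (length As) (thetas As)"
proof (induction As)
  case (Cons A As)
  then show ?case using homog_mult[OF homog_theta[of A]] by simp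
qed (simp add: homog_def ev_1)

text \<open>Moving one of two equal covectors through the factors between them produces a square,
  and odd elements have square zero.\<close>

lemma thetas_not_distinct: "\<not> distinct As \<Longrightarrow> thetas As = 0"
proof -
  assume "\<not> distinct As"
  then obtain xs ys zs A where As: "As = xs @ [A] @ ys @ [A] @ zs" by (metis not_distinct_decomp)
  have "theta A * thetas ys * theta A = sg (thetas ys) * (theta A * theta A)"
  proof -
    have "theta A * thetas ys = sg (thetas ys) * theta A"
      using graded_commute odd_theta by blast
    then show ?thesis by (simp only: mult.assoc)
  qed
  also have "\<dots> = 0" by (simp add: odd_square odd_theta)
  finally have "theta A * (thetas ys * theta A) = 0" by (simp add: mult.assoc)
  then have "thetas xs * (theta A * (thetas ys * theta A)) * thetas zs = 0" by simp
  then show ?thesis unfolding As thetas_simps by (simp only: mult.assoc mult_1_right mult_1_left)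
qed

text \<open>The genuine exterior forms of degree \<open>k\<close> among all cochains. Multilinearity
  in the arguments and vanishing above the top degree are available on this span.\<close>

inductive ext_form :: "nat \<Rightarrow> 'n::finite tvec cochain \<Rightarrow> bool" where
  zero: "ext_form k 0"
| plus: "length As = k \<Longrightarrow> ext_form k a \<Longrightarrow> ext_form k (cst c * thetas As + a)"

lemma ext_form_thetas: "ext_form (length As) (thetas As)"
  using ext_form.plus[OF refl ext_form.zero, of As 1] by simp

lemma ext_form_add: "ext_form k a \<Longrightarrow> ext_form k b \<Longrightarrow> ext_form k (a + b)"
  by (induction rule: ext_form.induct) (auto simp: add.assoc intro: ext_form.intros)

lemma ext_form_scale: "ext_form k a \<Longrightarrow> ext_form k (cst c * a)"
proof (induction rule: ext_form.induct)
  case (plus As k a d)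
  then show ?case using ext_form.plus[OF plus(1,3), of "c * d"] by (simp add: distrib_left cst_mult mult.assoc)
qed (simp add: ext_form.zero)

lemma ext_form_minus: "ext_form k a \<Longrightarrow> ext_form k (- a)"
  using ext_form_scale[of k a "-1"] by (simp add: cst_minus)

lemma ext_form_diff: "ext_form k a \<Longrightarrow> ext_form k b \<Longrightarrow> ext_form k (a - b)"
  using ext_form_add[OF _ ext_form_minus, of k a b] by simp

lemma ext_form_sum: "(\<And>i. i \<in> S \<Longrightarrow> ext_form k (a i)) \<Longrightarrow> ext_form k (sum a S)"
  by (induction S rule: infinite_finite_induct) (auto intro: ext_form_add ext_form.zero)

lemma ext_form_theta: "ext_form 1 (theta A)"
  using ext_form_thetas[of "[A]"] by simp

lemma ext_form_1: "ext_form 0 1"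
  using ext_form_thetas[of "[]"] by simp

lemma ext_form_mult: "ext_form j a \<Longrightarrow> ext_form k b \<Longrightarrow> ext_form (j + k) (a * b)"
proof (induction rule: ext_form.induct)
  case (plus As j a c)
  note IH = plus
  from \<open>ext_form k b\<close> have "ext_form (j + k) (thetas As * b)"
  proof (induction rule: ext_form.induct)
    case (plus Bs k b d)
    have "ext_form (j + k) (cst d * thetas (As @ Bs) + thetas As * b)"
      by (rule ext_form.plus) (use plus IH in auto)
    then show ?case by (simp add: distrib_left cst_left_commute mult.assoc)
  qed (simp add: ext_form.zero)
  then show ?case using plus by (simp add: distrib_right mult.assoc ext_form_add ext_form_scale)
qed (simp add: ext_form.zero)

lemma ext_form_theta2: "ext_form 2 (theta A * theta B)"
  using ext_form_mult[OF ext_form_theta ext_form_theta, of A B] by (simp add: numeral_2_eq_2)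

lemma ext_form_power: "ext_form j a \<Longrightarrow> ext_form (j * k) (a ^ k)"
  by (induction k) (auto intro: ext_form_1 ext_form_mult)

lemma homog_ext_form: "ext_form k a \<Longrightarrow> homog k a"
  by (induction rule: ext_form.induct) (use homog_thetas in \<open>auto simp: homog_0 intro: homog_add homog_scale\<close>)

text \<open>There are 2n coordinate covectors, so a longer product repeats one of them.\<close>

lemma ext_form_vanish:
  assumes "ext_form k (a :: 'n::finite tvec cochain)" "2 * CARD('n) < k"
  shows "a = 0"
  using assms
proof (induction rule: ext_form.induct)
  case (plus As k a c)
  have "\<not> distinct As"
  proof
    assume "distinct As"
    then have "length As = card (set As)" by (simp add: distinct_card)
    also have "\<dots> \<le> CARD('n + 'n)" by (rule card_mono) simp_all
    also have "\<dots> = 2 * CARD('n)" by (simp add: card_UNIV_sum)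
    finally show False using plus by simp
  qed
  then show ?case using plus by (simp add: thetas_not_distinct)
qed simp

lemma ext_form_iota: "ext_form (Suc k) a \<Longrightarrow> ext_form k (iota X a)"
proof -
  have th: "ext_form (length As) (iota X (thetas (A # As)))" for A As
  proof (induction As arbitrary: A)
    case Nil
    then show ?case using ext_form_scale[OF ext_form_1] by (simp add: iota_mult)
  next
    case (Cons B Bs)
    have "ext_form (length (B # Bs)) (cst (tcomp A X) * thetas (B # Bs))"
      by (rule ext_form_scale[OF ext_form_thetas])
    moreover have "ext_form (1 + length Bs) (theta A * iota X (thetas (B # Bs)))"
      by (rule ext_form_mult[OF ext_form_theta Cons])
    ultimately show ?case
      unfolding thetas_simps(2)[of A] iota_mult by (auto intro!: ext_form_diff)
  qed
  show "ext_form (Suc k) a \<Longrightarrow> ?thesis"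
  proof (induction "Suc k" a rule: ext_form.induct)
    case (plus As a c)
    then obtain A As' where "As = A # As'" by (cases As) auto
    with plus th[of As' A] show ?case by (auto intro!: ext_form_add ext_form_scale)
  qed (simp add: ext_form.zero)
qed

lemma iota_linear:
  assumes "ext_form k a"
  shows "iota X a = (\<Sum>B. cst (tcomp B X) * iota (cvec B) a)"
proof -
  have th: "iota X (thetas As) = (\<Sum>B. cst (tcomp B X) * iota (cvec B) (thetas As))" for As
  proof (induction As)
    case (Cons A As)
    have "iota X (thetas (A # As)) = cst (tcomp A X) * thetas As - theta A * iota X (thetas As)"
      by (simp add: iota_mult)
    also have "cst (tcomp A X) * thetas As = (\<Sum>B. cst (tcomp B X) * (cst (tcomp A (cvec B)) * thetas As))"
    proof -
      have "(\<Sum>B. cst (tcomp B X) * (cst (tcomp A (cvec B)) * thetas As))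
        = (\<Sum>B. if A = B then cst (tcomp B X) * thetas As else 0)"
        by (rule sum.cong) (simp_all add: tcomp_cvec)
      then show ?thesis by simp
    qed
    also have "theta A * iota X (thetas As)
        = (\<Sum>B. cst (tcomp B X) * (theta A * iota (cvec B) (thetas As)))"
      by (subst Cons) (simp add: sum_distrib_left cst_left_commute)
    finally show ?case by (simp add: iota_mult right_diff_distrib sum_subtractf)
  qed simp
  from assms show ?thesis
  proof (induction rule: ext_form.induct)
    case (plus As k a c)
    have "iota X (cst c * thetas As + a) = cst c * iota X (thetas As) + iota X a" by simp
    also have "\<dots> = cst c * (\<Sum>B. cst (tcomp B X) * iota (cvec B) (thetas As))
        + (\<Sum>B. cst (tcomp B X) * iota (cvec B) a)"
      using th[of As] plus.IH by (rule arg_cong2[of _ _ _ _ "\<lambda>x y. cst c * x + y"])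
    finally show ?case by (simp add: distrib_left sum.distrib sum_distrib_left cst_cst mult.commute)
  qed simp
qed

lemma finite_lists_length: "finite {As :: 'a::finite list. length As = k}"
  using finite_lists_length_eq[of "UNIV :: 'a set" k] by simp

lemma sum_lists_Suc:
  "(\<Sum>As\<in>{As :: 'a::finite list. length As = Suc k}. t As)
    = (\<Sum>A. \<Sum>As\<in>{As. length As = k}. t (A # As))"
proof -
  have eq: "{As :: 'a list. length As = Suc k} = (\<lambda>(A, As). A # As) ` (UNIV \<times> {As. length As = k})"
    by (auto simp: length_Suc_conv image_iff)
  have "inj_on (\<lambda>(A, As). A # As) (UNIV \<times> {As :: 'a list. length As = k})" by (auto simp: inj_on_def)
  then show ?thesis
    by (simp add: eq sum.reindex sum.cartesian_product split_def)
qed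

lemma ev_ext_form_expand:
  "ext_form k a \<Longrightarrow> length us = k \<Longrightarrow>
    ev a us = (\<Sum>Bs\<in>{Bs. length Bs = k}. (\<Prod>i<k. tcomp (Bs ! i) (us ! i)) * ev a (map cvec Bs))"
proof (induction k arbitrary: a us)
  case (Suc k)
  then obtain X vs where us: "us = X # vs" "length vs = k" by (auto simp: length_Suc_conv)
  have "ev a us = ev (iota X a) vs" by (simp add: us)
  also have "\<dots> = (\<Sum>B. tcomp B X * ev (iota (cvec B) a) vs)"
    by (simp add: iota_linear[OF Suc.prems(1), of X] del: ev_iota)
  also have "\<dots> = (\<Sum>B. tcomp B X * (\<Sum>Bs\<in>{Bs. length Bs = k}.
      (\<Prod>i<k. tcomp (Bs ! i) (vs ! i)) * ev (iota (cvec B) a) (map cvec Bs)))"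
    by (intro sum.cong refl arg_cong2[of _ _ _ _ "(*)"] Suc.IH ext_form_iota Suc.prems us)
  also have "\<dots> = (\<Sum>Bs\<in>{Bs. length Bs = Suc k}. (\<Prod>i<Suc k. tcomp (Bs ! i) (us ! i)) * ev a (map cvec Bs))"
    unfolding sum_lists_Suc
    by (simp add: us prod.lessThan_Suc_shift sum_distrib_left mult.assoc del: prod.lessThan_Suc)
  finally show ?case .
qed (simp)

lemma pull_ext_form:
  assumes T: "\<And>A v. tcomp A (T v) = (\<Sum>B. tcomp B v * M A B)"
  shows "ext_form k a \<Longrightarrow> ext_form k (pull T a)"
proof -
  have 1: "pull T (theta A) = (\<Sum>B. cst (M A B) * theta B)" for A
  proof (rule homog1_eqI)
    show "homog 1 (pull T (theta A))" by (simp add: homog_def theta_def)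
    show "homog 1 (\<Sum>B. cst (M A B) * theta B)" by (intro homog_sum homog_scale homog_theta)
    show "ev (pull T (theta A)) [v] = ev (\<Sum>B. cst (M A B) * theta B) [v]" for v
      by (simp add: ev_theta T mult.commute)
  qed
  have th: "ext_form 1 (pull T (theta A))" for A
    unfolding 1 by (intro ext_form_sum ext_form_scale ext_form_theta)
  have "ext_form (length As) (pull T (thetas As))" for As
  proof (induction As)
    case (Cons A As)
    from ext_form_mult[OF th Cons, of A] show ?case by simp
  qed (simp add: ext_form_1)
  note ths = this
  show "ext_form k a \<Longrightarrow> ?thesis"
    by (induction rule: ext_form.induct) (auto intro: ext_form.zero ext_form_add ext_form_scale ths)
qed

text \<open>Reality in the frame \<open>cvec\<close>, not invariance under conjugation of forms. It
  makes the sum of squares in \<open>star_top_eq_0\<close> nonnegative term by term.\<close>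

definition real_form :: "'n::finite tvec cochain \<Rightarrow> bool" where
  "real_form a \<longleftrightarrow> (\<forall>Bs. ev a (map cvec Bs) \<in> \<real>)"

lemma real_form_thetas: "real_form (thetas As)"
proof (induction As)
  case Nil
  then show ?case by (simp add: real_form_def ev_1)
next
  case (Cons A As)
  have "real_form a \<Longrightarrow> real_form b \<Longrightarrow> ev (a * b) (map cvec Bs) \<in> \<real>"
    for a b :: "'a tvec cochain" and Bs
  proof (induction Bs arbitrary: a b)
    case Nil
    then show ?case unfolding real_form_def by (metis Reals_mult ev_mult_Nil list.simps(8))
  next
    case (Cons B Bs)
    have "real_form (iota (cvec B) c)" if "real_form c" for c :: "'a tvec cochain"
      unfolding real_form_def
    proof
      fix Bs show "ev (iota (cvec B) c) (map cvec Bs) \<in> \<real>"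
        using that[unfolded real_form_def, rule_format, of "B # Bs"] by simp
    qed
    moreover have "real_form (sg a)" using Cons.prems by (simp add: real_form_def)
    ultimately show ?case using Cons by (simp add: ev_mult_Cons)
  qed
  moreover have "ev (theta A) (map cvec Bs) \<in> \<real>" for Bs
    by (cases Bs) (simp_all add: theta_def tcomp_cvec)
  ultimately show ?case using Cons by (simp add: real_form_def)
qed

lemma ev_thetas_self: "distinct As \<Longrightarrow> ev (thetas As) (map cvec As) = 1"
proof (induction As)
  case (Cons A As)
  have "iota (cvec A) (thetas Bs) = 0" if "A \<notin> set Bs" for Bs
    using that by (induction Bs) (auto simp: iota_mult tcomp_cvec)
  then have "iota (cvec A) (thetas (A # As)) = thetas As"
    using Cons.prems by (simp add: iota_mult tcomp_cvec)
  with Cons show ?case by (metis distinct.simps(2) ev_iota list.simps(9))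
qed (simp add: ev_1)

section \<open>A positive Hermitian matrix, its inverse and its Kaehler form\<close>

locale hermitian =
  fixes G :: "complex^'n^'n::finite"
  assumes herm: "\<And>i j. G $ j $ i = cnj (G $ i $ j)"
    and pos: "\<And>v. v \<noteq> 0 \<Longrightarrow> Re (\<Sum>i j. G $ i $ j * v $ i * cnj (v $ j)) > 0"
begin

definition om :: "'n tvec cochain" where
  "om = cst (\<i> / 2) * (\<Sum>i j. cst (G $ i $ j) * (theta (Inl i) * theta (Inr j)))"

text \<open>Divided powers, because contraction then lowers the exponent without a
  coefficient.\<close>

definition omk :: "nat \<Rightarrow> 'n tvec cochain" where "omk k = cst (1 / fact k) * om ^ k"

definition vol :: "'n tvec cochain" where "vol = omk CARD('n)"

abbreviation ginv :: "'n \<Rightarrow> 'n \<Rightarrow> complex" where "ginv \<equiv> inv_metric G"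

lemma invertible_G: "G ** matrix_inv G = mat 1" "matrix_inv G ** G = mat 1"
proof -
  have "x = 0" if "G *v x = 0" for x
  proof (rule ccontr)
    assume "x \<noteq> 0"
    \<comment> \<open>\<open>pos\<close> conjugates the second slot whereas \<open>G *v x\<close>
      has \<open>x\<close> itself there, so positivity is tested on the conjugate of
      \<open>x\<close>.\<close>
    then have nz: "(\<chi> i. cnj (x $ i)) \<noteq> 0" by (auto simp: vec_eq_iff)
    have "(\<Sum>j. G $ i $ j * x $ j) = 0" for i
      using that by (simp add: vec_eq_iff matrix_vector_mult_def)
    then have "(\<Sum>i. cnj (x $ i) * (\<Sum>j. G $ i $ j * x $ j)) = 0" by simp
    then show False using pos[OF nz] by (simp add: sum_distrib_left mult_ac)
  qed
  then have "invertible G" using matrix_left_invertible_ker invertible_left_inverse by blast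
  then have "\<exists>B. G ** B = mat 1 \<and> B ** G = mat 1" by (simp add: invertible_def)
  from someI_ex[OF this] show "G ** matrix_inv G = mat 1" "matrix_inv G ** G = mat 1"
    by (simp_all add: matrix_inv_def)
qed

lemma ginv_right: "(\<Sum>q. ginv p q * G $ k $ q) = (if p = k then 1 else 0)"
proof -
  have "(G ** matrix_inv G) $ k $ p = mat 1 $ k $ p" by (simp only: invertible_G)
  then show ?thesis by (simp add: matrix_matrix_mult_def mat_def inv_metric_def mult.commute eq_commute)
qed

lemma ginv_left: "(\<Sum>p. ginv p q * G $ p $ r) = (if q = r then 1 else 0)"
proof -
  have "(matrix_inv G ** G) $ q $ r = mat 1 $ q $ r" by (simp only: invertible_G)
  then show ?thesis by (simp add: matrix_matrix_mult_def mat_def inv_metric_def)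
qed

lemma ginv_herm: "cnj (ginv p q) = ginv q p"
proof -
  have eq: "(\<Sum>k. (if p = k then 1 else 0) * ginv q k) = ginv q p"
    by (simp add: sum_delta_mult)
  have "(\<Sum>q'. cnj (ginv p q') * G $ q' $ k) = (if p = k then 1 else 0)" for k
    using arg_cong[OF ginv_right[of p k], of cnj] by (cases "p = k") (simp_all add: herm[of _ k])
  then have "(\<Sum>k. (if p = k then 1 else 0) * ginv q k)
     = (\<Sum>k. (\<Sum>q'. cnj (ginv p q') * G $ q' $ k) * ginv q k)" by simp
  also have "\<dots> = (\<Sum>q'. cnj (ginv p q') * (\<Sum>k. ginv q k * G $ q' $ k))"
    unfolding sum_distrib_left sum_distrib_right by (subst sum.swap) (simp add: mult_ac)
  also have "\<dots> = cnj (ginv p q)"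
    unfolding ginv_right using sum_delta_mult(1)[of q "\<lambda>q'. cnj (ginv p q')"] by (simp add: mult.commute)
  finally show ?thesis using eq by simp
qed

lemma even_om: "even_form om"
  unfolding om_def
  by (intro even_form_scale even_form_sum odd_odd_mult odd_theta)

lemma ext_om: "ext_form 2 om"
  unfolding om_def
  by (intro ext_form_scale ext_form_sum ext_form_theta2)

lemma ext_omk: "ext_form (2 * k) (omk k)"
  unfolding omk_def by (intro ext_form_scale ext_form_power ext_om)

lemma omk_0 [simp]: "omk 0 = 1" by (simp add: omk_def)

text \<open>As \<open>om\<close> is even, contraction differentiates its powers like an ordinary
  derivation, and the exponent cancels against the factorial.\<close>

lemma iota_omk: "iota X (omk (Suc k)) = iota X om * omk k"
proof -
  have "iota X (om ^ Suc k) = cst (of_nat (Suc k)) * (iota X om * om ^ k)"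
  proof (induction k)
    case (Suc k)
    have *: "om * (iota X om * om ^ k) = iota X om * om ^ Suc k"
      using even_commute[OF even_om, of "iota X om"] by (simp add: mult.assoc[symmetric])
    have "iota X (om ^ Suc (Suc k)) = iota X om * om ^ Suc k + om * iota X (om ^ Suc k)"
      using even_om unfolding power_Suc[of om "Suc k"] iota_mult by (simp only: even_form_def)
    also have "om * iota X (om ^ Suc k) = cst (of_nat (Suc k)) * (iota X om * om ^ Suc k)"
      unfolding Suc by (simp only: cst_left_commute *)
    finally show ?case by (simp only: of_nat_Suc[of "Suc k"] cst_add distrib_right cst_1 mult_1_left)
  qed simp
  moreover have "1 / fact (Suc k) * of_nat (Suc k) = (1 / fact k :: complex)"
    by (simp add: field_simps del: of_nat_Suc)
  ultimately show ?thesis unfolding omk_def iota_scale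
    by (simp only: cst_cst cst_left_commute[of "iota X om"])
qed

lemma iota_om: "iota X om = cst (\<i> / 2) * (\<Sum>i j. cst (G $ i $ j * tcomp (Inl i) X) * theta (Inr j)
    - cst (G $ i $ j * tcomp (Inr j) X) * theta (Inl i))"
  unfolding om_def
  by (simp add: iota_mult right_diff_distrib cst_cst cst_commute[of "theta _"])

text \<open>The vector dual to the covector \<open>theta A\<close> under \<omega>. The factors
  \<plusminus>2\<i> invert the \<i>/2 in \<open>om\<close>; since \<omega> is of type (1,1), a (1,0)
  covector yields a (0,1) vector and conversely.\<close>

definition sharp :: "'n + 'n \<Rightarrow> 'n tvec" where
  "sharp A = (case A of Inl s \<Rightarrow> (0, \<chi> j. 2 * \<i> * ginv s j) | Inr s \<Rightarrow> (\<chi> i. - 2 * \<i> * ginv i s, 0))"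

lemma iota_sharp_om: "iota (sharp A) om = theta A"
proof (cases A)
  case (Inl s)
  have "(\<Sum>i j. cst (G $ i $ j * (2 * \<i> * ginv s j)) * theta (Inl i))
     = (\<Sum>i. cst (2 * \<i> * (\<Sum>j. ginv s j * G $ i $ j)) * theta (Inl i))"
    by (simp add: sum_distrib_left sum_distrib_right cst_sum mult_ac)
  also have "\<dots> = (\<Sum>i. if s = i then cst (2 * \<i>) * theta (Inl i) else 0)"
    unfolding ginv_right by (rule sum.cong) auto
  also have "\<dots> = cst (2 * \<i>) * theta (Inl s)" by simp
  finally show ?thesis
    by (simp add: Inl iota_om sharp_def tcomp_def sum_negf mult.assoc[symmetric] flip: cst_mult cst_minus)
      (simp add: cst_minus)
next
  case (Inr s)
  have "(\<Sum>i j. cst (G $ i $ j * (- 2 * \<i> * ginv i s)) * theta (Inr j))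
     = (\<Sum>j. cst (- 2 * \<i> * (\<Sum>i. ginv i s * G $ i $ j)) * theta (Inr j))"
    by (subst sum.swap) (simp add: sum_distrib_left sum_distrib_right cst_sum mult_ac sum_negf cst_minus)
  also have "\<dots> = (\<Sum>j. if s = j then cst (- 2 * \<i>) * theta (Inr j) else 0)"
    unfolding ginv_left by (rule sum.cong) auto
  also have "\<dots> = cst (- 2 * \<i>) * theta (Inr s)" by simp
  finally show ?thesis
    by (simp add: Inr iota_om sharp_def tcomp_def mult.assoc[symmetric] flip: cst_mult)
qed

text \<open>Contracting a form of degree \<open>2n + 1\<close>, which vanishes, with the vector dual to a covector
  under \<open>\<omega>\<close> moves that covector out of the product.\<close>

lemma contract:
  assumes P: "ext_form (Suc (2 * k)) P" and k: "k < CARD('n)" and X: "iota X om = a"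
  shows "P * a * omk (CARD('n) - Suc k) = iota X P * omk (CARD('n) - k)"
proof -
  define m where "m = CARD('n) - Suc k"
  have m: "CARD('n) - k = Suc m" using k by (simp add: m_def)
  have "ext_form (Suc (2 * k) + 2 * Suc m) (P * omk (Suc m))"
    by (intro ext_form_mult P ext_omk)
  then have "P * omk (Suc m) = 0" by (rule ext_form_vanish) (use k m_def in auto)
  then have "iota X (P * omk (Suc m)) = 0" by simp
  moreover have "sg P = - P" using homog_odd[OF homog_ext_form[OF P]] by (simp add: odd_form_def)
  ultimately have "iota X P * omk (Suc m) - P * (a * omk m) = 0"
    by (simp add: iota_mult iota_omk X)
  then show ?thesis by (simp add: m flip: m_def) (simp add: mult.assoc)
qed

text \<open>\<open>contract\<close> removes the last covector of a product and lowers the remaining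
  degree by two while raising the power of \<omega>. After \<open>k\<close> rounds a scalar times
  the volume form is left.\<close>

lemma ext_form_mult_omk:
  assumes "k \<le> CARD('n)" "ext_form (2 * k) a"
  shows "\<exists>c. a * omk (CARD('n) - k) = cst c * vol"
  using assms
proof (induction k arbitrary: a)
  case 0
  then have "ext_form 0 a" by simp
  then have "\<exists>c. a = cst c"
  proof (induction "0::nat" a rule: ext_form.induct)
    case zero
    show ?case by (rule exI[of _ 0]) simp
  next
    case (plus As a c)
    then obtain d where "a = cst d" by blast
    with plus show ?case by (intro exI[of _ "c + d"]) (simp add: cst_add)
  qed
  then show ?case by (auto simp: vol_def)
next
  case (Suc k)
  have th: "\<exists>c. thetas As * omk (CARD('n) - Suc k) = cst c * vol" if As: "length As = 2 * Suc k" for As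
  proof -
    obtain Bs A where AB: "As = Bs @ [A]" "length Bs = Suc (2 * k)"
      using As by (cases As rule: rev_cases) auto
    have "ext_form (Suc (2 * k)) (thetas Bs)" using ext_form_thetas[of Bs] AB by simp
    then have "thetas Bs * theta A * omk (CARD('n) - Suc k) = iota (sharp A) (thetas Bs) * omk (CARD('n) - k)"
      "ext_form (2 * k) (iota (sharp A) (thetas Bs))"
      using contract[OF _ _ iota_sharp_om] Suc.prems by (auto intro: ext_form_iota)
    then show ?thesis using Suc.IH Suc.prems AB by (auto simp: mult.assoc)
  qed
  from Suc.prems(2) show ?case
  proof (induction "2 * Suc k" a rule: ext_form.induct)
    case zero
    show ?case by (rule exI[of _ 0]) simp
  next
    case (plus As a c)
    then obtain d where d: "a * omk (CARD('n) - Suc k) = cst d * vol" by blast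
    obtain d' where d': "thetas As * omk (CARD('n) - Suc k) = cst d' * vol" using th plus by blast
    show ?case
      by (rule exI[of _ "c * d' + d"]) (simp add: distrib_right mult.assoc d d' cst_add cst_mult)
  qed
qed

text \<open>The product of all coordinate covectors is a multiple of the volume form by
  \<open>ext_form_mult_omk\<close>. It is not zero, so the factor can be inverted; this also yields
  \<open>vol_nonzero\<close>.\<close>

lemma vol_thetas:
  obtains L c where "distinct L" "set L = (UNIV :: ('n + 'n) set)" "length L = 2 * CARD('n)"
    "c \<noteq> 0" "vol = cst c * thetas L"
proof -
  obtain L where L: "distinct L" "set L = (UNIV :: ('n + 'n) set)"
    using finite_distinct_list[of "UNIV :: ('n + 'n) set"] by auto
  then have len: "length L = 2 * CARD('n)"
    using distinct_card[OF L(1)] by (simp add: card_UNIV_sum)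
  have "ext_form (2 * CARD('n)) (thetas L)" using ext_form_thetas[of L] len by simp
  from ext_form_mult_omk[OF le_refl this] obtain c where c: "thetas L = cst c * vol" by auto
  moreover have "thetas L \<noteq> 0" using ev_thetas_self[OF L(1)] by auto
  ultimately have "c \<noteq> 0" by auto
  then have "vol = cst (1 / c) * thetas L" unfolding c by (simp flip: mult.assoc cst_mult)
  then show ?thesis using that[OF L len, of "1 / c"] \<open>c \<noteq> 0\<close> by simp
qed

lemma vol_nonzero: "vol \<noteq> 0"
proof
  assume 0: "vol = 0"
  obtain L c where L: "distinct L" "c \<noteq> 0" "vol = cst c * thetas L" by (rule vol_thetas)
  have "ev vol (map cvec L) = c" unfolding L(3) ev_cst_mult ev_thetas_self[OF L(1)] by simp
  then show False using 0 L by simp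
qed

lemma cst_vol_cancel: "cst c * vol = cst d * vol \<Longrightarrow> c = d"
proof -
  assume "cst c * vol = cst d * vol"
  then have "cst (c - d) * vol = 0" by (simp add: cst_diff left_diff_distrib)
  then show ?thesis using cst_cancel[of "c - d" vol 0] vol_nonzero by auto
qed

lemma ext_vol: "ext_form (2 * CARD('n)) vol"
  unfolding vol_def by (rule ext_omk)

text \<open>\<open>contract\<close> in its lowest case, applied to the covector
  \<open>theta (Inl p)\<close> written last; restoring the order of the two covectors gives the
  sign.\<close>

lemma wedge11_vol: "theta (Inl p) * theta (Inr q) * omk (CARD('n) - 1) = cst (- 2 * \<i> * ginv p q) * vol"
proof -
  have "theta (Inr q) * theta (Inl p) * omk (CARD('n) - Suc 0)
      = iota (sharp (Inl p)) (theta (Inr q)) * omk (CARD('n) - 0)"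
    by (rule contract) (use ext_form_theta iota_sharp_om in auto)
  then show ?thesis
    by (simp add: theta_commute[of "Inl p"] sharp_def tcomp_def vol_def cst_minus)
qed

text \<open>Removing \<open>theta (Inl s)\<close> by \<open>contract\<close> leaves two products of
  type (1,1), each a multiple of the volume form by \<open>wedge11_vol\<close>. The 4 is
  (2\<i>)(-2\<i>). The first summand pairs traces, the second is the inner product.\<close>

lemma wedge22_vol:
  assumes n: "CARD('n) \<ge> 2"
  shows "theta (Inl p) * theta (Inr q) * (theta (Inr r) * theta (Inl s)) * omk (CARD('n) - 2)
    = cst (4 * ginv s r * ginv p q - 4 * ginv s q * ginv p r) * vol"
proof -
  let ?P = "theta (Inl p) * theta (Inr q) * theta (Inr r)"
  have P: "ext_form (Suc (2 * 1)) ?P"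
    using ext_form_mult[OF ext_form_mult[OF ext_form_theta ext_form_theta] ext_form_theta,
        of "Inl p" "Inr q" "Inr r"] by (simp add: eval_nat_numeral)
  have "?P * theta (Inl s) * omk (CARD('n) - Suc 1) = iota (sharp (Inl s)) ?P * omk (CARD('n) - 1)"
    by (rule contract[OF P]) (use n iota_sharp_om in auto)
  also have "iota (sharp (Inl s)) ?P = cst (2 * \<i> * ginv s r) * (theta (Inl p) * theta (Inr q))
      - cst (2 * \<i> * ginv s q) * (theta (Inl p) * theta (Inr r))"
    by (simp add: iota_mult sharp_def tcomp_def cst_commute[of "theta _"]
        cst_left_commute[of "theta _"] mult.assoc right_diff_distrib)
  also have "\<dots> * omk (CARD('n) - 1) = cst (2 * \<i> * ginv s r) * (cst (- 2 * \<i> * ginv p q) * vol)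
      - cst (2 * \<i> * ginv s q) * (cst (- 2 * \<i> * ginv p r) * vol)"
    by (simp only: left_diff_distrib mult.assoc[of "cst _"] wedge11_vol)
  also have "\<dots> = cst (2 * \<i> * ginv s r * (- 2 * \<i> * ginv p q) - 2 * \<i> * ginv s q * (- 2 * \<i> * ginv p r)) * vol"
    by (simp only: cst_diff cst_mult left_diff_distrib mult.assoc)
  also have "2 * \<i> * ginv s r * (- 2 * \<i> * ginv p q) - 2 * \<i> * ginv s q * (- 2 * \<i> * ginv p r)
     = 4 * ginv s r * ginv p q - 4 * ginv s q * ginv p r" by (simp add: algebra_simps)
  finally show ?thesis by (simp add: mult.assoc numeral_2_eq_2)
qed

text \<open>By \<open>wedge22_vol\<close> each product is a trace term minus four times an inner
  product. The trace term contains the trace of \<phi> as a factor, which \<open>tr\<close> makes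
  zero.\<close>

lemma wedge_norm_vol:
  fixes H :: "complex^'m^'m::finite" and \<phi> :: "'m \<Rightarrow> 'n \<Rightarrow> 'n \<Rightarrow> complex"
  assumes n: "CARD('n) \<ge> 2"
    and tr: "\<And>i. (\<Sum>p q. ginv p q * \<phi> i p q) = 0"
  shows "(\<Sum>i j. cst (H $ i $ j) *
     ((\<Sum>p q. cst (\<phi> i p q) * (theta (Inl p) * theta (Inr q)))
      * (\<Sum>r s. cst (cnj (\<phi> j r s)) * (theta (Inr r) * theta (Inl s))))) * omk (CARD('n) - 2)
   = cst (- 4 * (\<Sum>i j p q r s. H $ i $ j * ginv p r * ginv s q * \<phi> i p q * cnj (\<phi> j r s))) * vol"
proof -
  have prod4: "(\<Sum>p q. a p q) * (\<Sum>r s. b r s) * c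
      = (\<Sum>p q r s. a p q * b r s * c)"
    for a b :: "'n \<Rightarrow> 'n \<Rightarrow> 'n tvec cochain" and c
  proof -
    have "(\<Sum>p q. a p q) * (\<Sum>r s. b r s) * c
      = (\<Sum>p q. a p q * (\<Sum>r s. b r s * c))"
      by (simp only: sum_distrib_right mult.assoc)
    then show ?thesis by (simp only: sum_distrib_left mult.assoc)
  qed
  have ij: "(\<Sum>p q. cst (\<phi> i p q) * (theta (Inl p) * theta (Inr q)))
      * (\<Sum>r s. cst (cnj (\<phi> j r s)) * (theta (Inr r) * theta (Inl s))) * omk (CARD('n) - 2)
     = cst (- 4 * (\<Sum>p q r s. ginv p r * ginv s q * \<phi> i p q * cnj (\<phi> j r s))) * vol" for i j
  proof -
    have "(\<Sum>p q. cst (\<phi> i p q) * (theta (Inl p) * theta (Inr q)))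
      * (\<Sum>r s. cst (cnj (\<phi> j r s)) * (theta (Inr r) * theta (Inl s))) * omk (CARD('n) - 2)
      = (\<Sum>p q r s. cst (\<phi> i p q * cnj (\<phi> j r s)) *
         (theta (Inl p) * theta (Inr q) * (theta (Inr r) * theta (Inl s)) * omk (CARD('n) - 2)))"
      unfolding prod4 cst_mult_mult by (simp only: mult.assoc[of "cst _"])
    also have "\<dots> = cst (\<Sum>p q r s. (\<phi> i p q * cnj (\<phi> j r s)) *
         (4 * ginv s r * ginv p q - 4 * ginv s q * ginv p r)) * vol"
      unfolding wedge22_vol[OF n] cst_sum cst_mult sum_distrib_right by (simp only: mult.assoc)
    also have "(\<Sum>p q r s. (\<phi> i p q * cnj (\<phi> j r s)) *
         (4 * ginv s r * ginv p q - 4 * ginv s q * ginv p r))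
       = (\<Sum>p q r s. (ginv p q * \<phi> i p q) * (4 * ginv s r * cnj (\<phi> j r s)))
        - 4 * (\<Sum>p q r s. ginv p r * ginv s q * \<phi> i p q * cnj (\<phi> j r s))"
      unfolding sum_distrib_left sum_subtractf[symmetric]
      by (intro sum.cong refl) (simp add: algebra_simps)
    also have "(\<Sum>p q r s. (ginv p q * \<phi> i p q) * (4 * ginv s r * cnj (\<phi> j r s))) = 0"
      using tr[of i] by (simp flip: sum_distrib_left sum_distrib_right)
    finally show ?thesis by simp
  qed
  define P where "P i = (\<Sum>p q. cst (\<phi> i p q) * (theta (Inl p) * theta (Inr q)))" for i
  define P' where "P' j = (\<Sum>r s. cst (cnj (\<phi> j r s)) * (theta (Inr r) * theta (Inl s)))" for j
  define N where "N i j = (\<Sum>p q r s. ginv p r * ginv s q * \<phi> i p q * cnj (\<phi> j r s))" for i j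
  have "P i * P' j * omk (CARD('n) - 2) = cst (- 4 * N i j) * vol" for i j
    using ij[of i j] by (simp only: P_def P'_def N_def)
  then have "(\<Sum>i j. cst (H $ i $ j) * (P i * P' j)) * omk (CARD('n) - 2)
      = (\<Sum>i j. cst (H $ i $ j) * (cst (- 4 * N i j) * vol))"
    by (simp only: sum_distrib_right mult.assoc[of "cst _"])
  also have "\<dots> = (\<Sum>i j. cst (- 4 * (H $ i $ j * N i j)) * vol)"
    by (simp only: cst_cst mult.left_commute[of _ "- 4"])
  also have "\<dots> = cst (- 4 * (\<Sum>i j. H $ i $ j * N i j)) * vol"
    by (simp only: cst_sum sum_distrib_left sum_distrib_right)
  also have "(\<Sum>i j. H $ i $ j * N i j) = (\<Sum>i j p q r s. H $ i $ j * ginv p r * ginv s q * \<phi> i p q * cnj (\<phi> j r s))"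
    by (simp only: N_def sum_distrib_left mult.assoc)
  finally show ?thesis by (simp only: P_def P'_def)
qed

section \<open>Riemannian duality and the Hodge star\<close>

lemma riem_inverse: "riem G ** matrix_inv (riem G) = mat 1"
  and riem_inv: "matrix_inv (riem G) = (\<chi> A B. case (A, B) of
    (Inl i, Inr j) \<Rightarrow> 2 * ginv i j | (Inr j, Inl i) \<Rightarrow> 2 * ginv i j | _ \<Rightarrow> 0)" (is "_ = ?R")
proof -
  have 1: "riem G ** ?R = mat 1"
  proof -
    have "(riem G ** ?R) $ A $ B = mat 1 $ A $ B" for A B
    proof (cases A; cases B)
      fix i k assume "A = Inl i" "B = Inl k"
      then show ?thesis using ginv_right[of k i]
        by (simp add: matrix_matrix_mult_def sum_UNIV_sum riem_def mat_def mult.commute eq_commute)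
    next
      fix i k assume "A = Inr i" "B = Inr k"
      then show ?thesis using ginv_left[of k i]
        by (simp add: matrix_matrix_mult_def sum_UNIV_sum riem_def mat_def mult.commute eq_commute)
    qed (simp_all add: matrix_matrix_mult_def sum_UNIV_sum riem_def mat_def)
    then show ?thesis by (simp add: vec_eq_iff)
  qed
  then have 2: "?R ** riem G = mat 1" by (rule matrix_left_right_inverse1)
  have "\<exists>B. riem G ** B = mat 1 \<and> B ** riem G = mat 1" using 1 2 by blast
  from someI_ex[OF this] have 3: "matrix_inv (riem G) ** riem G = mat 1" by (simp add: matrix_inv_def)
  have "matrix_inv (riem G) = matrix_inv (riem G) ** (riem G ** ?R)" unfolding 1 by (simp only: matrix_mul_rid)
  also have "\<dots> = ?R" by (simp only: matrix_mul_assoc 3 matrix_mul_lid)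
  finally show *: "matrix_inv (riem G) = ?R" .
  show "riem G ** matrix_inv (riem G) = mat 1" unfolding * by (rule 1)
qed

lemma riem_ginv:
  "matrix_inv (riem G) $ Inl i $ Inr j = 2 * ginv i j" "matrix_inv (riem G) $ Inr j $ Inl i = 2 * ginv i j"
  "matrix_inv (riem G) $ Inl i $ Inl k = 0" "matrix_inv (riem G) $ Inr j $ Inr l = 0"
  unfolding riem_inv by simp_all

text \<open>The components of \<open>v\<close> are read as those of a covector and raised with the
  Riemannian metric, so \<open>rsharp (cvec A)\<close> is the metric dual of \<open>theta A\<close>.
  As a map of vectors it fits into \<open>pull\<close>, which raises all indices of a form at
  once.\<close>

definition rsharp :: "'n tvec \<Rightarrow> 'n tvec" where
  "rsharp v = (\<chi> j. \<Sum>A. tcomp A v * matrix_inv (riem G) $ A $ Inl j,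
               \<chi> j. \<Sum>A. tcomp A v * matrix_inv (riem G) $ A $ Inr j)"

lemma tcomp_rsharp: "tcomp B (rsharp v) = (\<Sum>A. tcomp A v * matrix_inv (riem G) $ A $ B)"
  by (simp add: rsharp_def tcomp_def split: sum.split)

lemma tcomp_rsharp_cvec: "tcomp B (rsharp (cvec A)) = matrix_inv (riem G) $ A $ B"
  by (simp add: tcomp_rsharp tcomp_cvec sum_delta_mult)

text \<open>The metric dual and the dual under \<omega> differ by the complex structure, which acts
  as \<i> or -\<i> according to type. These are the factors in the star of a 1-form.\<close>

lemma iota_rsharp_om:
  "iota (rsharp (cvec (Inl i))) om = cst (- \<i>) * theta (Inl i)"
  "iota (rsharp (cvec (Inr i))) om = cst \<i> * theta (Inr i)"
proof -
  have "iota (rsharp (cvec A)) om = iota (sharp A) (cst c * om)"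
    if "\<And>B. tcomp B (rsharp (cvec A)) = c * tcomp B (sharp A)" for A c
    unfolding iota_om iota_scale that
    by (simp add: sum_distrib_left right_diff_distrib cst_cst mult.left_commute)
  note * = this[unfolded iota_scale iota_sharp_om]
  show "iota (rsharp (cvec (Inl i))) om = cst (- \<i>) * theta (Inl i)"
  proof (rule *)
    show "tcomp B (rsharp (cvec (Inl i))) = - \<i> * tcomp B (sharp (Inl i))" for B
      by (cases B) (simp_all only: tcomp_rsharp_cvec riem_ginv, simp_all add: sharp_def tcomp_def)
  qed
  show "iota (rsharp (cvec (Inr i))) om = cst \<i> * theta (Inr i)"
  proof (rule *)
    show "tcomp B (rsharp (cvec (Inr i))) = \<i> * tcomp B (sharp (Inr i))" for B
      by (cases B) (simp_all only: tcomp_rsharp_cvec riem_ginv, simp_all add: sharp_def tcomp_def)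
  qed
qed

text \<open>\<delta> is the determinant of raising an index. Lowering it again with
  \<open>flat\<close> undoes the pullback, so \<delta> cannot be zero.\<close>

lemma pull_vol:
  obtains \<delta> where "\<delta> \<noteq> 0" "pull rsharp vol = cst \<delta> * vol"
proof -
  have "ext_form (2 * CARD('n)) (pull rsharp vol)"
    by (rule pull_ext_form[OF tcomp_rsharp ext_vol])
  from ext_form_mult_omk[OF le_refl this] obtain \<delta> where \<delta>: "pull rsharp vol = cst \<delta> * vol" by auto
  define flat :: "'n tvec \<Rightarrow> 'n tvec" where
    "flat v = (\<chi> j. \<Sum>A. tcomp A v * riem G $ A $ Inl j, \<chi> j. \<Sum>A. tcomp A v * riem G $ A $ Inr j)"
    for v
  have flat: "tcomp B (flat v) = (\<Sum>A. tcomp A v * riem G $ A $ B)" for B v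
    by (simp add: flat_def tcomp_def split: sum.split)
  have inv: "(\<Sum>A. riem G $ C $ A * matrix_inv (riem G) $ A $ B) = (if C = B then 1 else 0)" for B C
  proof -
    have "(\<Sum>A. riem G $ C $ A * matrix_inv (riem G) $ A $ B) = (riem G ** matrix_inv (riem G)) $ C $ B"
      by (simp add: matrix_matrix_mult_def)
    also have "riem G ** matrix_inv (riem G) = mat 1" by (rule riem_inverse)
    finally show ?thesis by (simp add: mat_def)
  qed
  have "tcomp B (rsharp (flat v)) = tcomp B v" for B v
  proof -
    have "tcomp B (rsharp (flat v)) = (\<Sum>A C. tcomp C v * (riem G $ C $ A * matrix_inv (riem G) $ A $ B))"
      by (simp add: tcomp_rsharp flat sum_distrib_right mult.assoc)
    also have "\<dots> = (\<Sum>C. tcomp C v * (if C = B then 1 else 0))"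
      by (subst sum.swap) (simp add: inv flip: sum_distrib_left)
    finally show ?thesis using sum_delta_mult(2)[of B "\<lambda>C. tcomp C v"] by (simp add: mult.commute)
  qed
  then have "rsharp (flat v) = v" for v
  proof -
    assume *: "\<And>B v. tcomp B (rsharp (flat v)) = tcomp B v"
    show ?thesis using *[of "Inl _" v] *[of "Inr _" v]
      by (simp add: tcomp_def vec_eq_iff prod_eq_iff)
  qed
  then have "rsharp \<circ> flat = id" by auto
  then have "pull flat (pull rsharp vol) = vol"
    by (intro cochain_eqI) simp
  then have "cst \<delta> * pull flat vol = vol" by (simp add: \<delta>)
  then have "\<delta> \<noteq> 0" using vol_nonzero by auto
  then show ?thesis using that \<delta> by blast
qed

text \<open>The star is injective in top degree. Summing over \<open>Bs\<close> raises all indices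
  of the volume form and gives \<delta> times it. The whole is then \<open>t\<close> times a nonzero
  constant times a sum of squares of real numbers, whose term at \<open>As = L\<close> is 1.\<close>

lemma star_top_eq_0:
  assumes T: "T = cst t * vol"
    and 0: "(\<Sum>As\<in>{As. length As = 2 * CARD('n)}. \<Sum>Bs\<in>{Bs. length Bs = 2 * CARD('n)}.
        (\<Prod>i<2 * CARD('n). matrix_inv (riem G) $ (As ! i) $ (Bs ! i))
          * ev T (map cvec As) * ev vol (map cvec Bs)) = 0"
  shows "t = 0"
proof -
  let ?n = "2 * CARD('n)"
  obtain \<delta> where \<delta>: "\<delta> \<noteq> 0" "pull rsharp vol = cst \<delta> * vol" by (rule pull_vol)
  obtain L c where L: "distinct L" "length L = ?n" "c \<noteq> 0" "vol = cst c * thetas L"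
    by (rule vol_thetas)
  have "(\<Sum>Bs\<in>{Bs. length Bs = ?n}. (\<Prod>i<?n. matrix_inv (riem G) $ (As ! i) $ (Bs ! i)) * ev vol (map cvec Bs))
      = \<delta> * ev vol (map cvec As)" if As: "length As = ?n" for As
  proof -
    have "\<delta> * ev vol (map cvec As) = ev (pull rsharp vol) (map cvec As)" by (simp add: \<delta>)
    also have "\<dots> = ev vol (map (\<lambda>A. rsharp (cvec A)) As)" by (simp add: comp_def)
    also have "\<dots> = (\<Sum>Bs\<in>{Bs. length Bs = ?n}.
      (\<Prod>i<?n. tcomp (Bs ! i) (map (\<lambda>A. rsharp (cvec A)) As ! i)) * ev vol (map cvec Bs))"
      by (rule ev_ext_form_expand[OF ext_vol]) (simp add: As)
    also have "\<dots> = (\<Sum>Bs\<in>{Bs. length Bs = ?n}.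
      (\<Prod>i<?n. matrix_inv (riem G) $ (As ! i) $ (Bs ! i)) * ev vol (map cvec Bs))"
      by (intro sum.cong refl arg_cong2[of _ _ _ _ "(*)"] prod.cong) (simp add: As tcomp_rsharp_cvec)
    finally show ?thesis by simp
  qed
  then have "(\<Sum>As\<in>{As. length As = ?n}. ev T (map cvec As) * (\<delta> * ev vol (map cvec As))) = 0"
    using 0 by (subst sum.cong[OF refl, of _ _ "\<lambda>As. \<Sum>Bs\<in>{Bs. length Bs = 2 * CARD('n)}.
        (\<Prod>i<2 * CARD('n). matrix_inv (riem G) $ (As ! i) $ (Bs ! i))
          * ev T (map cvec As) * ev vol (map cvec Bs)"])
      (simp_all add: sum_distrib_left mult_ac flip: sum_distrib_left)
  then have "t * \<delta> * c * c * (\<Sum>As\<in>{As. length As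
      = ?n}. ev (thetas L) (map cvec As) * ev (thetas L) (map cvec As)) = 0"
    by (simp add: T L(4) sum_distrib_left mult_ac)
  moreover have "(\<Sum>As\<in>{As. length As = ?n}. ev (thetas L) (map cvec As) * ev (thetas L) (map cvec As)) \<noteq> 0"
  proof -
    have re: "ev (thetas L) (map cvec As) = of_real (Re (ev (thetas L) (map cvec As)))" for As
      using real_form_thetas[of L] unfolding real_form_def by (metis Reals_cases Re_complex_of_real)
    define f where "f As = Re (ev (thetas L) (map cvec As))" for As
    have "0 < (f L)\<^sup>2" by (simp add: f_def ev_thetas_self L)
    also have "\<dots> \<le> (\<Sum>As\<in>{As. length As = ?n}. (f As)\<^sup>2)"
      by (rule member_le_sum) (use L finite_lists_length in auto)
    finally have "(\<Sum>As\<in>{As. length As = ?n}. (f As)\<^sup>2) \<noteq> 0" by simp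
    moreover have "(\<Sum>As\<in>{As. length As = ?n}. ev (thetas L) (map cvec As) * ev (thetas L) (map cvec As))
       = of_real (\<Sum>As\<in>{As. length As = ?n}. (f As)\<^sup>2)"
      unfolding of_real_sum by (rule sum.cong[OF refl], subst (1 2) re) (simp add: f_def power2_eq_square)
    ultimately show ?thesis by (metis of_real_eq_0_iff)
  qed
  ultimately show ?thesis using \<delta> L by auto
qed

end

section \<open>The differential of the bracket as an algebraic identity\<close>

lemma sum_antisym:
  fixes t :: "'i::finite \<Rightarrow> 'i \<Rightarrow> 'v cochain"
  assumes "\<And>i j. t i j = - t j i"
  shows "(\<Sum>i j. t i j) = 0"
proof (rule cochain_double_eq_0)
  have "(\<Sum>i j. t i j) = (\<Sum>j i. t i j)" by (rule sum.swap)
  also have "\<dots> = (\<Sum>j i. - t j i)" by (intro sum.cong refl assms)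
  also have "\<dots> = - (\<Sum>j i. t j i)" by (simp add: sum_negf)
  finally show "(\<Sum>i j. t i j) = - (\<Sum>i j. t i j)" .
qed

text \<open>The values at one point: \<open>a\<close>, \<open>b\<close> stand for \<partial>f and
  \<bar>\<partial>f, \<open>A\<close>, \<open>B\<close> for the same derivatives of the conjugate of
  f, \<open>E\<close> for \<bar>\<partial>\<partial>f. \<open>hd c i j\<close> and
  \<open>hb c i j\<close> are the derivatives of the metric entry (i, j) in the direction of w^c and
  of its conjugate; \<open>hdd c\<close> and \<open>hbd c\<close> are those derivatives of
  \<open>hd\<close>. The symmetries are those of a Kaehler metric.\<close>

locale bracket_algebra =
  fixes a b A B E :: "'m::finite \<Rightarrow> 'v cochain"
    and hd hb :: "'m \<Rightarrow> 'm \<Rightarrow> 'm \<Rightarrow> complex"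
    and hdd hbd :: "'m \<Rightarrow> 'm \<Rightarrow> 'm \<Rightarrow> 'm \<Rightarrow> complex"
  assumes odd: "\<And>i. odd_form (a i)" "\<And>i. odd_form (b i)" "\<And>i. odd_form (A i)" "\<And>i. odd_form (B i)"
    and even: "\<And>i. even_form (E i)"
    and hd_sym: "\<And>c i j. hd c i j = hd i c j"
    and hb_sym: "\<And>c i j. hb c i j = hb j i c"
    and hdd_sym1: "\<And>c e k j. hdd c e k j = hdd e c k j"
    and hdd_sym2: "\<And>c e k j. hdd c e k j = hdd c k e j"
    and hbd_sym: "\<And>c e k j. hbd c e k j = hbd j e k c"
begin

text \<open>The coefficient of \<open>A c + B c\<close> in \<open>dPsi j\<close>; by
  \<open>dPsi_eq\<close> all the rest cancels.\<close>

definition X :: "'m \<Rightarrow> 'm \<Rightarrow> 'v cochain" where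
  "X c j = (\<Sum>i. cst (hb c i j) * E i)
     + (\<Sum>e k. cst (hbd c e k j) * (b e * a k))"

text \<open>The differential of the lowered form \<open>Psi j\<close> as the Leibniz and chain rules
  produce it, see \<open>dfield_Psi\<close>.\<close>

definition dPsi :: "'m \<Rightarrow> 'v cochain" where
  "dPsi j = (\<Sum>i. ((\<Sum>c. cst (hd c i j) * (a c + b c)) + (\<Sum>c. cst (hb c i j) * (A c + B c))) * E i)
     + (\<Sum>e k. ((\<Sum>c. cst (hdd c e k j) * (a c + b c)) + (\<Sum>c. cst (hbd c e k j) * (A c + B c))) * (b e * a k)
          + cst (hd e k j) * (- (E e * a k) - b e * E k))"

lemma X_sym: "X c j = X j c"
  unfolding X_def by (simp only: hb_sym[of c _ j] hbd_sym[of c _ _ j])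

text \<open>Apart from the terms in \<open>A\<close> and \<open>B\<close>, the products of
  \<open>b\<close> with \<open>E\<close> cancel directly. Those of \<open>a\<close> with
  \<open>E\<close> cancel as \<open>hd\<close> is symmetric and \<open>E\<close> even
  (\<open>z1\<close>). The cubic ones vanish as second derivatives are symmetric while
  \<open>a\<close> and \<open>b\<close> anticommute (\<open>z2\<close>, \<open>z3\<close>).\<close>

lemma dPsi_eq: "dPsi j = (\<Sum>c. X c j * (A c + B c))"
proof -
  have comm: "x * E i = E i * x" for x i
    using even_commute[OF even] by metis
  have bacomm: "x * (b e * a k) = (b e * a k) * x" for x e k
    using even_commute[OF odd_odd_mult[OF odd(2) odd(1)]] by metis
  have z1: "(\<Sum>e k. cst (hd e k j) * (a e * E k - E e * a k)) = 0"
  proof (rule sum_antisym)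
    fix e k
    show "cst (hd e k j) * (a e * E k - E e * a k) = - (cst (hd k e j) * (a k * E e - E k * a e))"
      unfolding hd_sym[of k e] comm by (simp add: right_diff_distrib)
  qed
  have z2: "(\<Sum>e c k. cst (hdd c e k j) * (a c * (b e * a k))) = 0"
  proof (rule sum.neutral, rule ballI, rule sum_antisym)
    fix e c k
    have "a c * (b e * a k) = - (a k * (b e * a c))"
    proof -
      have "a c * (b e * a k) = b e * (a k * a c)" by (simp only: bacomm mult.assoc)
      also have "\<dots> = - (b e * (a c * a k))" unfolding odd_anticommute[OF odd(1) odd(1), of k c] by simp
      also have "b e * (a c * a k) = a k * (b e * a c)" by (simp only: bacomm mult.assoc)
      finally show ?thesis .
    qed
    moreover have "hdd c e k j = hdd k e c j" using hdd_sym1 hdd_sym2 by metis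
    ultimately show "cst (hdd c e k j) * (a c * (b e * a k)) = - (cst (hdd k e c j) * (a k * (b e * a c)))"
      by simp
  qed
  have z3: "(\<Sum>e c k. cst (hdd c e k j) * (b c * (b e * a k))) = 0"
  proof (rule sum_antisym)
    fix e c
    show "(\<Sum>k. cst (hdd c e k j) * (b c * (b e * a k)))
      = - (\<Sum>k. cst (hdd e c k j) * (b e * (b c * a k)))"
      unfolding mult.assoc[symmetric, of "b _"] odd_anticommute[OF odd(2) odd(2), of c e] hdd_sym1[of c]
      by (simp add: sum_negf)
  qed
  have "dPsi j = (\<Sum>c. X c j * (A c + B c))
      + (\<Sum>e k. cst (hd e k j) * (a e * E k - E e * a k))
      + (\<Sum>e c k. cst (hdd c e k j) * (a c * (b e * a k)))
      + (\<Sum>e c k. cst (hdd c e k j) * (b c * (b e * a k)))"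
  proof -
    define P where "P = (\<Sum>i c. cst (hb c i j) * ((A c + B c) * E i))"
    define Q where "Q = (\<Sum>e k c. cst (hbd c e k j) * ((A c + B c) * (b e * a k)))"
    define R1 where "R1 = (\<Sum>i c. cst (hd c i j) * (a c * E i))"
    define R2 where "R2 = (\<Sum>i c. cst (hd c i j) * (b c * E i))"
    define S1 where "S1 = (\<Sum>e k. cst (hd e k j) * (E e * a k))"
    define S2 where "S2 = (\<Sum>e k. cst (hd e k j) * (b e * E k))"
    define T1 where "T1 = (\<Sum>e k c. cst (hdd c e k j) * (a c * (b e * a k)))"
    define T2 where "T2 = (\<Sum>e k c. cst (hdd c e k j) * (b c * (b e * a k)))"
    have "dPsi j = (P + (R1 + R2)) + (Q + (T1 + T2) - (S1 + S2))"
      unfolding dPsi_def P_def Q_def R1_def R2_def S1_def S2_def T1_def T2_def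
      by (simp only: distrib_right distrib_left sum_distrib_right sum.distrib sum_subtractf mult.assoc
          right_diff_distrib mult_minus_right sum_negf) (simp add: algebra_simps)
    moreover have "R2 = S2" unfolding R2_def S2_def by (rule sum.swap)
    moreover have "(\<Sum>e k. cst (hd e k j) * (a e * E k - E e * a k)) = R1 - S1"
    proof -
      have "R1 = (\<Sum>e k. cst (hd e k j) * (a e * E k))"
        unfolding R1_def by (rule sum.swap)
      then show ?thesis unfolding S1_def by (simp only: right_diff_distrib sum_subtractf)
    qed
    moreover have "(\<Sum>e c k. cst (hdd c e k j) * (a c * (b e * a k))) = T1"
      unfolding T1_def by (rule sum.cong[OF refl], rule sum.swap)
    moreover have "(\<Sum>e c k. cst (hdd c e k j) * (b c * (b e * a k))) = T2"
      unfolding T2_def by (rule sum.cong[OF refl], rule sum.swap)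
    moreover have "(\<Sum>c. X c j * (A c + B c)) = P + Q"
    proof -
      have "(\<Sum>c. X c j * (A c + B c))
        = (\<Sum>c i. cst (hb c i j) * ((A c + B c) * E i))
        + (\<Sum>c e k. cst (hbd c e k j) * ((A c + B c) * (b e * a k)))"
        unfolding X_def comm[of "A _ + B _"] bacomm[of "A _ + B _"]
        by (simp only: distrib_right sum_distrib_right sum.distrib mult.assoc[of "cst _"])
      moreover have "(\<Sum>c i. cst (hb c i j) * ((A c + B c) * E i)) = P"
        unfolding P_def by (rule sum.swap)
      moreover have "(\<Sum>c e k. cst (hbd c e k j) * ((A c + B c) * (b e * a k))) = Q"
        unfolding Q_def by (subst sum.swap, rule sum.cong[OF refl], rule sum.swap)
      ultimately show ?thesis by simp
    qed
    ultimately show ?thesis by simp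
  qed
  then show ?thesis by (simp only: z1 z2 z3 add_0_right)
qed

text \<open>\<open>X\<close> is symmetric, so it annihilates the products of \<open>A\<close> with
  \<open>A\<close> and of \<open>B\<close> with \<open>B\<close>. The two mixed products coincide up
  to order, whence the factor -2.\<close>

lemma sum_dPsi:
  "(\<Sum>j. dPsi j * (A j - B j)) = cst (- 2) * (\<Sum>c j. X c j * (A c * B j))"
proof -
  have zz: "(\<Sum>j c. X c j * (D c * D j)) = 0" if "\<And>i. odd_form (D i)" for D
  proof (rule sum_antisym)
    show "X c j * (D c * D j) = - (X j c * (D j * D c))" for c j
      unfolding X_sym[of j c] odd_anticommute[OF that that, of c j] by simp
  qed
  define S where "S = (\<Sum>c j. X c j * (A c * B j))"
  have S1: "(\<Sum>j c. X c j * (A c * B j)) = S" unfolding S_def by (rule sum.swap)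
  have S2: "(\<Sum>j c. X c j * (B c * A j)) = - S"
  proof -
    have "X c j * (B c * A j) = - (X j c * (A j * B c))" for c j
      unfolding X_sym[of j c] odd_anticommute[OF odd(4) odd(3), of c j] by simp
    then show ?thesis unfolding S_def by (simp add: sum_negf)
  qed
  have "(\<Sum>j. dPsi j * (A j - B j))
     = (\<Sum>j c. X c j * (A c * A j)) - (\<Sum>j c. X c j * (A c * B j))
       + (\<Sum>j c. X c j * (B c * A j)) - (\<Sum>j c. X c j * (B c * B j))"
    unfolding dPsi_eq
    by (simp add: sum_distrib_right distrib_left distrib_right right_diff_distrib mult.assoc
        sum.distrib sum_subtractf algebra_simps)
  also have "\<dots> = - S - S" by (simp only: zz odd S1 S2) simp
  also have "\<dots> = cst (- 2) * S" by (rule cochain_eqI) simp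
  finally show ?thesis by (simp only: S_def)
qed

end

section \<open>Kaehler metrics in a chart\<close>

lemma cderiv_nth [simp]: "cderiv (\<lambda>q. q $ i) p v = fst v $ i"
proof -
  have "((\<lambda>q. q $ i) has_derivative (\<lambda>w. w $ i)) (at p)"
    by (intro bounded_linear_imp_has_derivative bounded_linear_vec_nth)
  then have "cderiv (\<lambda>q. q $ i) p v = clin (\<lambda>w. w $ i) v" by (rule cderiv_has_derivative)
  also have "\<dots> = (\<Sum>A. tcomp A v * clin (\<lambda>w. w $ i) (cvec A))" by (rule clin_expand)
  also have "\<dots> = (\<Sum>A. (if Inl i = A then 1 else 0) * tcomp A v)"
  proof (rule sum.cong[OF refl])
    fix A :: "'a + 'a"
    show "tcomp A v * clin (\<lambda>w. w $ i) (cvec A) = (if Inl i = A then 1 else 0) * tcomp A v"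
      by (cases A) (simp_all add: clin_cvec axis_def)
  qed
  finally show ?thesis by (simp only: sum_delta_mult) (simp add: tcomp_def)
qed

lemma differentiable_nth: "(\<lambda>q :: complex^'n. q $ i) differentiable (at p)"
  by (simp add: bounded_linear_imp_differentiable bounded_linear_vec_nth)

lemma cderiv_cnj_nth [simp]: "cderiv (\<lambda>q. cnj (q $ i)) p v = snd v $ i"
  by (simp add: cderiv_cnj differentiable_nth tconj_def)

lemma Cochain_fun_form: "Cochain (fun_form \<phi> p) = cst (\<phi> p)"
  by (simp add: fun_form_def cst_def)

lemma dfun_theta:
  "dfield id (\<lambda>q. cst (\<phi> q)) p = (\<Sum>A. cst (cderiv \<phi> p (cvec A)) * theta A)"
  "dfield pr10 (\<lambda>q. cst (\<phi> q)) p = (\<Sum>j. cst (cderiv \<phi> p (cvec (Inl j))) * theta (Inl j))"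
  "dfield pr01 (\<lambda>q. cst (\<phi> q)) p = (\<Sum>j. cst (cderiv \<phi> p (cvec (Inr j))) * theta (Inr j))"
proof -
  have 1: "ev (dfield id (\<lambda>q. cst (\<phi> q)) p) [v] = (\<Sum>A. tcomp A v * cderiv \<phi> p (cvec A))"
    "ev (dfield pr10 (\<lambda>q. cst (\<phi> q)) p) [v] = (\<Sum>j. fst v $ j * cderiv \<phi> p (cvec (Inl j)))"
    "ev (dfield pr01 (\<lambda>q. cst (\<phi> q)) p) [v] = (\<Sum>j. snd v $ j * cderiv \<phi> p (cvec (Inr j)))" for v
    by (simp only: ev_dfun, subst cderiv_expand, simp add: sum_UNIV_sum tcomp_def pr10_def pr01_def)+
  show "dfield id (\<lambda>q. cst (\<phi> q)) p = (\<Sum>A. cst (cderiv \<phi> p (cvec A)) * theta A)"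
    by (rule homog1_eqI) (auto intro!: homog_dfun homog_sum homog_scale homog_theta simp: 1 ev_theta
        mult.commute simp del: One_nat_def)
  show "dfield pr10 (\<lambda>q. cst (\<phi> q)) p = (\<Sum>j. cst (cderiv \<phi> p (cvec (Inl j))) * theta (Inl j))"
    by (rule homog1_eqI) (auto intro!: homog_dfun homog_sum homog_scale homog_theta simp: 1 ev_theta tcomp_def
        mult.commute simp del: One_nat_def)
  show "dfield pr01 (\<lambda>q. cst (\<phi> q)) p = (\<Sum>j. cst (cderiv \<phi> p (cvec (Inr j))) * theta (Inr j))"
    by (rule homog1_eqI) (auto intro!: homog_dfun homog_sum homog_scale homog_theta simp: 1 ev_theta tcomp_def
        mult.commute simp del: One_nat_def)
qed

lemma Cochain_dz: "Cochain (dz i p) = theta (Inl i)"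
proof -
  have "Cochain (dz i p) = dfield id (\<lambda>q. cst (q $ i)) p"
    by (simp only: dz_def Cochain_d_along Cochain_fun_form)
  then show ?thesis
    by (intro homog1_eqI) (simp_all add: ev_dfun ev_theta tcomp_def homog_dfun homog_theta del: One_nat_def)
qed

lemma Cochain_dzbar: "Cochain (dzbar i p) = theta (Inr i)"
proof -
  have "Cochain (dzbar i p) = dfield id (\<lambda>q. cst (cnj (q $ i))) p"
    by (simp only: dzbar_def Cochain_d_along Cochain_fun_form)
  then show ?thesis
    by (intro homog1_eqI) (simp_all add: ev_dfun ev_theta tcomp_def homog_dfun homog_theta del: One_nat_def)
qed

text \<open>The form \<open>om\<close> for an arbitrary matrix, outside the locale
  \<open>hermitian\<close>: differentiation needs it as a function of a varying matrix.\<close>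

definition omega :: "complex^'n^'n \<Rightarrow> 'n::finite tvec cochain" where
  "omega G = cst (\<i> / 2) * (\<Sum>i j. cst (G $ i $ j) * (theta (Inl i) * theta (Inr j)))"

lemma (in hermitian) om_omega: "om = omega G"
  by (simp add: om_def omega_def)

lemma Cochain_sum: "Cochain (\<lambda>vs. \<Sum>i\<in>S. f i vs) = (\<Sum>i\<in>S. Cochain (f i))"
  and Cochain_add: "Cochain (\<lambda>vs. f' vs + f'' vs) = Cochain f' + Cochain f''"
  and Cochain_scale: "Cochain (\<lambda>vs. c * f' vs) = cst c * Cochain f'"
  and Cochain_minus: "Cochain (\<lambda>vs. - f' vs) = - Cochain f'"
  and Cochain_diff: "Cochain (\<lambda>vs. f' vs - f'' vs) = Cochain f' - Cochain f''"
  and Cochain_divide: "Cochain (\<lambda>vs. f' vs / c) = cst (1 / c) * Cochain f'"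
  by (rule cochain_eqI; simp)+

lemma Cochain_kaehler_form: "Cochain (kaehler_form g p) = omega (g p)"
  unfolding kaehler_form_def Cochain_scale Cochain_sum Cochain_wedge Cochain_dz Cochain_dzbar omega_def ..

lemma Cochain_wedge_power: "Cochain (wedge_power \<alpha> k p) = Cochain (\<alpha> p) ^ k"
  by (induction k) (simp_all add: Cochain_fun_form Cochain_wedge)

definition omegak :: "nat \<Rightarrow> complex^'n^'n \<Rightarrow> 'n::finite tvec cochain" where
  "omegak k G = cst (1 / fact k) * omega G ^ k"

lemma Cochain_volume_form: "Cochain (volume_form (g :: 'n::finite metric) p) = omegak CARD('n) (g p)"
  unfolding volume_form_def Cochain_divide Cochain_wedge_power Cochain_kaehler_form omegak_def ..

lemma Cochain_omega_n2: "Cochain (omega_n2 (g :: 'n::finite metric) p) = omegak (CARD('n) - 2) (g p)"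
  unfolding omega_n2_def Cochain_divide Cochain_wedge_power Cochain_kaehler_form omegak_def ..

lemma (in hermitian) omk_omegak: "omk k = omegak k G"
  by (simp add: omk_def omegak_def om_omega)

section \<open>First derivatives of a Kaehler metric\<close>

locale kaehler_chart =
  fixes g :: "'n::finite metric" and W :: "(complex^'n) set"
  assumes open_W: "open W"
    and smooth_metric: "smooth_on g W"
    and hermitian_metric: "p \<in> W \<Longrightarrow> hermitian (g p)"
    and closed_form: "p \<in> W \<Longrightarrow> ext_d (kaehler_form g) p vs = 0"
begin

lemma smooth_entry: "smooth_on (\<lambda>q. g q $ i $ j) W"
  by (intro smooth_on_nth open_W smooth_metric)

lemma diff_entry: "p \<in> W \<Longrightarrow> (\<lambda>q. g q $ i $ j) differentiable (at p)"
  by (rule smooth_on_differentiable[OF smooth_entry])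

definition dg :: "'n \<Rightarrow> 'n \<Rightarrow> 'n \<Rightarrow> complex^'n \<Rightarrow> complex" where
  "dg c i j y = cderiv (\<lambda>q. g q $ i $ j) y (cvec (Inl c))"

definition bg :: "'n \<Rightarrow> 'n \<Rightarrow> 'n \<Rightarrow> complex^'n \<Rightarrow> complex" where
  "bg c i j y = cderiv (\<lambda>q. g q $ i $ j) y (cvec (Inr c))"

lemma smooth_dg: "smooth_on (dg c i j) W" and smooth_bg: "smooth_on (bg c i j) W"
  unfolding dg_def[abs_def] bg_def[abs_def] by (intro smooth_on_cderiv open_W smooth_entry)+

lemma fdiff_omega: "p \<in> W \<Longrightarrow> fdiff (\<lambda>q. omega (g q)) p"
  unfolding omega_def
  by (intro fdiff_mult fdiff_const fdiff_sum) (simp add: fdiff_cst diff_entry)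

lemma dfield_omega: "p \<in> W \<Longrightarrow> dfield id (\<lambda>q. omega (g q)) p = 0"
proof -
  assume "p \<in> W"
  have "dfield id (\<lambda>q. omega (g q)) p = Cochain (ext_d (kaehler_form g) p)"
    by (simp only: Cochain_d_along Cochain_kaehler_form)
  then show ?thesis using closed_form[OF \<open>p \<in> W\<close>] by (intro cochain_eqI) simp
qed

lemma dfield_omegak: "p \<in> W \<Longrightarrow> dfield id (\<lambda>q. omegak k (g q)) p = 0"
proof -
  assume p: "p \<in> W"
  have "dfield id (\<lambda>q. omega (g q) ^ k) p = 0"
  proof (induction k)
    case (Suc k)
    show ?case
      unfolding power_Suc dfield_mult[OF fdiff_omega[OF p] fdiff_power[OF fdiff_omega[OF p]]]
      by (simp only: dfield_omega[OF p] Suc mult_zero_left mult_zero_right add_0_left)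
  qed simp
  then show ?thesis
    unfolding omegak_def dfield_cscale[OF fdiff_power[OF fdiff_omega[OF p]]] by simp
qed

lemma fdiff_omegak: "p \<in> W \<Longrightarrow> fdiff (\<lambda>q. omegak k (g q)) p"
  unfolding omegak_def by (intro fdiff_mult fdiff_const fdiff_power fdiff_omega)

text \<open>This is d\<omega> = 0 on the frame vectors \<open>c\<close>, \<open>i\<close> and
  conjugate \<open>j\<close>. Two of the shuffles survive there, with opposite signs.\<close>

lemma dg_sym: "p \<in> W \<Longrightarrow> dg c i j p = dg i c j p"
proof -
  assume p: "p \<in> W"
  have "dfield id (\<lambda>q. omega (g q)) p = cst (\<i> / 2) * (\<Sum>i j. dfield id (\<lambda>q. cst (g q $ i $ j)) p
      * (theta (Inl i) * theta (Inr j)))"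
    unfolding omega_def
    by (simp add: dfield_cscale dfield_sum dfield_mult fdiff_sum fdiff_mult fdiff_const fdiff_cst diff_entry[OF p])
  with dfield_omega[OF p] have "cst (\<i> / 2) * (\<Sum>i j. dfield id (\<lambda>q. cst (g q $ i $ j)) p * (theta (Inl i)
      * theta (Inr j))) = cst (\<i> / 2) * 0"
    by simp
  from cst_cancel[OF this] have "ev (\<Sum>i j. dfield id (\<lambda>q. cst (g q $ i $ j)) p * (theta (Inl i) * theta (Inr j)))
      [cvec (Inl c), cvec (Inl i), cvec (Inr j)] = 0"
    by simp
  moreover have "ev (dfield id (\<lambda>q. cst (g q $ i' $ j')) p * (theta (Inl i') * theta (Inr j')))
      [cvec (Inl c), cvec (Inl i), cvec (Inr j)]
     = (if i' = i \<and> j' = j then dg c i' j' p else 0) - (if i' = c \<and> j' = j then dg i i' j' p else 0)" for i' j'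
  proof -
    have io: "iota v (dfield id (\<lambda>q. cst (g q $ i' $ j')) p) = cst (cderiv (\<lambda>q. g q $ i' $ j') p v)" for v
    proof (rule cochain_eqI)
      fix vs :: "'n tvec list"
      show "ev (iota v (dfield id (\<lambda>q. cst (g q $ i' $ j')) p)) vs = ev (cst (cderiv (\<lambda>q. g q $ i' $ j') p v)) vs"
        using homog_dfun[of id "\<lambda>q. g q $ i' $ j'" p] ev_dfun[of id "\<lambda>q. g q $ i' $ j'" p v]
        by (cases vs) (simp_all add: ev_cst homog_def)
    qed
    have s: "sg (dfield id (\<lambda>q. cst (g q $ i' $ j')) p) = - dfield id (\<lambda>q. cst (g q $ i' $ j')) p"
      using odd_dfun by (auto simp: odd_form_def)
    show ?thesis
      by (simp add: ev_mult_Cons ev_mult_Nil iota_mult io s tcomp_cvec dg_def)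
        (auto simp: ev_cst ev_1 ev_mult_Nil cst_commute tcomp_cvec)
  qed
  ultimately have "(\<Sum>i' j'. (if i' = i \<and> j' = j then dg c i' j' p else 0)
      - (if i' = c \<and> j' = j then dg i i' j' p else 0)) = 0"
    by simp
  moreover have "(\<Sum>i' j'. (if i' = x \<and> j' = y then t i' j' else (0::complex))) = t x y"
    for x y :: 'n and t
  proof -
    have "(if i' = x \<and> j' = y then t i' j' else 0) = (if i' = x then if j'
        = y then t i' j' else 0 else 0)" for i' j'
      by simp
    then have "(\<Sum>j'. (if i' = x \<and> j' = y then t i' j' else 0)) = (if i' = x then t i' y else 0)" for i'
      by (cases "i' = x") simp_all
    then show ?thesis by simp
  qed
  ultimately show ?thesis by (simp add: sum_subtractf)
qed

lemma cnj_entry: "p \<in> W \<Longrightarrow> cnj (g p $ i $ j) = g p $ j $ i"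
  using hermitian_metric hermitian.herm by metis

lemma cnj_dg: "p \<in> W \<Longrightarrow> cnj (dg c i j p) = bg c j i p"
proof -
  assume p: "p \<in> W"
  have tc: "tconj (cvec (Inr c)) = cvec (Inl c)"
    by (simp add: tconj_def cvec_def vec_eq_iff axis_def)
  have "bg c j i p = cderiv (\<lambda>q. cnj (g q $ i $ j)) p (cvec (Inr c))"
    unfolding bg_def by (rule cderiv_cong[OF open_W p]) (simp add: cnj_entry)
  also have "\<dots> = cnj (dg c i j p)"
    by (simp add: cderiv_cnj diff_entry[OF p] tc dg_def)
  finally show ?thesis by simp
qed

lemma bg_sym: "p \<in> W \<Longrightarrow> bg c i j p = bg j i c p"
  by (metis cnj_dg dg_sym)

end

lemma sum_rotate: "(\<Sum>i\<in>I. \<Sum>e\<in>J. \<Sum>k\<in>K. t i e k) = (\<Sum>e\<in>J. \<Sum>k\<in>K. \<Sum>i\<in>I. t i e k)"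
  by (rule trans[OF sum.swap], intro sum.cong refl, rule sum.swap)

section \<open>Christoffel symbols, second derivatives and curvature\<close>

context kaehler_chart
begin

definition Gam :: "'n \<Rightarrow> 'n \<Rightarrow> 'n \<Rightarrow> complex^'n \<Rightarrow> complex" where
  "Gam i j k y = (\<Sum>d. inv_metric (g y) i d * dg j k d y)"

lemma Gam_sym: "y \<in> W \<Longrightarrow> Gam i j k y = Gam i k j y"
  unfolding Gam_def using dg_sym by metis

text \<open>In the symbols with a barred lower index the derivatives of the metric cancel in pairs
  by \<open>bg_sym\<close> or involve only its zero blocks. The connection thus preserves type, and
  forms with values in \<open>E'\<close> can be treated with the symbols \<open>Gam\<close>
  alone.\<close>

lemma christoffel_Inl:
  assumes y: "y \<in> W"
  shows "christoffel g y (Inl i) (Inl j) (Inl k) = Gam i j k y"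
    "christoffel g y (Inl i) (Inl j) (Inr k) = 0"
    "christoffel g y (Inl i) (Inr j) (Inl k) = 0"
    "christoffel g y (Inl i) (Inr j) (Inr k) = 0"
proof -
  interpret hermitian "g y" by (rule hermitian_metric[OF y])
  have half: "cderiv (\<lambda>u. g u $ k $ d / 2) y v = cderiv (\<lambda>u. g u $ k $ d) y v / 2" for k d v
    using cderiv_cmult[OF diff_entry[OF y], of "1 / 2"] by simp
  have riem_nth: "riem H $ Inl k $ Inr d = H $ k $ d / 2" "riem H $ Inr d $ Inl k = H $ k $ d / 2"
    "riem H $ Inl k $ Inl l = 0" "riem H $ Inr k $ Inr l = 0" for H :: "complex^'n^'n" and k d l
    by (simp_all add: riem_def)
  have s: "christoffel g y (Inl i) B C = (\<Sum>d. 2 * ginv i d *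
     (cderiv (\<lambda>u. riem (g u) $ C $ Inr d) y (cvec B) + cderiv (\<lambda>u. riem (g u) $ B $ Inr d) y (cvec C)
        - cderiv (\<lambda>u. riem (g u) $ B $ C) y (cvec (Inr d))) / 2)" for B C
    unfolding christoffel_def sum_UNIV_sum by (simp add: riem_ginv)
  show "christoffel g y (Inl i) (Inl j) (Inl k) = Gam i j k y"
    unfolding s riem_nth half Gam_def dg_def[symmetric] dg_sym[OF y, of k j] by (simp add: field_simps)
  show "christoffel g y (Inl i) (Inl j) (Inr k) = 0"
    unfolding s riem_nth half bg_def[symmetric] bg_sym[OF y, of k j] by simp
  show "christoffel g y (Inl i) (Inr j) (Inl k) = 0"
    unfolding s riem_nth half bg_def[symmetric] bg_sym[OF y, of j k] by simp
  show "christoffel g y (Inl i) (Inr j) (Inr k) = 0"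
    unfolding s riem_nth by simp
qed

definition hess :: "'n \<Rightarrow> 'n \<Rightarrow> 'n \<Rightarrow> 'n \<Rightarrow> complex^'n \<Rightarrow> complex" where
  "hess c e k j y = cderiv (dg e k j) y (cvec (Inr c))"

lemma hess_eq: "y \<in> W \<Longrightarrow> hess c e k j y = cderiv (bg c k j) y (cvec (Inl e))"
  unfolding hess_def dg_def[abs_def] bg_def[abs_def]
  by (rule cderiv_commute[OF open_W _ smooth_entry])

lemma hess_sym1: "y \<in> W \<Longrightarrow> hess c e k j y = hess c k e j y"
  unfolding hess_def by (rule cderiv_cong[OF open_W]) (auto simp: dg_sym)

lemma hess_sym2: "y \<in> W \<Longrightarrow> hess c e k j y = hess j e k c y"
  by (simp only: hess_eq, rule cderiv_cong[OF open_W]) (auto intro: bg_sym)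

lemma tconj_cvec: "tconj (cvec (Inr c)) = cvec (Inl c)" "tconj (cvec (Inl c)) = cvec (Inr c)"
  by (simp_all add: tconj_def cvec_def vec_eq_iff axis_def)

lemma cnj_hess: "y \<in> W \<Longrightarrow> cnj (hess c e k j y) = hess e c j k y"
proof -
  assume y: "y \<in> W"
  have "hess e c j k y = cderiv (bg e j k) y (cvec (Inl c))" by (rule hess_eq[OF y])
  also have "\<dots> = cderiv (\<lambda>q. cnj (dg e k j q)) y (cvec (Inl c))"
    by (rule cderiv_cong[OF open_W y]) (simp add: cnj_dg)
  also have "\<dots> = cnj (hess c e k j y)"
    unfolding hess_def by (simp add: cderiv_cnj smooth_on_differentiable[OF smooth_dg y] tconj_cvec)
  finally show ?thesis by simp
qed

text \<open>The symmetries of \<open>hess\<close> move the indices so that both terms start from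
  derivatives of the entry (k, l) in the directions \<open>i\<close> and conjugate \<open>j\<close>.
  In this form the curvature appears in \<open>d_bracket\<close> and is compared under coordinate
  changes.\<close>

lemma curvature_eq:
  assumes y: "y \<in> W"
  shows "curvature g y i j k l = - hess j i k l y
    + (\<Sum>p q. inv_metric (g y) p q * dg i k q y * bg j p l y)"
proof -
  have "cderiv (\<lambda>u. cderiv (\<lambda>u'. g u' $ i $ j) u (cvec (Inr l))) y (cvec (Inl k)) = hess l k i j y"
    unfolding hess_eq[OF y] bg_def[abs_def] ..
  also have "\<dots> = hess j i k l y" using hess_sym1[OF y] hess_sym2[OF y] by metis
  finally show ?thesis by (simp add: curvature_def dg_def bg_def)
qed

text \<open>Conjugation exchanges the barred and unbarred index of each pair; this is the source of
  the reality of Q.\<close>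

lemma cnj_curvature:
  assumes y: "y \<in> W"
  shows "cnj (curvature g y i j k l) = curvature g y j i l k"
proof -
  interpret hermitian "g y" by (rule hermitian_metric[OF y])
  have bg: "cnj (bg c i j y) = dg c j i y" for c i j
    using cnj_dg[OF y, of c j i] by (metis complex_cnj_cnj)
  show ?thesis
    unfolding curvature_eq[OF y]
    by (simp add: cnj_hess[OF y] ginv_herm cnj_dg[OF y] bg, subst sum.swap) (simp add: mult_ac)
qed

end

lemma conj_pull_theta:
  "conj_pull tconj (theta (Inl i)) = theta (Inr i)" "conj_pull tconj (theta (Inr i)) = theta (Inl i)"
proof -
  have "homog 1 (conj_pull tconj (theta A))" for A :: "'a + 'a" by (simp add: homog_def theta_def)
  then show "conj_pull tconj (theta (Inl i)) = theta (Inr i)" "conj_pull tconj (theta (Inr i)) = theta (Inl i)"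
    by (auto intro!: homog1_eqI homog_theta simp: ev_theta tcomp_def tconj_def simp del: One_nat_def)
qed

text \<open>Conjugating \<i>/2 changes the sign, and so does restoring the order of the two
  conjugated covectors.\<close>

lemma (in hermitian) conj_omegak: "conj_pull tconj (omegak k G) = omegak k G"
proof -
  have "conj_pull tconj (omega G)
      = cst (- \<i> / 2) * (\<Sum>i j. cst (G $ j $ i) * (theta (Inr i) * theta (Inl j)))"
    unfolding omega_def by (simp add: conj_pull_theta herm[symmetric])
  also have "\<dots> = cst (- \<i> / 2) * (\<Sum>j i. - (cst (G $ j $ i) * (theta (Inl j) * theta (Inr i))))"
    by (subst sum.swap) (simp add: theta_commute[of "Inr _"])
  also have "\<dots> = omega G"
    unfolding omega_def by (simp add: sum_negf cst_minus)
  finally show ?thesis by (simp add: omegak_def)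
qed

section \<open>Harmonic maps in charts\<close>

locale kaehler_map = M: kaehler_chart g W + N: kaehler_chart h V
  for g :: "'n::finite metric" and W and h :: "'m::finite metric" and V +
  fixes F :: "complex^'n \<Rightarrow> complex^'m"
  assumes smooth_F: "smooth_on F W" and F_in: "p \<in> W \<Longrightarrow> F p \<in> V"
begin

text \<open>Lower case letters belong to the components of \<open>F\<close>, capitals
  \<open>A\<close>, \<open>B\<close> and \<open>Ec\<close> to their conjugates. These fields
  instantiate the locale \<open>bracket_algebra\<close>.\<close>

definition a :: "'m \<Rightarrow> 'n field" where "a i = dfield pr10 (\<lambda>q. cst (F q $ i))"
definition b :: "'m \<Rightarrow> 'n field" where "b i = dfield pr01 (\<lambda>q. cst (F q $ i))"
definition A :: "'m \<Rightarrow> 'n field" where "A i = dfield pr10 (\<lambda>q. cst (cnj (F q $ i)))"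
definition B :: "'m \<Rightarrow> 'n field" where "B i = dfield pr01 (\<lambda>q. cst (cnj (F q $ i)))"
definition E :: "'m \<Rightarrow> 'n field" where "E i = dfield pr01 (a i)"
definition Ec :: "'m \<Rightarrow> 'n field" where "Ec i = dfield pr01 (A i)"

lemma smooth_F_nth: "smooth_on (\<lambda>q. F q $ i) W"
  by (rule smooth_on_nth[OF M.open_W smooth_F])

lemma smooth_coord: "smooth_field (\<lambda>q. cst (F q $ i)) W" "smooth_field (\<lambda>q. cst (cnj (F q $ i))) W"
  by (intro smooth_field_cst smooth_on_cnj smooth_F_nth M.open_W)+

lemma smooth_fields: "smooth_field (a i) W" "smooth_field (b i) W" "smooth_field (A i) W" "smooth_field (B i) W"
  "smooth_field (E i) W" "smooth_field (Ec i) W"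
  unfolding a_def b_def A_def B_def E_def Ec_def
  by (intro smooth_field_dfield M.open_W smooth_coord)+

lemma fdiff_fields: "p \<in> W \<Longrightarrow> fdiff (a i) p" "p \<in> W \<Longrightarrow> fdiff (b i) p" "p \<in> W \<Longrightarrow> fdiff (A i) p"
  "p \<in> W \<Longrightarrow> fdiff (B i) p" "p \<in> W \<Longrightarrow> fdiff (E i) p" "p \<in> W \<Longrightarrow> fdiff (Ec i) p"
  by (erule smooth_field_fdiff[OF smooth_fields(1)] smooth_field_fdiff[OF smooth_fields(2)]
      smooth_field_fdiff[OF smooth_fields(3)] smooth_field_fdiff[OF smooth_fields(4)]
      smooth_field_fdiff[OF smooth_fields(5)] smooth_field_fdiff[OF smooth_fields(6)])+

lemma odd_fields: "odd_form (a i p)" "odd_form (b i p)" "odd_form (A i p)" "odd_form (B i p)"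
  unfolding a_def b_def A_def B_def by (rule odd_dfun)+

lemma even_E: "even_form (E i p)"
  unfolding E_def a_def by (rule even_ddfun)

lemma d_fields:
  assumes p: "p \<in> W"
  shows "dfield id (a i) p = E i p" "dfield id (b i) p = - E i p" "dfield pr10 (b i) p = - E i p"
    "dfield id (A i) p = Ec i p" "dfield id (B i) p = - Ec i p" "dfield pr10 (B i) p = - Ec i p"
proof -
  note dd = dfield_dfield[OF M.open_W p smooth_coord(1)] dfield_dfield[OF M.open_W p smooth_coord(2)]
  note anti = dfield_anticommute[OF M.open_W p smooth_coord(1), of pr10 pr01] dfield_anticommute[OF M.open_W p
      smooth_coord(2), of pr10 pr01]
  show "dfield id (a i) p = E i p" "dfield id (b i) p = - E i p" "dfield pr10 (b i) p = - E i p"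
    "dfield id (A i) p = Ec i p" "dfield id (B i) p = - Ec i p" "dfield pr10 (B i) p = - Ec i p"
    unfolding dfield_id a_def b_def A_def B_def E_def Ec_def by (simp_all add: dd anti)
qed

lemma dfield_E: "p \<in> W \<Longrightarrow> dfield id (E i) p = 0"
proof -
  assume p: "p \<in> W"
  have "dfield id (E i) p = dfield id (dfield id (a i)) p"
    by (rule dfield_cong[OF M.open_W p]) (simp add: d_fields)
  then show ?thesis using dfield_dfield[OF M.open_W p smooth_fields(1)] by simp
qed

lemma conj_fields:
  assumes p: "p \<in> W"
  shows "conj_pull tconj (a i p) = B i p" "conj_pull tconj (b i p) = A i p"
    "conj_pull tconj (A i p) = b i p" "conj_pull tconj (B i p) = a i p"
proof -
  have fc: "fdiff (\<lambda>q. cst (F q $ i)) p" "fdiff (\<lambda>q. cst (cnj (F q $ i))) p"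
    using smooth_coord p smooth_field_fdiff by blast+
  show "conj_pull tconj (a i p) = B i p" "conj_pull tconj (b i p) = A i p"
    "conj_pull tconj (A i p) = b i p" "conj_pull tconj (B i p) = a i p"
    unfolding a_def b_def A_def B_def
    using conj_pull_dfield[OF fc(1), of pr10 pr01] conj_pull_dfield[OF fc(1), of pr01 pr10]
      conj_pull_dfield[OF fc(2), of pr10 pr01] conj_pull_dfield[OF fc(2), of pr01 pr10]
    by (simp_all add: tconj_pr)
qed

text \<open>Conjugation turns \<bar>\<partial>\<partial> into \<partial>\<bar>\<partial>, and the
  sign comes from anticommuting these back.\<close>

lemma conj_E: "p \<in> W \<Longrightarrow> conj_pull tconj (E i p) = - Ec i p"
proof -
  assume p: "p \<in> W"
  have "conj_pull tconj (E i p) = dfield pr10 (\<lambda>q. conj_pull tconj (a i q)) p"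
    unfolding E_def by (rule conj_pull_dfield[OF fdiff_fields(1)[OF p]]) (simp add: tconj_pr)
  also have "\<dots> = dfield pr10 (B i) p"
    by (rule dfield_cong[OF M.open_W p]) (rule conj_fields)
  finally show ?thesis by (simp add: d_fields[OF p])
qed

text \<open>The components of \<bar>\<partial>\<partial>f in the covariant sense, as
  \<open>Cochain_delbar_E\<close> confirms.\<close>

definition psi :: "'m \<Rightarrow> 'n field" where
  "psi i p = E i p + (\<Sum>e k. cst (N.Gam i e k (F p)) * (b e p * a k p))"

lemma Cochain_coord:
  "Cochain (d_along \<pi> (coord_form F (Inl i)) p) = dfield \<pi> (\<lambda>q. cst (F q $ i)) p"
  "Cochain (d_along \<pi> (coord_form F (Inr i)) p) = dfield \<pi> (\<lambda>q. cst (cnj (F q $ i))) p"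
  by (simp_all add: Cochain_d_along coord_form_def Cochain_fun_form)

lemma Cochain_maps: "Cochain (del_map F i p) = a i p" "Cochain (delbar_map F i p) = b i p"
  by (simp_all add: del_map_def delbar_map_def Cochain_coord a_def b_def)

lemma Cochain_cov_d:
  assumes p: "p \<in> W"
  shows "Cochain (cov_d \<pi> h F \<psi> (Inl i) p) = dfield \<pi> (\<lambda>q. Cochain (\<psi> (Inl i) q)) p
    + (\<Sum>j k. cst (N.Gam i j k (F p)) * (dfield \<pi> (\<lambda>q. cst (F q $ j)) p * Cochain (\<psi> (Inl k) p)))"
  unfolding cov_d_def Cochain_add Cochain_sum Cochain_scale Cochain_wedge sum_UNIV_sum
    N.christoffel_Inl[OF F_in[OF p]] Cochain_coord
  by (simp add: Cochain_d_along)

lemma Cochain_delbar_E: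
  assumes p: "p \<in> W"
  shows "Cochain (delbar_E' h F (del_map F) i p) = psi i p"
  unfolding delbar_E'_def Cochain_cov_d[OF p] psi_def
  by (simp add: incl_E_def Cochain_maps b_def E_def)

text \<open>The connection is torsion free: \<partial> and \<bar>\<partial> anticommute, the lower
  indices of \<open>Gam\<close> are symmetric, and the 1-forms \<open>a\<close> and \<open>b\<close>
  anticommute.\<close>

lemma Cochain_del_E:
  assumes p: "p \<in> W"
  shows "Cochain (del_E' h F (delbar_map F) i p) = - psi i p"
proof -
  have "(\<Sum>j k. cst (N.Gam i j k (F p)) * (a j p * b k p))
    = (\<Sum>k j. - (cst (N.Gam i k j (F p)) * (b k p * a j p)))"
    by (subst sum.swap) (simp add: N.Gam_sym[OF F_in[OF p], of i _ _]
        odd_anticommute[OF odd_fields(1) odd_fields(2)])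
  then show ?thesis
    unfolding del_E'_def Cochain_cov_d[OF p] psi_def
    by (simp add: incl_E_def Cochain_maps d_fields[OF p] sum_negf flip: a_def)
qed

definition Psi :: "'m \<Rightarrow> 'n field" where
  "Psi j q = (\<Sum>i. cst (h (F q) $ i $ j) * E i q)
     + (\<Sum>e k. cst (N.dg e k j (F q)) * (b e q * a k q))"

lemma Psi_eq:
  assumes p: "p \<in> W"
  shows "(\<Sum>i. cst (h (F p) $ i $ j) * psi i p) = Psi j p"
proof -
  interpret H: hermitian "h (F p)" by (rule N.hermitian_metric[OF F_in[OF p]])
  have G: "(\<Sum>i. h (F p) $ i $ j * N.Gam i e k (F p)) = N.dg e k j (F p)" for e k
  proof -
    have "(\<Sum>i. h (F p) $ i $ j * N.Gam i e k (F p))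
      = (\<Sum>d. (\<Sum>i. H.ginv i d * h (F p) $ i $ j) * N.dg e k d (F p))"
      unfolding N.Gam_def sum_distrib_left sum_distrib_right by (subst sum.swap) (simp add: mult_ac)
    also have "\<dots> = N.dg e k j (F p)"
      unfolding H.ginv_left by (rule sum_delta_mult)
    finally show ?thesis .
  qed
  have "(\<Sum>i e k. cst (h (F p) $ i $ j * N.Gam i e k (F p)) * (b e p * a k p))
     = (\<Sum>e k. cst (\<Sum>i. h (F p) $ i $ j * N.Gam i e k (F p)) * (b e p * a k p))"
    unfolding cst_sum sum_distrib_right by (rule sum_rotate)
  then show ?thesis
    unfolding Psi_def psi_def
    by (simp only: distrib_left sum.distrib sum_distrib_left cst_cst G)
qed

section \<open>The bracket and its differential\<close>

abbreviation bracket_df :: "'n form" where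
  "bracket_df \<equiv> bracket h F (delbar_E' h F (del_map F)) (\<lambda>i q us. delbar_map F i q us - del_map F i q us)"

lemma Cochain_cnj_form: "Cochain (cnj_form \<alpha> p) = conj_pull tconj (Cochain (\<alpha> p))"
proof -
  have "tconj = (\<lambda>(a, b). (\<chi> j. cnj (b $ j), \<chi> j. cnj (a $ j)))"
    by (auto simp: tconj_def)
  note * = this[symmetric]
  show ?thesis by (rule cochain_eqI) (simp add: cnj_form_def *)
qed

text \<open>Conjugation sends \<bar>\<partial>f - \<partial>f to \<open>A - B\<close>; carrying out
  the sum over the unbarred index first replaces \<open>psi\<close> by its lowered form.\<close>

lemma Cochain_bracket:
  assumes p: "p \<in> W"
  shows "Cochain (bracket_df p) = (\<Sum>j. Psi j p * (A j p - B j p))"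
proof -
  have "Cochain (bracket_df p) = (\<Sum>i j. cst (h (F p) $ i $ j) * (psi i p * (A j p - B j p)))"
    unfolding bracket_def Cochain_sum Cochain_scale Cochain_wedge Cochain_cnj_form Cochain_delbar_E[OF p]
      Cochain_diff Cochain_maps
    by (simp add: conj_fields[OF p])
  also have "\<dots> = (\<Sum>j. (\<Sum>i. cst (h (F p) $ i $ j) * psi i p) * (A j p - B j p))"
    by (subst sum.swap) (simp only: sum_distrib_right mult.assoc)
  finally show ?thesis by (simp only: Psi_eq[OF p])
qed

lemma dfun_comp:
  assumes p: "p \<in> W" and u: "u differentiable (at (F p))"
  shows "dfield id (\<lambda>q. cst (u (F q))) p
    = (\<Sum>c. cst (cderiv u (F p) (cvec (Inl c))) * (a c p + b c p))
     + (\<Sum>c. cst (cderiv u (F p) (cvec (Inr c))) * (A c p + B c p))"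
  unfolding dfun_chain[OF smooth_on_differentiable[OF smooth_F p] u] dfield_id a_def b_def A_def B_def ..

lemma diff_comp: "p \<in> W \<Longrightarrow> smooth_on u V \<Longrightarrow> (\<lambda>q. u (F q)) differentiable (at p)"
  using differentiable_chain_at[OF smooth_on_differentiable[OF smooth_F] smooth_on_differentiable[OF _ F_in]]
  by (simp add: o_def)

lemma diff_at_F: "p \<in> W \<Longrightarrow> smooth_on u V \<Longrightarrow> u differentiable (at (F p))"
  using smooth_on_differentiable F_in by blast

lemma algebra_at:
  assumes p: "p \<in> W"
  shows "bracket_algebra (\<lambda>i. a i p) (\<lambda>i. b i p) (\<lambda>i. A i p) (\<lambda>i. B i p) (\<lambda>i. E i p)
    (\<lambda>c i j. N.dg c i j (F p)) (\<lambda>c i j. N.bg c i j (F p))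
    (\<lambda>c e k j. cderiv (N.dg e k j) (F p) (cvec (Inl c))) (\<lambda>c e k j. N.hess c e k j (F p))"
proof
  note y = F_in[OF p]
  show "cderiv (N.dg e k j) (F p) (cvec (Inl c)) = cderiv (N.dg c k j) (F p) (cvec (Inl e))" for c e k j
    unfolding N.dg_def[abs_def] by (rule cderiv_commute[OF N.open_W y N.smooth_entry])
  show "cderiv (N.dg e k j) (F p) (cvec (Inl c)) = cderiv (N.dg k e j) (F p) (cvec (Inl c))" for c e k j
    by (rule cderiv_cong[OF N.open_W y]) (rule N.dg_sym)
  show "N.hess c e k j (F p) = N.hess j e k c (F p)" for c e k j by (rule N.hess_sym2[OF y])
  show "N.dg c i j (F p) = N.dg i c j (F p)" for c i j by (rule N.dg_sym[OF y])
  show "N.bg c i j (F p) = N.bg j i c (F p)" for c i j by (rule N.bg_sym[OF y])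
qed (rule odd_fields even_E)+

lemma fdiff_ba: "p \<in> W \<Longrightarrow> fdiff (\<lambda>q. b e q * a k q) p"
  by (intro fdiff_mult fdiff_fields)

lemma fdiff_Psi: "p \<in> W \<Longrightarrow> fdiff (Psi j) p"
  unfolding Psi_def[abs_def]
  by (intro fdiff_add fdiff_sum fdiff_mult fdiff_fields)
    (simp_all add: fdiff_cst diff_comp[OF _ N.smooth_entry] diff_comp[OF _ N.smooth_dg])

lemma even_Psi: "even_form (Psi j p)"
proof -
  have "even_form (x + y)" if "even_form x" "even_form y" for x y :: "'n tvec cochain"
    using that by (simp add: even_form_def)
  note add = this
  show ?thesis unfolding Psi_def
    by (intro add even_form_sum even_form_scale) (simp_all add: even_E odd_odd_mult odd_fields)
qed

text \<open>\<open>E\<close> is closed and the differential of \<open>b e * a k\<close> is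
  \<open>- (E e * a k) - b e * E k\<close>. The coefficients depend on the point through
  \<open>F\<close>, so the chain rule expresses their differentials by all four kinds of
  1-forms.\<close>

lemma dfield_Psi:
  assumes p: "p \<in> W"
  shows "dfield id (Psi j) p = bracket_algebra.dPsi (\<lambda>i. a i p) (\<lambda>i. b i p) (\<lambda>i. A i p) (\<lambda>i. B i p) (\<lambda>i. E i p)
    (\<lambda>c i j. N.dg c i j (F p)) (\<lambda>c i j. N.bg c i j (F p))
    (\<lambda>c e k j. cderiv (N.dg e k j) (F p) (cvec (Inl c))) (\<lambda>c e k j. N.hess c e k j (F p)) j"
proof -
  have 1: "dfield id (\<lambda>q. cst (h (F q) $ i $ j) * E i q) p
     = ((\<Sum>c. cst (N.dg c i j (F p)) * (a c p + b c p))
       + (\<Sum>c. cst (N.bg c i j (F p)) * (A c p + B c p))) * E i p" for i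
    unfolding dfield_scale[OF diff_comp[OF p N.smooth_entry] fdiff_fields(5)[OF p]] dfield_E[OF p]
      dfun_comp[OF p diff_at_F[OF p N.smooth_entry]] N.dg_def N.bg_def by simp
  have ba: "dfield id (\<lambda>q. b e q * a k q) p = - (E e p * a k p) - b e p * E k p" for e k
    using odd_fields(2)[of e p] unfolding dfield_mult[OF fdiff_fields(2)[OF p] fdiff_fields(1)[OF p]] d_fields[OF p]
    by (simp add: odd_form_def)
  have 2: "dfield id (\<lambda>q. cst (N.dg e k j (F q)) * (b e q * a k q)) p
     = ((\<Sum>c. cst (cderiv (N.dg e k j) (F p) (cvec (Inl c))) * (a c p + b c p))
       + (\<Sum>c. cst (N.hess c e k j (F p)) * (A c p + B c p))) * (b e p * a k p)
       + cst (N.dg e k j (F p)) * (- (E e p * a k p) - b e p * E k p)" for e k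
    unfolding dfield_scale[OF diff_comp[OF p N.smooth_dg] fdiff_ba[OF p]] ba
      dfun_comp[OF p diff_at_F[OF p N.smooth_dg]] N.hess_def ..
  have f1: "fdiff (\<lambda>q. cst (h (F q) $ i $ j) * E i q) p" for i
    by (intro fdiff_mult fdiff_fields p) (simp add: fdiff_cst diff_comp[OF p N.smooth_entry])
  have f2: "fdiff (\<lambda>q. cst (N.dg e k j (F q)) * (b e q * a k q)) p" for e k
    by (intro fdiff_mult fdiff_ba fdiff_fields p) (simp add: fdiff_cst diff_comp[OF p N.smooth_dg])
  have "dfield id (Psi j) p = (\<Sum>i. dfield id (\<lambda>q. cst (h (F q) $ i $ j) * E i q) p)
     + (\<Sum>e k. dfield id (\<lambda>q. cst (N.dg e k j (F q)) * (b e q * a k q)) p)"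
    unfolding Psi_def[abs_def]
    by (subst dfield_add, intro fdiff_sum f1, intro fdiff_sum f2, subst dfield_sum, rule f1,
        subst dfield_sum, intro fdiff_sum f2, subst dfield_sum, rule f2, rule refl)
  then show ?thesis unfolding 1 2 bracket_algebra.dPsi_def[OF algebra_at[OF p]] .
qed

text \<open>The terms that are not of type \<open>(2,2)\<close> cancel by the symmetries of the derivatives of \<open>h\<close>.\<close>

lemma d_bracket:
  assumes p: "p \<in> W"
  shows "Cochain (ext_d bracket_df p)
    = cst (- 2) * (\<Sum>i j. cst (h (F p) $ i $ j) * (psi i p * conj_pull tconj (psi j p)))
    + cst 2 * (\<Sum>i j k l. cst (curvature h (F p) i j k l)
        * (b i p * a k p * (A j p * B l p)))"
proof -
  interpret H: hermitian "h (F p)" by (rule N.hermitian_metric[OF F_in[OF p]])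
  interpret alg: bracket_algebra "\<lambda>i. a i p" "\<lambda>i. b i p" "\<lambda>i. A i p" "\<lambda>i. B i p" "\<lambda>i. E i p"
    "\<lambda>c i j. N.dg c i j (F p)" "\<lambda>c i j. N.bg c i j (F p)"
    "\<lambda>c e k j. cderiv (N.dg e k j) (F p) (cvec (Inl c))" "\<lambda>c e k j. N.hess c e k j (F p)"
    by (rule algebra_at[OF p])
  have fAB: "fdiff (\<lambda>q. A j q - B j q) p" for j by (intro fdiff_diff fdiff_fields p)
  have "Cochain (ext_d bracket_df p) = dfield id (\<lambda>q. \<Sum>j. Psi j q * (A j q - B j q)) p"
    unfolding Cochain_d_along by (rule dfield_cong[OF M.open_W p]) (rule Cochain_bracket)
  also have "\<dots> = (\<Sum>j. dfield id (\<lambda>q. Psi j q * (A j q - B j q)) p)"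
    by (rule dfield_sum) (intro fdiff_mult fdiff_Psi fAB p)
  also have "\<dots> = (\<Sum>j. alg.dPsi j * (A j p - B j p) + cst 2 * (Psi j p * Ec j p))"
  proof (rule sum.cong[OF refl])
    fix j
    \<comment> \<open>The differentials of \<open>A j\<close> and \<open>B j\<close> are opposite,
      so the difference in the bracket doubles the term instead of cancelling it.\<close>
    have "dfield id (\<lambda>q. A j q - B j q) p = cst 2 * Ec j p"
      unfolding dfield_diff[OF fdiff_fields(3)[OF p] fdiff_fields(4)[OF p]] d_fields[OF p]
          by (rule cochain_eqI) simp
    then show "dfield id (\<lambda>q. Psi j q * (A j q - B j q)) p
        = alg.dPsi j * (A j p - B j p) + cst 2 * (Psi j p * Ec j p)"
      unfolding dfield_mult[OF fdiff_Psi[OF p] fAB] dfield_Psi[OF p]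
      using even_Psi[of j p] by (simp add: even_form_def cst_left_commute)
  qed
  also have "\<dots> = cst (- 2) * (\<Sum>c j. alg.X c j * (A c p * B j p))
      + cst 2 * (\<Sum>j. Psi j p * Ec j p)"
    by (simp only: sum.distrib alg.sum_dPsi sum_distrib_left)
  finally have lhs: "Cochain (ext_d bracket_df p) = cst (- 2) * (\<Sum>c j. alg.X c j * (A c p * B j p))
      + cst 2 * (\<Sum>j. Psi j p * Ec j p)" .

  \<comment> \<open>The part of the curvature that contains the inverse metric. It arises when the
    connection term in the conjugate of \<open>psi\<close> meets the one in
    \<open>Psi\<close>.\<close>
  define K where "K e c k d = (\<Sum>x q. H.ginv x q * N.dg e k q (F p) * N.bg c x d (F p))" for e c k d
  have conjpsi: "conj_pull tconj (psi j p) = - Ec j p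
      + (\<Sum>c d. cst (cnj (N.Gam j c d (F p))) * (A c p * B d p))" for j
    unfolding psi_def by (simp add: conj_E[OF p] conj_fields[OF p])
  have PsiGam: "(\<Sum>j. cst (cnj (N.Gam j c d (F p))) * Psi j p)
     = (\<Sum>i. cst (N.bg c i d (F p)) * E i p) + (\<Sum>e k. cst (K e c k d) * (b e p * a k p))" for c d
  proof -
    have cG: "cnj (N.Gam j c d (F p)) = (\<Sum>x. H.ginv x j * N.bg c x d (F p))" for j
      unfolding N.Gam_def by (simp add: H.ginv_herm N.cnj_dg[OF F_in[OF p]])
    have s1: "(\<Sum>j. cnj (N.Gam j c d (F p)) * h (F p) $ i $ j) = N.bg c i d (F p)" for i
    proof -
      have "(\<Sum>j. cnj (N.Gam j c d (F p)) * h (F p) $ i $ j)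
        = (\<Sum>x. (\<Sum>j. H.ginv x j * h (F p) $ i $ j) * N.bg c x d (F p))"
        unfolding cG sum_distrib_right by (subst sum.swap) (simp add: mult_ac)
      then show ?thesis unfolding H.ginv_right by (simp only: sum_delta_mult)
    qed
    have s2: "(\<Sum>j. cnj (N.Gam j c d (F p)) * N.dg e k j (F p)) = K e c k d" for e k
      unfolding cG K_def sum_distrib_right by (subst sum.swap) (simp add: mult_ac)
    have "(\<Sum>j i. cst (cnj (N.Gam j c d (F p)) * h (F p) $ i $ j) * E i p)
       = (\<Sum>i. cst (\<Sum>j. cnj (N.Gam j c d (F p)) * h (F p) $ i $ j) * E i p)"
      unfolding cst_sum sum_distrib_right by (rule sum.swap)
    moreover have "(\<Sum>j e k. cst (cnj (N.Gam j c d (F p)) * N.dg e k j (F p)) * (b e p * a k p))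
       = (\<Sum>e k. cst (\<Sum>j. cnj (N.Gam j c d (F p)) * N.dg e k j (F p)) * (b e p * a k p))"
      unfolding cst_sum sum_distrib_right by (rule sum_rotate)
    ultimately show ?thesis
      unfolding Psi_def by (simp only: distrib_left sum.distrib sum_distrib_left cst_cst s1 s2)
  qed
  have "(\<Sum>i j. cst (h (F p) $ i $ j) * (psi i p * conj_pull tconj (psi j p)))
     = (\<Sum>j. Psi j p * conj_pull tconj (psi j p))"
    unfolding Psi_eq[OF p, symmetric] sum_distrib_right mult.assoc by (rule sum.swap)
  also have "\<dots> = - (\<Sum>j. Psi j p * Ec j p)
     + (\<Sum>j c d. cst (cnj (N.Gam j c d (F p))) * Psi j p * (A c p * B d p))"
    unfolding conjpsi by (simp add: distrib_left sum.distrib sum_distrib_left sum_negf cst_left_commute[of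
        "Psi _ p"] mult.assoc
        right_diff_distrib sum_subtractf)
  also have "(\<Sum>j c d. cst (cnj (N.Gam j c d (F p))) * Psi j p * (A c p * B d p))
     = (\<Sum>c d. (\<Sum>j. cst (cnj (N.Gam j c d (F p))) * Psi j p) * (A c p * B d p))"
    unfolding sum_distrib_right by (rule sum_rotate)
  finally have mid: "(\<Sum>i j. cst (h (F p) $ i $ j) * (psi i p * conj_pull tconj (psi j p)))
     = - (\<Sum>j. Psi j p * Ec j p) + (\<Sum>c d. ((\<Sum>i. cst (N.bg c i d (F p)) * E i p)
        + (\<Sum>e k. cst (K e c k d) * (b e p * a k p))) * (A c p * B d p))"
    unfolding PsiGam .
  \<comment> \<open>\<open>Y\<close> occurs in the norm term as well as in the sum over
    \<open>alg.X\<close> and drops out. \<open>Z\<close> and \<open>T\<close> carry the products and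
    the second derivatives of the metric, and \<open>Z - T\<close> is the curvature sum.\<close>
  define Y where "Y = (\<Sum>c d. (\<Sum>i. cst (N.bg c i d (F p)) * E i p) * (A c p * B d p))"
  define Z where "Z = (\<Sum>c d. (\<Sum>e k. cst (K e c k d) * (b e p * a k p)) * (A c p * B d p))"
  define T where "T = (\<Sum>c d. (\<Sum>e k. cst (N.hess c e k d (F p)) * (b e p * a k p)) * (A c p * B d p))"
  have X: "(\<Sum>c j. alg.X c j * (A c p * B j p)) = Y + T"
    unfolding alg.X_def Y_def T_def by (simp only: distrib_right sum.distrib)
  have mid': "(\<Sum>i j. cst (h (F p) $ i $ j) * (psi i p * conj_pull tconj (psi j p)))
     = - (\<Sum>j. Psi j p * Ec j p) + (Y + Z)"
    unfolding mid Y_def Z_def by (simp only: distrib_right sum.distrib)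
  have curv: "curvature h (F p) i j k l = K i j k l - N.hess j i k l (F p)" for i j k l
    unfolding N.curvature_eq[OF F_in[OF p]] K_def by simp
  have re: "(\<Sum>i j k l. t i j k l)
     = (\<Sum>j l i k. t i j k l)" for t :: "'m \<Rightarrow> 'm \<Rightarrow> 'm \<Rightarrow> 'm \<Rightarrow> 'n tvec cochain"
  proof -
    have "(\<Sum>i j k l. t i j k l) = (\<Sum>j i l k. t i j k l)"
      by (rule trans[OF sum.swap], rule sum.cong[OF refl], rule sum.cong[OF refl], rule sum.swap)
    also have "\<dots> = (\<Sum>j l i k. t i j k l)"
      by (rule sum.cong[OF refl], rule sum.swap)
    finally show ?thesis .
  qed
  have R: "(\<Sum>i j k l. cst (curvature h (F p) i j k l)
        * (b i p * a k p * (A j p * B l p))) = Z - T"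
    unfolding Z_def T_def
    by (subst re) (simp only: curv cst_diff left_diff_distrib sum_subtractf sum_distrib_right mult.assoc)
  show ?thesis
    unfolding lhs X mid' R by (rule cochain_eqI) (simp add: algebra_simps)
qed

end

text \<open>The star of a 1-form contracts the volume form with the metric dual vector. Contraction
  of the divided power gives a covector times the next lower power, and
  \<open>iota_rsharp_om\<close> identifies that covector.\<close>

lemma (in hermitian) hodge_star_1:
  assumes G: "g p = G" and \<beta>: "\<And>A. \<beta> p [cvec A] = c A"
  shows "Cochain (hodge_star g 1 \<beta> p) = (cst (- \<i>) * (\<Sum>j. cst (c (Inl j)) * theta (Inl j))
    + cst \<i> * (\<Sum>j. cst (c (Inr j)) * theta (Inr j))) * omk (CARD('n) - 1)"
proof -
  have vol: "Cochain (volume_form g p) = vol"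
    by (simp add: Cochain_volume_form G vol_def omk_omegak)
  have iota_vol: "iota X vol = iota X om * omk (CARD('n) - 1)" for X
  proof -
    have "CARD('n) = Suc (CARD('n) - 1)" by simp
    then show ?thesis unfolding vol_def using iota_omk by metis
  qed
  have "Cochain (hodge_star g 1 \<beta> p)
    = (\<Sum>A. cst (c A) * (\<Sum>B. cst (matrix_inv (riem G) $ A $ B) * iota (cvec B) vol))"
  proof (rule cochain_eqI)
    fix vs :: "'n tvec list"
    have "volume_form g p us = ev vol us" for us unfolding vol[symmetric] by simp
    then show "ev (Cochain (hodge_star g 1 \<beta> p)) vs
      = ev (\<Sum>A. cst (c A) * (\<Sum>B. cst (matrix_inv (riem G) $ A $ B) * iota (cvec B) vol)) vs"
      by (simp add: hodge_star_def sum_lists_Suc G \<beta>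
          sum_distrib_left mult_ac)
  qed
  also have "\<dots> = (\<Sum>A. cst (c A) * iota (rsharp (cvec A)) vol)"
    by (simp only: iota_linear[OF ext_vol, of "rsharp _"] tcomp_rsharp_cvec)
  also have "\<dots> = (\<Sum>j. cst (c (Inl j)) * (cst (- \<i>) * theta (Inl j) * omk (CARD('n) - 1)))
      + (\<Sum>j. cst (c (Inr j)) * (cst \<i> * theta (Inr j) * omk (CARD('n) - 1)))"
    by (simp only: sum_UNIV_sum iota_vol iota_rsharp_om)
  also have "\<dots> = (cst (- \<i>) * (\<Sum>j. cst (c (Inl j)) * theta (Inl j))
    + cst \<i> * (\<Sum>j. cst (c (Inr j)) * theta (Inr j))) * omk (CARD('n) - 1)"
    by (simp only: distrib_right sum_distrib_right sum_distrib_left mult.assoc[of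
        "cst _"] cst_cst mult.commute[of _ \<i>] mult.commute[of _ "- \<i>"])
  finally show ?thesis .
qed

section \<open>The tension field as a trace\<close>

context kaehler_map
begin

text \<open>The components of \<partial>\<bar>\<partial>f in the covariant sense, that is of
  \<open>- psi i\<close>, see \<open>psi_theta\<close>.\<close>

definition phi_comp :: "'m \<Rightarrow> complex^'n \<Rightarrow> 'n \<Rightarrow> 'n \<Rightarrow> complex" where
  "phi_comp i x p q = cderiv (\<lambda>y. cderiv (\<lambda>y. F y $ i) y (cvec (Inl p))) x (cvec (Inr q))
     + (\<Sum>e k. N.Gam i e k (F x) * cderiv (\<lambda>y. F y $ e) x (cvec (Inr q))
          * cderiv (\<lambda>y. F y $ k) x (cvec (Inl p)))"

lemma a_theta: "a i x = (\<Sum>j. cst (cderiv (\<lambda>y. F y $ i) x (cvec (Inl j))) * theta (Inl j))"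
  and b_theta: "b i x = (\<Sum>j. cst (cderiv (\<lambda>y. F y $ i) x (cvec (Inr j))) * theta (Inr j))"
  and A_theta: "A i x = (\<Sum>j. cst (cderiv (\<lambda>y. cnj (F y $ i)) x (cvec (Inl j))) * theta (Inl j))"
  and B_theta: "B i x = (\<Sum>j. cst (cderiv (\<lambda>y. cnj (F y $ i)) x (cvec (Inr j))) * theta (Inr j))"
  unfolding a_def b_def A_def B_def dfun_theta by (rule refl)+

lemma psi_theta:
  assumes x: "x \<in> W"
  shows "psi i x = - (\<Sum>p q. cst (phi_comp i x p q) * (theta (Inl p) * theta (Inr q)))"
proof -
  have "E i x = (\<Sum>p. dfield pr01 (\<lambda>y. cst (cderiv (\<lambda>y. F y $ i) y (cvec (Inl p))) * theta (Inl p)) x)"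
    unfolding E_def a_theta[abs_def]
    by (rule dfield_sum, intro fdiff_mult fdiff_const)
      (simp add: fdiff_cst smooth_on_differentiable[OF smooth_on_cderiv[OF M.open_W smooth_F_nth] x])
  also have "\<dots> = (\<Sum>p. (\<Sum>q. cst (cderiv (\<lambda>y. cderiv (\<lambda>y. F y $ i) y (cvec (Inl p))) x (cvec (Inr q)))
      * theta (Inr q)) * theta (Inl p))"
    by (intro sum.cong refl, subst dfield_scale)
      (simp_all add: fdiff_const dfun_theta smooth_on_differentiable[OF smooth_on_cderiv[OF M.open_W
          smooth_F_nth] x])
  also have "\<dots> = - (\<Sum>p q. cst (cderiv (\<lambda>y. cderiv (\<lambda>y. F y $ i) y (cvec (Inl p))) x (cvec (Inr q)))
      * (theta (Inl p) * theta (Inr q)))"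
    by (simp add: sum_distrib_right mult.assoc theta_commute[of "Inr _"] sum_negf)
  finally have 1: "E i x = - (\<Sum>p q. cst (cderiv (\<lambda>y. cderiv (\<lambda>y. F y $ i) y (cvec (Inl p))) x (cvec (Inr q)))
      * (theta (Inl p) * theta (Inr q)))" .
  have ba: "b e x * a k x = - (\<Sum>p q. cst (cderiv (\<lambda>y. F y $ e) x (cvec (Inr q))
       * cderiv (\<lambda>y. F y $ k) x (cvec (Inl p))) * (theta (Inl p) * theta (Inr q)))" for e k
    unfolding a_theta b_theta
    by (subst sum.swap) (simp add: sum_product cst_mult_mult theta_commute[of "Inr _"] sum_negf)
  have "(\<Sum>e k. cst (N.Gam i e k (F x)) * (b e x * a k x))
     = - (\<Sum>e k p q. cst (N.Gam i e k (F x) * cderiv (\<lambda>y. F y $ e) x (cvec (Inr q))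
       * cderiv (\<lambda>y. F y $ k) x (cvec (Inl p))) * (theta (Inl p) * theta (Inr q)))"
    unfolding ba by (simp add: sum_distrib_left cst_cst sum_negf mult.assoc)
  also have "\<dots> = - (\<Sum>p q e k. cst (N.Gam i e k (F x) * cderiv (\<lambda>y. F y $ e) x (cvec (Inr q))
       * cderiv (\<lambda>y. F y $ k) x (cvec (Inl p))) * (theta (Inl p) * theta (Inr q)))"
    by (subst (2) sum_rotate, subst sum_rotate, rule refl)
  finally have 2: "(\<Sum>e k. cst (N.Gam i e k (F x)) * (b e x * a k x))
     = - (\<Sum>p q e k. cst (N.Gam i e k (F x) * cderiv (\<lambda>y. F y $ e) x (cvec (Inr q))
       * cderiv (\<lambda>y. F y $ k) x (cvec (Inl p))) * (theta (Inl p) * theta (Inr q)))" .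
  show ?thesis unfolding psi_def 1 2 phi_comp_def
    by (simp add: cst_add cst_sum distrib_right sum_distrib_right sum.distrib)
qed

lemma star_df:
  assumes x: "x \<in> W"
  shows "Cochain (hodge_star g 1 (ext_d (coord_form F (Inl i))) x)
    = (cst (- \<i>) * a i x + cst \<i> * b i x) * omegak (CARD('n) - 1) (g x)"
proof -
  interpret G: hermitian "g x" by (rule M.hermitian_metric[OF x])
  have "Cochain (ext_d (coord_form F (Inl i)) x) = dfield id (\<lambda>q. cst (F q $ i)) x" by (rule Cochain_coord)
  then have "ext_d (coord_form F (Inl i)) x [cvec A] = ev (dfield id (\<lambda>q. cst (F q $ i)) x) [cvec A]" for A
    by (metis ev_Cochain)
  then have "ext_d (coord_form F (Inl i)) x [cvec A] = cderiv (\<lambda>y. F y $ i) x (cvec A)" for A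
    by (simp add: ev_dfun)
  from G.hodge_star_1[where g = g and \<beta> = "ext_d (coord_form F (Inl i))" and c
      = "\<lambda>A. cderiv (\<lambda>y. F y $ i) x (cvec A)", OF refl this]
  show ?thesis unfolding a_theta b_theta G.omk_omegak .
qed

text \<open>The powers of \<omega> are closed, so only the 1-form factor of \<open>star_df\<close>
  is differentiated. The connection terms in which both forms have the same type vanish by the
  symmetry of \<open>Gam\<close>; the mixed ones complete \<open>E\<close> to
  \<open>psi\<close>.\<close>

lemma cov_d_star_df:
  assumes x: "x \<in> W"
  shows "Cochain (cov_d id h F (\<lambda>B. hodge_star g 1 (ext_d (coord_form F B))) (Inl i) x)
    = cst (- 2 * \<i>) * psi i x * omegak (CARD('n) - 1) (g x)"
proof -
  let ?w = "omegak (CARD('n) - 1) (g x)"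
  have fS: "fdiff (\<lambda>q. cst (- \<i>) * a i q + cst \<i> * b i q) x"
    by (intro fdiff_add fdiff_mult fdiff_const fdiff_fields x)
  have "dfield id (\<lambda>q. Cochain (hodge_star g 1 (ext_d (coord_form F (Inl i))) q)) x
     = dfield id (\<lambda>q. (cst (- \<i>) * a i q + cst \<i> * b i q) * omegak (CARD('n) - 1) (g q)) x"
    by (rule dfield_cong[OF M.open_W x]) (rule star_df)
  also have "\<dots> = dfield id (\<lambda>q. cst (- \<i>) * a i q + cst \<i> * b i q) x * ?w"
    unfolding dfield_mult[OF fS M.fdiff_omegak[OF x]] M.dfield_omegak[OF x] by simp
  also have "dfield id (\<lambda>q. cst (- \<i>) * a i q + cst \<i> * b i q) x = cst (- \<i>) * E i x + cst \<i> * (- E i x)"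
  proof -
    have "fdiff (\<lambda>q. cst (- \<i>) * a i q) x" "fdiff (\<lambda>q. cst \<i> * b i q) x"
      by (intro fdiff_mult fdiff_const fdiff_fields x)+
    then show ?thesis
      by (simp only: dfield_add dfield_cscale[OF fdiff_fields(1)[OF x]] dfield_cscale[OF fdiff_fields(2)[OF x]]
          d_fields[OF x])
  qed
  also have "\<dots> = cst (- 2 * \<i>) * E i x" by (rule cochain_eqI) simp
  finally have 1: "dfield id (\<lambda>q. Cochain (hodge_star g 1 (ext_d (coord_form F (Inl i))) q)) x
     = cst (- 2 * \<i>) * E i x * ?w" .
  have z: "(\<Sum>j k. cst (N.Gam i j k (F x)) * (D j * D k)) = 0" if "\<And>j. odd_form (D j)" for D
  proof (rule sum_antisym)
    show "cst (N.Gam i j k (F x)) * (D j * D k) = - (cst (N.Gam i k j (F x)) * (D k * D j))" for j k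
      unfolding odd_anticommute[OF that that, of j k] N.Gam_sym[OF F_in[OF x], of i j k] by simp
  qed
  define S where "S = (\<Sum>j k. cst (N.Gam i j k (F x)) * (b j x * a k x))"
  have ab: "(\<Sum>j k. cst (N.Gam i j k (F x)) * (a j x * b k x)) = - S"
  proof -
    have "cst (N.Gam i j k (F x)) * (a j x * b k x) = - (cst (N.Gam i k j (F x)) * (b k x * a j x))" for j k
      unfolding odd_anticommute[OF odd_fields(1,2), of j x k] N.Gam_sym[OF F_in[OF x], of i j k] by simp
    then show ?thesis unfolding S_def by (subst sum.swap) (simp add: sum_negf)
  qed
  have "(\<Sum>j k. cst (N.Gam i j k (F x)) * ((a j x + b j x) * (cst (- \<i>) * a k x + cst \<i> * b k x)))
     = cst (- \<i>) * (\<Sum>j k. cst (N.Gam i j k (F x)) * (a j x * a k x))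
     + cst \<i> * (\<Sum>j k. cst (N.Gam i j k (F x)) * (a j x * b k x))
     + cst (- \<i>) * S + cst \<i> * (\<Sum>j k. cst (N.Gam i j k (F x)) * (b j x * b k x))"
    unfolding S_def
    by (rule cochain_eqI) (simp add: distrib_left distrib_right cst_left_commute[of "a _ x"] cst_left_commute[of
        "b _ x"]
        sum.distrib sum_distrib_left algebra_simps)
  also have "\<dots> = cst (- 2 * \<i>) * S"
    unfolding z[OF odd_fields(1)] z[OF odd_fields(2)] ab by (rule cochain_eqI) simp
  finally have 2: "(\<Sum>j k. cst (N.Gam i j k (F x)) * ((a j x + b j x) * (cst (- \<i>) * a k x + cst \<i> * b k x)))
     = cst (- 2 * \<i>) * S" .
  have ab_id: "dfield id (\<lambda>q. cst (F q $ j)) x = a j x + b j x" for j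
    by (simp add: dfield_id a_def b_def)
  have "(\<Sum>j k. cst (N.Gam i j k (F x)) * (dfield id (\<lambda>q. cst (F q $ j)) x
       * Cochain (hodge_star g 1 (ext_d (coord_form F (Inl k))) x)))
     = (\<Sum>j k. cst (N.Gam i j k (F x)) * ((a j x + b j x) * (cst (- \<i>) * a k x + cst \<i> * b k x))) * ?w"
    unfolding star_df[OF x] ab_id sum_distrib_right mult.assoc ..
  also have "\<dots> = cst (- 2 * \<i>) * S * ?w" by (simp only: 2)
  finally show ?thesis
    unfolding Cochain_cov_d[OF x] 1 psi_def S_def[symmetric] by (simp only: distrib_left distrib_right)
qed

text \<open>A (1,1) form times the divided power of exponent n - 1 is its trace times the volume
  form, by \<open>wedge11_vol\<close>, and the star is injective in top degree. The factor 4 is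
  (2\<i>)(-2\<i>).\<close>

lemma tension_trace:
  assumes x: "x \<in> W" and t: "tension g h F (Inl i) x [] = 0"
  shows "(\<Sum>p q. inv_metric (g x) p q * phi_comp i x p q) = 0"
proof -
  interpret G: hermitian "g x" by (rule M.hermitian_metric[OF x])
  define T where "T = Cochain (cov_d id h F (\<lambda>B. hodge_star g 1 (ext_d (coord_form F B))) (Inl i) x)"
  have "T = cst (2 * \<i>) * ((\<Sum>p q. cst (phi_comp i x p q) * (theta (Inl p) * theta (Inr q))) * G.omk (CARD('n) - 1))"
    unfolding T_def cov_d_star_df[OF x] psi_theta[OF x] G.omk_omegak by (simp add: cst_minus mult.assoc)
  also have "\<dots> = cst (2 * \<i>) * (\<Sum>p q. cst (phi_comp i x p q) * (cst (- 2 * \<i> * G.ginv p q) * G.vol))"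
    unfolding sum_distrib_right mult.assoc[of "cst (phi_comp _ _ _ _)"] G.wedge11_vol ..
  also have "\<dots> = (\<Sum>p q. cst (4 * (G.ginv p q * phi_comp i x p q)) * G.vol)"
  proof -
    have "2 * \<i> * (phi_comp i x p q * (- 2 * \<i> * G.ginv p q)) = 4 * (G.ginv p q * phi_comp i x p q)" for p q
      by (simp add: algebra_simps)
    then show ?thesis by (simp only: sum_distrib_left cst_cst)
  qed
  also have "\<dots> = cst (4 * (\<Sum>p q. G.ginv p q * phi_comp i x p q)) * G.vol"
    by (simp only: cst_sum sum_distrib_left sum_distrib_right)
  finally have T: "T = cst (4 * (\<Sum>p q. G.ginv p q * phi_comp i x p q)) * G.vol" .
  have evT: "cov_d id h F (\<lambda>B. hodge_star g 1 (ext_d (coord_form F B))) (Inl i) x us = ev T us"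
    "volume_form g x us = ev G.vol us" for us
    by (simp add: T_def) (metis Cochain_volume_form G.vol_def G.omk_omegak ev_Cochain)
  have "(\<Sum>As\<in>{As. length As = 2 * CARD('n)}. \<Sum>Bs\<in>{Bs. length Bs = 2 * CARD('n)}.
        (\<Prod>i<2 * CARD('n). matrix_inv (riem (g x)) $ (As ! i) $ (Bs ! i))
          * ev T (map cvec As) * ev G.vol (map cvec Bs)) = 0"
    using t unfolding tension_def hodge_star_def[of _ "2 * CARD('n)"] evT by simp
  from G.star_top_eq_0[OF T this] show ?thesis by simp
qed

text \<open>Exchanging \<open>A j\<close> with \<open>a k\<close> changes the sign and so absorbs
  the minus in the definition; the products are then ordered as in \<open>d_bracket\<close>.\<close>

lemma Cochain_curvature_form:
  "Cochain (curvature_form g h F x) = (\<Sum>i j k l. cst (curvature h (F x) i j k l) * (b i x * a k x * (A j x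
      * B l x))) * omegak (CARD('n) - 2) (g x)"
proof -
  have "b i x * A j x * a k x * B l x = - (b i x * a k x * (A j x * B l x))" for i j k l
    unfolding mult.assoc[of "b i x" "A j x"] odd_anticommute[OF odd_fields(3,1)] by (simp add: mult.assoc)
  then show ?thesis
    unfolding curvature_form_def Cochain_minus Cochain_sum Cochain_scale Cochain_wedge Cochain_coord
        Cochain_omega_n2
    by (simp add: sum_distrib_right sum_negf mult.assoc flip: a_def b_def A_def B_def)
qed

lemma ext_fields: "ext_form 1 (a i x)" "ext_form 1 (b i x)" "ext_form 1 (A i x)" "ext_form 1 (B i x)"
  unfolding a_theta b_theta A_theta B_theta by (intro ext_form_sum ext_form_scale ext_form_theta)+

text \<open>Being of top degree the form is a multiple of the volume form. Conjugation permutes its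
  summands by \<open>cnj_curvature\<close>, and the volume form is real and not zero, so the factor
  is real.\<close>

lemma curvature_form_real_multiple:
  assumes x: "x \<in> W" and n: "CARD('n) \<ge> 2"
  shows "\<exists>r::real. Cochain (curvature_form g h F x) = cst (of_real r) * omegak CARD('n) (g x)"
proof -
  interpret G: hermitian "g x" by (rule M.hermitian_metric[OF x])
  have "ext_form ((1 + 1) + (1 + 1)) (b i x * a k x * (A j x * B l x))" for i j k l
    by (intro ext_form_mult ext_fields)
  then have "ext_form (2 * 2) (b i x * a k x * (A j x * B l x))" for i j k l
    by (simp add: eval_nat_numeral)
  then have "ext_form (2 * 2) (\<Sum>i j k l. cst (curvature h (F x) i j k l) * (b i x * a k x * (A j x * B l x)))"
    by (intro ext_form_sum ext_form_scale)
  from G.ext_form_mult_omk[OF n this] obtain c where c: "Cochain (curvature_form g h F x) = cst c * G.vol"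
    unfolding Cochain_curvature_form G.omk_omegak by blast
  have "conj_pull tconj (Cochain (curvature_form g h F x)) = Cochain (curvature_form g h F x)"
  proof -
    have com: "A i x * B k x * (b j x * a l x) = b j x * a l x * (A i x * B k x)" for i j k l
      by (rule even_commute) (intro odd_odd_mult odd_fields)
    have "conj_pull tconj (Cochain (curvature_form g h F x))
      = (\<Sum>i j k l. cst (curvature h (F x) j i l k) * (b j x * a l x * (A i x * B k x))) * omegak (CARD('n)
          - 2) (g x)"
      unfolding Cochain_curvature_form
      by (simp add: N.cnj_curvature[OF F_in[OF x]] conj_fields[OF x] G.conj_omegak com)
    also have "(\<Sum>i j k l. cst (curvature h (F x) j i l k) * (b j x * a l x * (A i x * B k x)))
      = (\<Sum>j i l k. cst (curvature h (F x) j i l k) * (b j x * a l x * (A i x * B k x)))"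
      by (rule trans[OF sum.swap], rule sum.cong[OF refl], rule sum.cong[OF refl], rule sum.swap)
    finally show ?thesis unfolding Cochain_curvature_form .
  qed
  then have "cst (cnj c) * G.vol = cst c * G.vol"
    unfolding c by (simp add: G.vol_def G.omk_omegak G.conj_omegak)
  then have "cnj c = c" by (rule G.cst_vol_cancel)
  then have "c = of_real (Re c)" by (simp add: complex_eq_iff)
  then show ?thesis using c unfolding G.vol_def G.omk_omegak by metis
qed

text \<open>The -2 of \<open>d_bracket\<close> and the -4 of \<open>wedge_norm_vol\<close> combine
  to 8; replacing \<open>psi\<close> by \<open>- \<Phi>\<close> affects neither product.\<close>

lemma local_identity:
  assumes x: "x \<in> W" and n: "CARD('n) \<ge> 2"
    and t: "\<And>i. tension g h F (Inl i) x [] = 0"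
    and Q: "Cochain (curvature_form g h F x) = cst (of_real Q) * omegak CARD('n) (g x)"
  shows "Cochain (wedge (ext_d bracket_df) (omega_n2 g) x)
    = cst (of_real (8 * form11_norm2 g h F (del_E' h F (delbar_map F)) x + 2 * Q)) * omegak CARD('n) (g x)"
proof -
  interpret G: hermitian "g x" by (rule M.hermitian_metric[OF x])
  interpret H: hermitian "h (F x)" by (rule N.hermitian_metric[OF F_in[OF x]])
  define \<Phi> where "\<Phi> i = (\<Sum>p q. cst (phi_comp i x p q) * (theta (Inl p) * theta (Inr q)))" for i
  have psi: "psi i x = - \<Phi> i" for i unfolding \<Phi>_def by (rule psi_theta[OF x])
  have conj: "conj_pull tconj (\<Phi> i) = (\<Sum>p q. cst (cnj (phi_comp i x p q)) * (theta (Inr p) * theta (Inl q)))" for i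
    unfolding \<Phi>_def by (simp add: conj_pull_theta)
  define Nm where "Nm = (\<Sum>i j p q r s. h (F x) $ i $ j * G.ginv p r * G.ginv s q * phi_comp i x p q
      * cnj (phi_comp j x r s))"
  have norm: "(\<Sum>i j. cst (h (F x) $ i $ j) * (\<Phi> i * conj_pull tconj (\<Phi> j))) * G.omk (CARD('n) - 2)
     = cst (- 4 * Nm) * G.vol"
    unfolding conj Nm_def unfolding \<Phi>_def
    by (rule G.wedge_norm_vol[OF n]) (rule tension_trace[OF x t])
  have ev\<Phi>: "ev (\<Phi> i) [cvec (Inl p), cvec (Inr q)] = phi_comp i x p q" for i p q
  proof -
    have "ev (theta (Inl p') * theta (Inr q')) [cvec (Inl p), cvec (Inr q)]
       = (if p' = p then if q' = q then 1 else 0 else 0)" for p' q'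
      by (simp add: ev_mult_Cons ev_mult_Nil tcomp_cvec ev_cst)
    then have "ev (\<Phi> i) [cvec (Inl p), cvec (Inr q)]
      = (\<Sum>p' q'. if p' = p then if q' = q then phi_comp i x p' q' else 0 else 0)"
      unfolding \<Phi>_def ev_sum ev_cst_mult by (intro sum.cong refl) simp
    also have "\<dots> = (\<Sum>p'. if p' = p then phi_comp i x p' q else 0)"
      by (rule sum.cong) simp_all
    finally show ?thesis by simp
  qed
  have "del_E' h F (delbar_map F) i x us = ev (\<Phi> i) us" for i us
    using Cochain_del_E[OF x, of i] psi by (metis ev_Cochain minus_minus)
  then have f11: "form11_norm2 g h F (del_E' h F (delbar_map F)) x = Re Nm"
    unfolding form11_norm2_def Nm_def by (simp only: ev\<Phi>)
  \<comment> \<open>\<open>form11_norm2\<close> keeps only the real part, so the sum itself has to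
    be real. Hermitian symmetry maps each term to the one with \<open>(i, p, q)\<close> and
    \<open>(j, r, s)\<close> exchanged.\<close>
  have "cnj Nm = (\<Sum>i j p q r s. h (F x) $ j $ i * G.ginv r p * G.ginv q s * phi_comp j x r s
      * cnj (phi_comp i x p q))"
    unfolding Nm_def by (simp add: G.ginv_herm N.cnj_entry[OF F_in[OF x]] mult_ac)
  also have "\<dots> = (\<Sum>j i r s p q. h (F x) $ j $ i * G.ginv r p * G.ginv q s * phi_comp j x r s
      * cnj (phi_comp i x p q))"
  proof -
    have sw: "(\<Sum>p q r s. t p q r s) = (\<Sum>r s p q. t p q r s)"
      for t :: "'n \<Rightarrow> 'n \<Rightarrow> 'n \<Rightarrow> 'n \<Rightarrow> complex"
    proof -
      have "(\<Sum>p q r s. t p q r s)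
        = (\<Sum>p r s q. t p q r s)"
        by (rule sum.cong[OF refl], rule sum_rotate)
      also have "\<dots> = (\<Sum>r s p q. t p q r s)"
        by (rule sum_rotate)
      finally show ?thesis .
    qed
    show ?thesis
      by (rule trans[OF sum.swap], rule sum.cong[OF refl], rule sum.cong[OF refl], rule sw)
  qed
  also have "\<dots> = Nm" unfolding Nm_def ..
  finally have "cnj Nm = Nm" .
  then have NmR: "Nm = of_real (Re Nm)" by (simp add: complex_eq_iff)
  have R: "(\<Sum>i j k l. cst (curvature h (F x) i j k l)
        * (b i x * a k x * (A j x * B l x))) * G.omk (CARD('n) - 2) = cst (of_real Q) * G.vol"
    using Q unfolding Cochain_curvature_form G.vol_def G.omk_omegak .
  have "Cochain (wedge (ext_d bracket_df) (omega_n2 g) x)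
      = cst (- 2) * (cst (- 4 * Nm) * G.vol) + cst 2 * (cst (of_real Q) * G.vol)"
    unfolding Cochain_wedge d_bracket[OF x] Cochain_omega_n2 psi conj_pull_minus minus_mult_minus distrib_right
      mult.assoc[of "cst (- 2)"] mult.assoc[of "cst 2"] G.omk_omegak[symmetric] norm R ..
  also have "\<dots> = cst (8 * Nm + 2 * of_real Q) * G.vol"
    by (rule cochain_eqI) (simp add: algebra_simps)
  also have "8 * Nm + 2 * of_real Q = of_real (8 * Re Nm + 2 * Q)" by (subst NmR) simp
  finally show ?thesis unfolding f11 G.vol_def G.omk_omegak .
qed

end

section \<open>Change of holomorphic coordinates\<close>

definition jac :: "(complex^'n \<Rightarrow> complex^'m) \<Rightarrow> 'm \<Rightarrow> 'n::finite \<Rightarrow> complex^'n \<Rightarrow> complex" where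
  "jac \<sigma> k l y = frechet_derivative \<sigma> (at y) (axis l 1) $ k"

text \<open>Complex linearity of the differential cancels the half of \<open>clin\<close> belonging
  to the conjugate coordinates and doubles the other half.\<close>

lemma holomorphic_cderiv:
  fixes \<sigma> :: "complex^'n::finite \<Rightarrow> complex^'m::finite"
  assumes hol: "holomorphic_map_on \<sigma> S" and y: "y \<in> S"
  shows "cderiv (\<lambda>u. \<sigma> u $ k) y v = (\<Sum>l. fst v $ l * jac \<sigma> k l y)"
    and "cderiv (\<lambda>u. cnj (\<sigma> u $ k)) y v = (\<Sum>l. snd v $ l * cnj (jac \<sigma> k l y))"
proof -
  define D where "D = frechet_derivative \<sigma> (at y)"
  have diff: "\<sigma> differentiable (at y)"
    using hol y smooth_on_differentiable by (auto simp: holomorphic_map_on_def)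
  have "((\<lambda>u. \<sigma> u $ k) has_derivative (\<lambda>w. D w $ k)) (at y)"
    unfolding D_def by (rule bounded_linear.has_derivative[OF bounded_linear_vec_nth differentiable_frechet[OF
        diff]])
  then have c: "cderiv (\<lambda>u. \<sigma> u $ k) y v = clin (\<lambda>w. D w $ k) v" for v by (rule cderiv_has_derivative)
  have "D (axis l \<i>) = \<i> *s D (axis l 1)" for l
  proof -
    have "axis l \<i> = (\<i> *s axis l 1 :: complex^'n)" by (simp add: vec_eq_iff axis_def)
    then show ?thesis using hol y unfolding holomorphic_map_on_def D_def by metis
  qed
  then show 1: "cderiv (\<lambda>u. \<sigma> u $ k) y v = (\<Sum>l. fst v $ l * jac \<sigma> k l y)" for v
    unfolding c clin_def jac_def D_def[symmetric] by (intro sum.cong refl) (simp add: field_simps)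
  have "(\<lambda>u. \<sigma> u $ k) differentiable (at y)"
    using differentiable_compose[OF bounded_linear_imp_differentiable[OF bounded_linear_vec_nth] diff]
    by (simp add: o_def)
  then show "cderiv (\<lambda>u. cnj (\<sigma> u $ k)) y v = (\<Sum>l. snd v $ l * cnj (jac \<sigma> k l y))"
    by (simp add: cderiv_cnj 1 tconj_def)
qed

text \<open>A transition map between two coordinate expressions of one Kaehler metric. It serves for
  charts of M, where forms are pulled back, and for charts of N, where the curvature is
  transformed.\<close>

locale metric_change = P: kaehler_chart h V + P': kaehler_chart h' V'
  for h :: "'n::finite metric" and V and h' :: "'n metric" and V' +
  fixes \<sigma> :: "complex^'n \<Rightarrow> complex^'n"
  assumes hol: "holomorphic_map_on \<sigma> V" and maps: "y \<in> V \<Longrightarrow> \<sigma> y \<in> V'"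
    and metric: "y \<in> V \<Longrightarrow> h y $ i $ j = (\<Sum>k l. h' (\<sigma> y) $ k $ l * jac \<sigma> k i y * cnj (jac \<sigma> l j y))"
begin

abbreviation J where "J \<equiv> jac \<sigma>"

lemma smooth_\<sigma>: "smooth_on \<sigma> V"
  using hol by (simp add: holomorphic_map_on_def)

lemma diff_\<sigma>: "y \<in> V \<Longrightarrow> \<sigma> differentiable (at y)"
  by (rule smooth_on_differentiable[OF smooth_\<sigma>])

lemma smooth_J: "smooth_on (J k l) V"
  unfolding jac_def[abs_def] by (intro smooth_on_nth P.open_W smooth_on_frechet smooth_\<sigma>)

lemma push_eq: "y \<in> V \<Longrightarrow> push \<sigma> y v
    = (\<chi> k. \<Sum>l. fst v $ l * J k l y, \<chi> k. \<Sum>l. snd v $ l * cnj (J k l y))"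
  by (simp add: push_def holomorphic_cderiv[OF hol])

lemma push_pr: "y \<in> V \<Longrightarrow> push \<sigma> y (pr10 v) = pr10 (push \<sigma> y v)"
  "y \<in> V \<Longrightarrow> push \<sigma> y (pr01 v) = pr01 (push \<sigma> y v)"
  by (simp_all add: push_eq pr10_def pr01_def vec_eq_iff)

text \<open>A holomorphic map preserves types by \<open>push_pr\<close>, so the pullback respects
  \<partial> and \<bar>\<partial> separately.\<close>

lemma pull_dfun:
  assumes y: "y \<in> V" and u: "u differentiable (at (\<sigma> y))"
    and \<pi>: "\<pi> = pr10 \<and> \<rho> = pr10 \<or> \<pi> = pr01 \<and> \<rho> = pr01"
  shows "dfield \<pi> (\<lambda>q. cst (u (\<sigma> q))) y = pull (push \<sigma> y) (dfield \<rho> (\<lambda>q. cst (u q)) (\<sigma> y))"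
proof (rule homog1_eqI[OF homog_dfun])
  show "homog 1 (pull (push \<sigma> y) (dfield \<rho> (\<lambda>q. cst (u q)) (\<sigma> y)))"
    using homog_dfun[of \<rho> u] by (simp add: homog_def)
  show "ev (dfield \<pi> (\<lambda>q. cst (u (\<sigma> q))) y) [v] = ev (pull (push \<sigma> y) (dfield \<rho> (\<lambda>q. cst (u q)) (\<sigma> y))) [v]" for v
    using \<pi> by (auto simp: ev_dfun cderiv_chain[OF diff_\<sigma>[OF y] u] push_pr[OF y])
qed

lemma pull_theta:
  assumes y: "y \<in> V"
  shows "pull (push \<sigma> y) (theta (Inl k)) = (\<Sum>i. cst (J k i y) * theta (Inl i))"
    "pull (push \<sigma> y) (theta (Inr k)) = (\<Sum>i. cst (cnj (J k i y)) * theta (Inr i))"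
proof -
  have hp: "homog 1 (pull (push \<sigma> y) (theta A))" for A by (simp add: homog_def theta_def)
  show "pull (push \<sigma> y) (theta (Inl k)) = (\<Sum>i. cst (J k i y) * theta (Inl i))"
    by (rule homog1_eqI[OF hp], intro homog_sum homog_scale homog_theta)
      (simp add: ev_theta push_eq[OF y] tcomp_def mult.commute)
  show "pull (push \<sigma> y) (theta (Inr k)) = (\<Sum>i. cst (cnj (J k i y)) * theta (Inr i))"
    by (rule homog1_eqI[OF hp], intro homog_sum homog_scale homog_theta)
      (simp add: ev_theta push_eq[OF y] tcomp_def mult.commute)
qed

lemma pull_omegak:
  assumes y: "y \<in> V"
  shows "omegak k (h y) = pull (push \<sigma> y) (omegak k (h' (\<sigma> y)))"
proof -
  have prod: "pull (push \<sigma> y) (theta (Inl k)) * pull (push \<sigma> y) (theta (Inr l))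
      = (\<Sum>i j. cst (J k i y * cnj (J l j y)) * (theta (Inl i) * theta (Inr j)))" for k l
    unfolding pull_theta[OF y] sum_product cst_mult_mult ..
  have "pull (push \<sigma> y) (omega (h' (\<sigma> y))) = cst (\<i> / 2) * (\<Sum>k l i j. cst (h' (\<sigma> y) $ k $ l * J k i y
      * cnj (J l j y)) * (theta (Inl i) * theta (Inr j)))"
    unfolding omega_def
    by (simp only: pull_mult pull_sum pull_cst prod sum_distrib_left cst_cst mult.assoc)
  also have "(\<Sum>k l i j. cst (h' (\<sigma> y) $ k $ l * J k i y * cnj (J l j y)) * (theta (Inl i) * theta (Inr j)))
     = (\<Sum>k i j l. cst (h' (\<sigma> y) $ k $ l * J k i y * cnj (J l j y)) * (theta (Inl i) * theta (Inr j)))"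
    by (rule sum.cong[OF refl], rule sum_rotate)
  also have "\<dots> = (\<Sum>i j k l. cst (h' (\<sigma> y) $ k $ l * J k i y * cnj (J l j y)) * (theta (Inl i) * theta (Inr j)))"
    by (rule sum_rotate)
  finally have "pull (push \<sigma> y) (omega (h' (\<sigma> y))) = omega (h y)"
    unfolding omega_def metric[OF y] by (simp add: cst_sum sum_distrib_right)
  then show ?thesis by (simp add: omegak_def)
qed

lemma cderiv_comp_change:
  assumes y: "y \<in> V" and u: "u differentiable (at (\<sigma> y))"
  shows "cderiv (\<lambda>q. u (\<sigma> q)) y (cvec (Inl k)) = (\<Sum>c. cderiv u (\<sigma> y) (cvec (Inl c)) * J c k y)"
    "cderiv (\<lambda>q. u (\<sigma> q)) y (cvec (Inr k)) = (\<Sum>c. cderiv u (\<sigma> y) (cvec (Inr c)) * cnj (J c k y))"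
proof -
  have "tcomp A (push \<sigma> y (cvec (Inl k))) = (case A of Inl c \<Rightarrow> J c k y | Inr _ \<Rightarrow> 0)"
    "tcomp A (push \<sigma> y (cvec (Inr k))) = (case A of Inl _ \<Rightarrow> 0 | Inr c \<Rightarrow> cnj (J c k y))" for A
    by (cases A; simp add: push_eq[OF y] tcomp_def cvec_def axis_def if_distrib[of "\<lambda>x. x * _"] cong: if_cong)+
  then show "cderiv (\<lambda>q. u (\<sigma> q)) y (cvec (Inl k)) = (\<Sum>c. cderiv u (\<sigma> y) (cvec (Inl c)) * J c k y)"
    "cderiv (\<lambda>q. u (\<sigma> q)) y (cvec (Inr k)) = (\<Sum>c. cderiv u (\<sigma> y) (cvec (Inr c)) * cnj (J c k y))"
    by (simp_all only: cderiv_chain[OF diff_\<sigma>[OF y] u], subst cderiv_expand, simp add: sum_UNIV_sum mult.commute,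
        subst cderiv_expand, simp add: sum_UNIV_sum mult.commute)
qed

text \<open>Second derivatives of the transition map: the terms that must cancel for the curvature
  to be a tensor.\<close>

definition dJ :: "'n \<Rightarrow> 'n \<Rightarrow> 'n \<Rightarrow> complex^'n \<Rightarrow> complex" where
  "dJ a k i y = cderiv (J a k) y (cvec (Inl i))"

lemma smooth_dJ: "smooth_on (dJ a k i) V"
  unfolding dJ_def[abs_def] by (intro smooth_on_cderiv P.open_W smooth_J)

lemma J_cderiv: "y \<in> V \<Longrightarrow> J a k y = cderiv (\<lambda>u. \<sigma> u $ a) y (cvec (Inl k))"
  "y \<in> V \<Longrightarrow> cderiv (\<lambda>u. \<sigma> u $ a) y (cvec (Inr k)) = 0"
  by (simp_all add: holomorphic_cderiv[OF hol] cvec_def axis_def if_distrib[of "\<lambda>x. x * _"] cong: if_cong)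

lemma smooth_\<sigma>_nth: "smooth_on (\<lambda>u. \<sigma> u $ a) V"
  by (rule smooth_on_nth[OF P.open_W smooth_\<sigma>])

lemma J_bar: "y \<in> V \<Longrightarrow> cderiv (J a k) y (cvec (Inr j)) = 0"
proof -
  assume y: "y \<in> V"
  have "cderiv (J a k) y (cvec (Inr j)) = cderiv (\<lambda>y. cderiv (\<lambda>u. \<sigma> u $ a) y (cvec (Inl k))) y (cvec (Inr j))"
    by (rule cderiv_cong[OF P.open_W y]) (rule J_cderiv)
  also have "\<dots> = cderiv (\<lambda>y. cderiv (\<lambda>u. \<sigma> u $ a) y (cvec (Inr j))) y (cvec (Inl k))"
    by (rule cderiv_commute[OF P.open_W y smooth_\<sigma>_nth])
  also have "\<dots> = cderiv (\<lambda>y. 0) y (cvec (Inl k))"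
    by (rule cderiv_cong[OF P.open_W y]) (rule J_cderiv)
  finally show ?thesis by simp
qed

lemma dJ_bar: "y \<in> V \<Longrightarrow> cderiv (dJ a k i) y (cvec (Inr j)) = 0"
proof -
  assume y: "y \<in> V"
  have "cderiv (dJ a k i) y (cvec (Inr j)) = cderiv (\<lambda>y. cderiv (J a k) y (cvec (Inr j))) y (cvec (Inl i))"
    unfolding dJ_def[abs_def] by (rule cderiv_commute[OF P.open_W y smooth_J])
  also have "\<dots> = cderiv (\<lambda>y. 0) y (cvec (Inl i))"
    by (rule cderiv_cong[OF P.open_W y]) (rule J_bar)
  finally show ?thesis by simp
qed

lemma diff_J: "y \<in> V \<Longrightarrow> J a k differentiable (at y)" "y \<in> V \<Longrightarrow> dJ a k i differentiable (at y)"
  by (erule smooth_on_differentiable[OF smooth_J], erule smooth_on_differentiable[OF smooth_dJ])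

lemma diff_cnj_J: "y \<in> V \<Longrightarrow> (\<lambda>q. cnj (J a k q)) differentiable (at y)"
  by (rule smooth_on_differentiable[OF smooth_on_cnj[OF P.open_W smooth_J]])

lemma cderiv_cnj_J: "y \<in> V \<Longrightarrow> cderiv (\<lambda>q. cnj (J a k q)) y (cvec (Inl i)) = 0"
  "y \<in> V \<Longrightarrow> cderiv (\<lambda>q. cnj (J a k q)) y (cvec (Inr i)) = cnj (dJ a k i y)"
  by (simp_all add: cderiv_cnj diff_J P.tconj_cvec J_bar dJ_def)

lemma diff_comp_change: "y \<in> V \<Longrightarrow> smooth_on u V' \<Longrightarrow> (\<lambda>q. u (\<sigma> q)) differentiable (at y)"
  using differentiable_chain_at[OF diff_\<sigma> smooth_on_differentiable[OF _ maps]] by (simp add: o_def)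

lemma diff_at_change: "y \<in> V \<Longrightarrow> smooth_on u V' \<Longrightarrow> u differentiable (at (\<sigma> y))"
  using smooth_on_differentiable maps by blast

text \<open>The holomorphic derivative of the metric with only its unbarred index transformed. The
  conjugate Jacobian is constant for holomorphic derivatives and factors out in
  \<open>dg_change\<close>.\<close>

definition M :: "'n \<Rightarrow> 'n \<Rightarrow> 'n \<Rightarrow> complex^'n \<Rightarrow> complex" where
  "M i k b y = (\<Sum>a. (\<Sum>c. P'.dg c a b (\<sigma> y) * J c i y) * J a k y + h' (\<sigma> y) $ a $ b * dJ a k i y)"

lemma dg_change:
  assumes y: "y \<in> V"
  shows "P.dg i k q y = (\<Sum>b. cnj (J b q y) * M i k b y)"
proof -
  note ds = diff_J[OF y] diff_cnj_J[OF y] diff_comp_change[OF y P'.smooth_entry]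
  have "P.dg i k q y = cderiv (\<lambda>y. \<Sum>a b. h' (\<sigma> y) $ a $ b * J a k y * cnj (J b q y)) y (cvec (Inl i))"
    unfolding P.dg_def by (rule cderiv_cong[OF P.open_W y]) (rule metric)
  also have "\<dots> = (\<Sum>a b. cderiv (\<lambda>y. h' (\<sigma> y) $ a $ b * J a k y * cnj (J b q y)) y (cvec (Inl i)))"
    by (subst cderiv_sum, intro differentiable_sum ballI differentiable_mult ds finite,
        intro sum.cong refl cderiv_sum differentiable_mult ds)
  also have "\<dots> = (\<Sum>a b. cnj (J b q y) * ((\<Sum>c. P'.dg c a b (\<sigma> y) * J c i y) * J a k y
      + h' (\<sigma> y) $ a $ b * dJ a k i y))"
    by (intro sum.cong refl)
      (simp add: cderiv_mult ds cderiv_cnj_J[OF y] cderiv_comp_change[OF y diff_at_change[OF y P'.smooth_entry]]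
          P'.dg_def dJ_def algebra_simps)
  also have "\<dots> = (\<Sum>b. cnj (J b q y) * M i k b y)"
    unfolding M_def sum_distrib_left by (rule sum.swap)
  finally show ?thesis .
qed

lemma bg_change:
  assumes y: "y \<in> V"
  shows "P.bg j p l y = (\<Sum>a. J a p y * cnj (M j l a y))"
  using P.cnj_dg[OF y, of j l p] unfolding dg_change[OF y] by simp

lemma cnj_M:
  assumes y: "y \<in> V"
  shows "cnj (M j l a y) = (\<Sum>b. (\<Sum>d. P'.bg d a b (\<sigma> y) * cnj (J d j y)) * cnj (J b l y))
    + (\<Sum>b. h' (\<sigma> y) $ a $ b * cnj (dJ b l j y))"
  unfolding M_def by (simp add: P'.cnj_dg[OF maps[OF y]] P'.cnj_entry[OF maps[OF y]] sum.distrib)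

text \<open>Only the middle sum is tensorial. The other two contain \<open>dJ\<close>, either
  through its conjugate in the first sum or as a factor in the last, and reappear in
  \<open>curvature_change\<close>.\<close>

lemma hess_change:
  assumes y: "y \<in> V"
  shows "P.hess j i k l y = (\<Sum>b. cnj (dJ b l j y) * M i k b y)
    + (\<Sum>b a. cnj (J b l y) * ((\<Sum>c. (\<Sum>d. P'.hess d c a b (\<sigma> y) * cnj (J d j y)) * J c i y) * J a k y))
    + (\<Sum>b a. cnj (J b l y) * ((\<Sum>d. P'.bg d a b (\<sigma> y) * cnj (J d j y)) * dJ a k i y))"
proof -
  note ds = diff_J[OF y] diff_cnj_J[OF y] diff_comp_change[OF y P'.smooth_entry] diff_comp_change[OF y P'.smooth_dg]
  have dM: "(\<lambda>y. M i k b y) differentiable (at y)" for b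
    unfolding M_def by (intro differentiable_sum ballI differentiable_add differentiable_mult ds finite)
  have dcM: "cderiv (\<lambda>y. M i k b y) y (cvec (Inr j))
    = (\<Sum>a. (\<Sum>c. (\<Sum>d. P'.hess d c a b (\<sigma> y) * cnj (J d j y)) * J c i y) * J a k y
      + (\<Sum>d. P'.bg d a b (\<sigma> y) * cnj (J d j y)) * dJ a k i y)" for b
  proof -
    have s1: "(\<lambda>y. \<Sum>c. P'.dg c a b (\<sigma> y) * J c i y) differentiable (at y)" for a
      by (intro differentiable_sum ballI differentiable_mult ds finite)
    have s2: "cderiv (\<lambda>y. \<Sum>c. P'.dg c a b (\<sigma> y) * J c i y) y (cvec (Inr j))
       = (\<Sum>c. (\<Sum>d. P'.hess d c a b (\<sigma> y) * cnj (J d j y)) * J c i y)" for a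
      by (subst cderiv_sum, intro differentiable_mult ds)
        (simp add: cderiv_mult ds J_bar[OF y] cderiv_comp_change[OF y diff_at_change[OF y P'.smooth_dg]]
            P'.hess_def)
    have s3: "cderiv (\<lambda>y. (\<Sum>c. P'.dg c a b (\<sigma> y) * J c i y) * J a k y
        + h' (\<sigma> y) $ a $ b * dJ a k i y) y (cvec (Inr j))
      = (\<Sum>c. (\<Sum>d. P'.hess d c a b (\<sigma> y) * cnj (J d j y)) * J c i y) * J a k y
      + (\<Sum>d. P'.bg d a b (\<sigma> y) * cnj (J d j y)) * dJ a k i y" for a
      by (simp add: cderiv_add cderiv_mult s1 s2 ds J_bar[OF y] dJ_bar[OF y] cderiv_comp_change[OF y
          diff_at_change[OF y P'.smooth_entry]] P'.bg_def)
    show ?thesis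
      unfolding M_def
      by (subst cderiv_sum, intro differentiable_add differentiable_mult s1 ds) (simp only: s3)
  qed
  have "P.hess j i k l y = cderiv (\<lambda>y. \<Sum>b. cnj (J b l y) * M i k b y) y (cvec (Inr j))"
    unfolding P.hess_def by (rule cderiv_cong[OF P.open_W y]) (rule dg_change)
  also have "\<dots> = (\<Sum>b. cnj (dJ b l j y) * M i k b y + cnj (J b l y) * cderiv (\<lambda>y. M i k b y) y (cvec (Inr j)))"
    by (subst cderiv_sum, intro differentiable_mult ds dM) (simp add: cderiv_mult ds dM cderiv_cnj_J[OF y])
  finally show ?thesis
    unfolding dcM by (simp add: sum.distrib sum_distrib_left distrib_left add.assoc)
qed

text \<open>The transformed inverse \<open>Z\<close> is shown to invert the matrix of
  \<open>h'\<close>, and inverses are unique.\<close>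

lemma ginv_change:
  assumes y: "y \<in> V"
  shows "(\<Sum>p q. inv_metric (h y) p q * J a p y * cnj (J b q y)) = inv_metric (h' (\<sigma> y)) a b"
proof -
  interpret H: hermitian "h y" by (rule P.hermitian_metric[OF y])
  interpret H': hermitian "h' (\<sigma> y)" by (rule P'.hermitian_metric[OF maps[OF y]])
  define Z where "Z a b = (\<Sum>p q. H.ginv p q * J a p y * cnj (J b q y))" for a b
  define Jm :: "complex^'n^'n" where "Jm = (\<chi> r k. J k r y)"
  \<comment> \<open>Solving the transformation rule of the metric for the inverse of the transposed
    Jacobian gives \<open>C\<close>. Invertibility of the Jacobian is thus inherited from that of
    \<open>h\<close>.\<close>
  define C :: "complex^'n^'n" where "C = (\<chi> k s. \<Sum>q b. h' (\<sigma> y) $ k $ b * cnj (J b q y) * H.ginv s q)"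
  have "(Jm ** C) $ r $ s = mat 1 $ r $ s" for r s
  proof -
    have "(Jm ** C) $ r $ s = (\<Sum>q k b. H.ginv s q * (h' (\<sigma> y) $ k $ b * J k r y * cnj (J b q y)))"
      unfolding matrix_matrix_mult_def Jm_def C_def
      by (simp add: sum_distrib_left mult_ac) (rule sum.swap)
    also have "\<dots> = (\<Sum>q. H.ginv s q * h y $ r $ q)"
      unfolding metric[OF y] sum_distrib_left ..
    finally show ?thesis by (simp add: H.ginv_right mat_def eq_commute)
  qed
  then have "Jm ** C = mat 1" by (simp add: vec_eq_iff)
  then have "C ** Jm = mat 1" by (rule matrix_left_right_inverse1)
  then have CJ: "(C ** Jm) $ k $ a = (if k = a then 1 else 0)" for k a by (simp add: mat_def)
  have ZH: "(\<Sum>b. h' (\<sigma> y) $ k $ b * Z a b) = (if k = a then 1 else 0)" for a k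
  proof -
    have "(\<Sum>b. h' (\<sigma> y) $ k $ b * Z a b)
      = (\<Sum>b p q. h' (\<sigma> y) $ k $ b * cnj (J b q y) * H.ginv p q * J a p y)"
      unfolding Z_def by (simp add: sum_distrib_left mult_ac)
    also have "\<dots> = (\<Sum>p q b. h' (\<sigma> y) $ k $ b * cnj (J b q y) * H.ginv p q * J a p y)"
      by (rule sum_rotate)
    also have "\<dots> = (C ** Jm) $ k $ a"
      unfolding matrix_matrix_mult_def Jm_def C_def by (simp add: sum_distrib_right)
    finally show ?thesis by (simp only: CJ)
  qed
  have "Z a b = (\<Sum>b'. (if b = b' then 1 else 0) * Z a b')" by (simp only: sum_delta_mult)
  also have "\<dots> = (\<Sum>b'. (\<Sum>k. H'.ginv k b * h' (\<sigma> y) $ k $ b') * Z a b')"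
    by (simp only: H'.ginv_left)
  also have "\<dots> = (\<Sum>k. (\<Sum>b'. h' (\<sigma> y) $ k $ b' * Z a b') * H'.ginv k b)"
    unfolding sum_distrib_right by (rule trans[OF sum.swap]) (simp add: mult_ac)
  also have "\<dots> = H'.ginv a b" unfolding ZH by (rule sum_delta_mult)
  finally show ?thesis unfolding Z_def .
qed

text \<open>In the product of first derivatives the inverse metric contracts with \<open>h'\<close>
  wherever a factor \<open>dJ\<close> occurs. What is left is exactly the two sums with
  \<open>dJ\<close> in \<open>hess_change\<close>, and they cancel.\<close>

lemma curvature_change:
  assumes y: "y \<in> V"
  shows "curvature h y i j k l = (\<Sum>c d a b. curvature h' (\<sigma> y) c d a b * (J c i y * cnj (J d j y) * J a k y
      * cnj (J b l y)))"
proof -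
  interpret H': hermitian "h' (\<sigma> y)" by (rule P'.hermitian_metric[OF maps[OF y]])
  \<comment> \<open>Both factors are split into a part with first derivatives of \<open>h'\<close>
    and a part with second derivatives of the transition map; the product of \<open>M0\<close> and
    \<open>N0\<close> alone is tensorial.\<close>
  define M0 where "M0 b = (\<Sum>a. (\<Sum>c. P'.dg c a b (\<sigma> y) * J c i y) * J a k y)" for b
  define M1 where "M1 b = (\<Sum>a. h' (\<sigma> y) $ a $ b * dJ a k i y)" for b
  define N0 where "N0 a = (\<Sum>b. (\<Sum>d. P'.bg d a b (\<sigma> y) * cnj (J d j y)) * cnj (J b l y))" for a
  define N1 where "N1 a = (\<Sum>b. h' (\<sigma> y) $ a $ b * cnj (dJ b l j y))" for a
  have Msplit: "M i k b y = M0 b + M1 b" for b by (simp add: M_def M0_def M1_def sum.distrib)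
  have Nsplit: "cnj (M j l a y) = N0 a + N1 a" for a unfolding cnj_M[OF y] N0_def N1_def ..
  have "(\<Sum>p q. inv_metric (h y) p q * P.dg i k q y * P.bg j p l y)
     = (\<Sum>p q a b. inv_metric (h y) p q * J a p y * cnj (J b q y) * (M i k b y * cnj (M j l a y)))"
    unfolding dg_change[OF y] bg_change[OF y]
  proof (intro sum.cong refl)
    fix p q
    have "inv_metric (h y) p q * (\<Sum>b. cnj (J b q y) * M i k b y) * (\<Sum>a. J a p y * cnj (M j l a y))
      = (\<Sum>b a. inv_metric (h y) p q * J a p y * cnj (J b q y) * (M i k b y * cnj (M j l a y)))"
      by (simp add: sum_distrib_left sum_distrib_right mult_ac)
    also have "\<dots> = (\<Sum>a b. inv_metric (h y) p q * J a p y * cnj (J b q y) * (M i k b y * cnj (M j l a y)))"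
      by (rule sum.swap)
    finally show "inv_metric (h y) p q * (\<Sum>b. cnj (J b q y) * M i k b y) * (\<Sum>a. J a p y * cnj (M j l a y))
      = (\<Sum>a b. inv_metric (h y) p q * J a p y * cnj (J b q y) * (M i k b y * cnj (M j l a y)))" .
  qed
  also have "\<dots> = (\<Sum>p a b q. inv_metric (h y) p q * J a p y * cnj (J b q y) * (M i k b y * cnj (M j l a y)))"
    by (rule sum.cong[OF refl], rule sum_rotate)
  also have "\<dots> = (\<Sum>a b p q. inv_metric (h y) p q * J a p y * cnj (J b q y) * (M i k b y * cnj (M j l a y)))"
    by (rule sum_rotate)
  also have "\<dots> = (\<Sum>a b. H'.ginv a b * (M i k b y * cnj (M j l a y)))"
    unfolding ginv_change[OF y, symmetric] sum_distrib_right ..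
  also have "\<dots> = (\<Sum>a b. H'.ginv a b * (M0 b * N0 a)) + (\<Sum>a b. H'.ginv a b * (M1 b * N0 a))
     + (\<Sum>a b. H'.ginv a b * (M i k b y * N1 a))"
    unfolding Nsplit by (simp add: Msplit sum.distrib[symmetric] algebra_simps)
  also have "(\<Sum>a b. H'.ginv a b * (M i k b y * N1 a)) = (\<Sum>b. cnj (dJ b l j y) * M i k b y)"
  proof -
    have "(\<Sum>a b. H'.ginv a b * (M i k b y * N1 a))
      = (\<Sum>a b b'. H'.ginv a b * h' (\<sigma> y) $ a $ b' * (M i k b y * cnj (dJ b' l j y)))"
      unfolding N1_def by (simp add: sum_distrib_left mult_ac)
    also have "\<dots> = (\<Sum>b b'. (\<Sum>a. H'.ginv a b * h' (\<sigma> y) $ a $ b') * (M i k b y * cnj (dJ b' l j y)))"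
      unfolding sum_distrib_right by (rule sum_rotate)
    also have "\<dots> = (\<Sum>b. M i k b y * cnj (dJ b l j y))"
      by (simp only: H'.ginv_left sum_delta_mult)
    finally show ?thesis by (simp only: mult.commute)
  qed
  also have "(\<Sum>a b. H'.ginv a b * (M1 b * N0 a))
     = (\<Sum>b a. cnj (J b l y) * ((\<Sum>d. P'.bg d a b (\<sigma> y) * cnj (J d j y)) * dJ a k i y))"
  proof -
    have "(\<Sum>a b. H'.ginv a b * (M1 b * N0 a))
      = (\<Sum>a b a'. H'.ginv a b * h' (\<sigma> y) $ a' $ b * (dJ a' k i y * N0 a))"
      unfolding M1_def by (simp add: sum_distrib_left sum_distrib_right mult_ac)
    also have "\<dots> = (\<Sum>a a'. (\<Sum>b. H'.ginv a b * h' (\<sigma> y) $ a' $ b) * (dJ a' k i y * N0 a))"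
      unfolding sum_distrib_right by (rule sum.cong[OF refl], rule sum.swap)
    also have "\<dots> = (\<Sum>a. dJ a k i y * N0 a)"
      by (simp only: H'.ginv_right sum_delta_mult)
    also have "\<dots> = (\<Sum>a b. cnj (J b l y) * ((\<Sum>d. P'.bg d a b (\<sigma> y) * cnj (J d j y)) * dJ a k i y))"
      unfolding N0_def by (simp add: sum_distrib_left mult_ac)
    finally show ?thesis by (subst sum.swap)
  qed
  finally have KK: "(\<Sum>p q. inv_metric (h y) p q * P.dg i k q y * P.bg j p l y)
    = (\<Sum>a b. H'.ginv a b * (M0 b * N0 a))
    + (\<Sum>b a. cnj (J b l y) * ((\<Sum>d. P'.bg d a b (\<sigma> y) * cnj (J d j y)) * dJ a k i y))
    + (\<Sum>b. cnj (dJ b l j y) * M i k b y)" .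
  define K where "K c d a b = (\<Sum>p q. H'.ginv p q * P'.dg c a q (\<sigma> y) * P'.bg d p b (\<sigma> y))" for c d a b
  define JJ where "JJ c d a b = J c i y * cnj (J d j y) * J a k y * cnj (J b l y)" for c d a b
  have sum4: "(\<Sum>p q c d a b. t p q c d a b)
    = (\<Sum>c d a b p q. t p q c d a b)"
    for t :: "'n \<Rightarrow> 'n \<Rightarrow> 'n \<Rightarrow> 'n \<Rightarrow> 'n \<Rightarrow> 'n \<Rightarrow> complex"
  proof -
    have rot: "(\<Sum>q c d a b. s q c d a b)
      = (\<Sum>c d a b q. s q c d a b)"
      for s :: "'n \<Rightarrow> 'n \<Rightarrow> 'n \<Rightarrow> 'n \<Rightarrow> 'n \<Rightarrow> complex"
      by (rule trans[OF sum_rotate], rule sum.cong[OF refl], rule sum.cong[OF refl], rule sum_rotate)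
    show ?thesis by (rule trans[OF sum.cong[OF refl rot] rot])
  qed
  have "(\<Sum>a b. H'.ginv a b * (M0 b * N0 a))
    = (\<Sum>p q c d a b. H'.ginv p q * P'.dg c a q (\<sigma> y) * P'.bg d p b (\<sigma> y) * JJ c d a b)"
  proof (intro sum.cong refl)
    fix p q
    have "M0 q = (\<Sum>c a. P'.dg c a q (\<sigma> y) * (J c i y * J a k y))"
      unfolding M0_def by (subst sum.swap) (simp add: sum_distrib_left sum_distrib_right mult_ac)
    moreover have "N0 p = (\<Sum>d b. P'.bg d p b (\<sigma> y) * (cnj (J d j y) * cnj (J b l y)))"
      unfolding N0_def by (subst sum.swap) (simp add: sum_distrib_left sum_distrib_right mult_ac)
    ultimately have "H'.ginv p q * (M0 q * N0 p) = H'.ginv p q *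
      (\<Sum>c d. (\<Sum>a. P'.dg c a q (\<sigma> y) * (J c i y * J a k y))
         * (\<Sum>b. P'.bg d p b (\<sigma> y) * (cnj (J d j y) * cnj (J b l y))))"
      by (simp only: sum_product)
    then show "H'.ginv p q * (M0 q * N0 p) = (\<Sum>c d a b. H'.ginv p q * P'.dg c a q (\<sigma> y) * P'.bg d p b (\<sigma> y)
        * JJ c d a b)"
      unfolding sum_product unfolding sum_distrib_left JJ_def by (simp only: mult_ac)
  qed
  also have "\<dots> = (\<Sum>c d a b. K c d a b * JJ c d a b)"
    by (subst sum4) (simp only: K_def sum_distrib_right)
  finally have K0: "(\<Sum>a b. H'.ginv a b * (M0 b * N0 a))
    = (\<Sum>c d a b. K c d a b * JJ c d a b)" .
  have "(\<Sum>b a. cnj (J b l y) * ((\<Sum>c. (\<Sum>d. P'.hess d c a b (\<sigma> y) * cnj (J d j y)) * J c i y) * J a k y))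
    = (\<Sum>b a c d. P'.hess d c a b (\<sigma> y) * JJ c d a b)"
    by (simp add: sum_distrib_left sum_distrib_right JJ_def mult_ac)
  also have "\<dots> = (\<Sum>a b c d. P'.hess d c a b (\<sigma> y) * JJ c d a b)"
    by (rule sum.swap)
  also have "\<dots> = (\<Sum>a c d b. P'.hess d c a b (\<sigma> y) * JJ c d a b)"
    by (rule sum.cong[OF refl], rule sum_rotate)
  also have "\<dots> = (\<Sum>c d a b. P'.hess d c a b (\<sigma> y) * JJ c d a b)"
    by (rule sum_rotate)
  finally have H0: "(\<Sum>b a. cnj (J b l y) * ((\<Sum>c. (\<Sum>d. P'.hess d c a b (\<sigma> y) * cnj (J d j y)) * J c i y) * J a k y))
    = (\<Sum>c d a b. P'.hess d c a b (\<sigma> y) * JJ c d a b)" .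
  have "curvature h y i j k l = (\<Sum>c d a b. K c d a b * JJ c d a b)
     - (\<Sum>c d a b. P'.hess d c a b (\<sigma> y) * JJ c d a b)"
    unfolding P.curvature_eq[OF y] hess_change[OF y] KK K0 H0 by simp
  also have "\<dots> = (\<Sum>c d a b. curvature h' (\<sigma> y) c d a b * JJ c d a b)"
    unfolding P'.curvature_eq[OF maps[OF y]] K_def[symmetric] by (simp add: sum_subtractf left_diff_distrib)
  finally show ?thesis unfolding JJ_def .
qed

end

text \<open>\<sigma> leads from the primed target chart to the unprimed one, so the Jacobians that
  the chain rule puts on the differentials of \<open>F\<close> are those with which
  \<open>curvature_change\<close> expresses the curvature of \<open>h'\<close> by that of
  \<open>h\<close>. The pullback along \<tau> accounts for the source.\<close>

lemma curvature_form_change: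
  assumes C: "kaehler_map g W h V F" and D: "kaehler_map g' W' h' V' F'"
    and T: "metric_change g W g' W' \<tau>" and S: "metric_change h' V' h V \<sigma>"
    and F: "\<And>p. p \<in> W \<Longrightarrow> F p = \<sigma> (F' (\<tau> p))" and p: "p \<in> W"
  shows "Cochain (curvature_form g h F p) = pull (push \<tau> p) (Cochain (curvature_form g' h' F' (\<tau> p)))"
proof -
  interpret C: kaehler_map g W h V F by fact
  interpret D: kaehler_map g' W' h' V' F' by fact
  interpret T: metric_change g W g' W' \<tau> by fact
  interpret S: metric_change h' V' h V \<sigma> by fact
  define y where "y = F' (\<tau> p)"
  have \<tau>p: "\<tau> p \<in> W'" by (rule T.maps[OF p])
  have y: "y \<in> V'" unfolding y_def by (rule D.F_in[OF \<tau>p])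
  have dF': "F' differentiable (at (\<tau> p))" by (rule smooth_on_differentiable[OF D.smooth_F \<tau>p])
  have dG: "(\<lambda>q. F' (\<tau> q)) differentiable (at p)"
    using differentiable_chain_at[OF T.diff_\<sigma>[OF p] dF'] by (simp add: o_def)
  have d1: "(\<lambda>u. \<sigma> u $ i) differentiable (at y)" for i
    by (rule smooth_on_differentiable[OF S.smooth_\<sigma>_nth y])
  have d2: "(\<lambda>u. cnj (\<sigma> u $ i)) differentiable (at y)" for i
    by (rule smooth_on_differentiable[OF smooth_on_cnj[OF D.N.open_W S.smooth_\<sigma>_nth] y])
  have d3: "(\<lambda>q. F' q $ i) differentiable (at (\<tau> p))" "(\<lambda>q. cnj (F' q $ i)) differentiable (at (\<tau> p))" for i
    by (rule smooth_on_differentiable[OF D.smooth_F_nth \<tau>p],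
        rule smooth_on_differentiable[OF smooth_on_cnj[OF D.M.open_W D.smooth_F_nth] \<tau>p])
  have jc: "cderiv (\<lambda>u. \<sigma> u $ i) y (cvec (Inl a)) = S.J i a y" "cderiv (\<lambda>u. \<sigma> u $ i) y (cvec (Inr a)) = 0"
    "cderiv (\<lambda>u. cnj (\<sigma> u $ i)) y (cvec (Inl a)) = 0" "cderiv (\<lambda>u. cnj (\<sigma> u $ i)) y (cvec (Inr a))
        = cnj (S.J i a y)"
    for i a
    by (simp_all add: holomorphic_cderiv[OF S.hol y] cvec_def axis_def if_distrib[of "\<lambda>x. x * _"] cong: if_cong)
  have hol1: "dfield \<pi> (\<lambda>q. cst (F q $ i)) p
      = (\<Sum>a. cst (S.J i a y) * pull (push \<tau> p) (dfield \<pi> (\<lambda>q. cst (F' q $ a)) (\<tau> p)))"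
    if \<pi>: "\<pi> = pr10 \<or> \<pi> = pr01" for \<pi> i
  proof -
    have "dfield \<pi> (\<lambda>q. cst (F q $ i)) p = dfield \<pi> (\<lambda>q. cst (\<sigma> (F' (\<tau> q)) $ i)) p"
      by (rule dfield_cong[OF C.M.open_W p]) (simp add: F)
    also have "\<dots> = (\<Sum>a. cst (S.J i a y) * dfield \<pi> (\<lambda>q. cst (F' (\<tau> q) $ a)) p)"
      unfolding dfun_chain[OF dG, of "\<lambda>u. \<sigma> u $ i", folded y_def, OF d1] jc by simp
    also have "\<dots> = (\<Sum>a. cst (S.J i a y) * pull (push \<tau> p) (dfield \<pi> (\<lambda>q. cst (F' q $ a)) (\<tau> p)))"
      using \<pi> by (intro sum.cong refl arg_cong2[of _ _ _ _ "(*)"] T.pull_dfun[OF p, of "\<lambda>q. F' q $ _"] d3) auto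
    finally show ?thesis .
  qed
  have hol2: "dfield \<pi> (\<lambda>q. cst (cnj (F q $ i))) p
      = (\<Sum>a. cst (cnj (S.J i a y)) * pull (push \<tau> p) (dfield \<pi> (\<lambda>q. cst (cnj (F' q $ a))) (\<tau> p)))"
    if \<pi>: "\<pi> = pr10 \<or> \<pi> = pr01" for \<pi> i
  proof -
    have "dfield \<pi> (\<lambda>q. cst (cnj (F q $ i))) p = dfield \<pi> (\<lambda>q. cst (cnj (\<sigma> (F' (\<tau> q)) $ i))) p"
      by (rule dfield_cong[OF C.M.open_W p]) (simp add: F)
    also have "\<dots> = (\<Sum>a. cst (cnj (S.J i a y)) * dfield \<pi> (\<lambda>q. cst (cnj (F' (\<tau> q) $ a))) p)"
      unfolding dfun_chain[OF dG, of "\<lambda>u. cnj (\<sigma> u $ i)", folded y_def, OF d2] jc by simp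
    also have "\<dots> = (\<Sum>a. cst (cnj (S.J i a y)) * pull (push \<tau> p) (dfield \<pi> (\<lambda>q. cst (cnj (F' q $ a))) (\<tau> p)))"
      using \<pi> by (intro sum.cong refl arg_cong2[of _ _ _ _ "(*)"] T.pull_dfun[OF p, of
          "\<lambda>q. cnj (F' q $ _)"] d3) auto
    finally show ?thesis .
  qed
  define pa where "pa i = pull (push \<tau> p) (D.a i (\<tau> p))" for i
  define pb where "pb i = pull (push \<tau> p) (D.b i (\<tau> p))" for i
  define pA where "pA i = pull (push \<tau> p) (D.A i (\<tau> p))" for i
  define pB where "pB i = pull (push \<tau> p) (D.B i (\<tau> p))" for i
  have ab: "C.a i p = (\<Sum>r. cst (S.J i r y) * pa r)" "C.b i p = (\<Sum>r. cst (S.J i r y) * pb r)"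
    "C.A i p = (\<Sum>r. cst (cnj (S.J i r y)) * pA r)" "C.B i p = (\<Sum>r. cst (cnj (S.J i r y)) * pB r)" for i
    unfolding C.a_def C.b_def C.A_def C.B_def D.a_def D.b_def D.A_def D.B_def pa_def pb_def pA_def pB_def
    by (simp_all only: hol1 hol2 simp_thms)
  define JJ where "JJ i j k l r s t u = S.J i r y * cnj (S.J j s y) * S.J k t y
      * cnj (S.J l u y)" for i j k l r s t u
  have prod: "C.b i p * C.a k p * (C.A j p * C.B l p)
     = (\<Sum>r s t u. cst (JJ i j k l r s t u) * (pb r * pa t * (pA s * pB u)))" for i j k l
  proof -
    have "C.b i p * C.a k p = (\<Sum>r t. cst (S.J i r y * S.J k t y) * (pb r * pa t))"
      unfolding ab sum_product cst_mult_mult ..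
    moreover have "C.A j p * C.B l p = (\<Sum>s u. cst (cnj (S.J j s y) * cnj (S.J l u y)) * (pA s * pB u))"
      unfolding ab sum_product cst_mult_mult ..
    ultimately have "C.b i p * C.a k p * (C.A j p * C.B l p)
      = (\<Sum>r s. (\<Sum>t. cst (S.J i r y * S.J k t y) * (pb r * pa t))
          * (\<Sum>u. cst (cnj (S.J j s y) * cnj (S.J l u y)) * (pA s * pB u)))"
      by (simp only: sum_product)
    also have "\<dots> = (\<Sum>r s t u. cst (JJ i j k l r s t u) * (pb r * pa t * (pA s * pB u)))"
      unfolding sum_product cst_mult_mult JJ_def by (simp only: mult_ac)
    finally show ?thesis .
  qed
  have rot: "(\<Sum>q c d a b. s q c d a b)
      = (\<Sum>c d a b q. s q c d a b)"
    for s :: "'b \<Rightarrow> 'b \<Rightarrow> 'b \<Rightarrow> 'b \<Rightarrow> 'b \<Rightarrow> 'a tvec cochain"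
    by (rule trans[OF sum_rotate], rule sum.cong[OF refl], rule sum.cong[OF refl], rule sum_rotate)
  have rot4: "(\<Sum>i j k l r s t u. x i j k l r s t u)
    = (\<Sum>r s t u i j k l. x i j k l r s t u)"
    for x :: "'b \<Rightarrow> 'b \<Rightarrow> 'b \<Rightarrow> 'b \<Rightarrow> 'b \<Rightarrow> 'b \<Rightarrow> 'b \<Rightarrow> 'b \<Rightarrow> 'a tvec cochain"
    by (rule trans[OF _ rot], rule sum.cong[OF refl], rule trans[OF _ rot], rule sum.cong[OF refl],
        rule trans[OF _ rot], rule sum.cong[OF refl], rule rot)
  have "(\<Sum>i j k l. cst (curvature h (F p) i j k l) * (C.b i p * C.a k p * (C.A j p * C.B l p)))
    = (\<Sum>i j k l r s t u. cst (curvature h (\<sigma> y) i j k l * JJ i j k l r s t u) * (pb r * pa t * (pA s * pB u)))"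
    unfolding prod sum_distrib_left cst_cst F[OF p] y_def ..
  also have "\<dots> = (\<Sum>r s t u i j k l. cst (curvature h (\<sigma> y) i j k l * JJ i j k l r s t u) * (pb r * pa t * (pA s
      * pB u)))"
    by (rule rot4)
  also have "\<dots> = (\<Sum>r s t u. cst (curvature h' y r s t u) * (pb r * pa t * (pA s * pB u)))"
    unfolding S.curvature_change[OF y] JJ_def[symmetric] cst_sum sum_distrib_right ..
  finally show ?thesis
    unfolding C.Cochain_curvature_form D.Cochain_curvature_form T.pull_omegak[OF p]
    by (simp add: pa_def pb_def pA_def pB_def y_def)
qed

section \<open>Charts and the theorem\<close>

lemma atlas_chart:
  assumes "complex_atlas \<A>" "c \<in> \<A>"
  shows "open (fst c)" "open (snd c ` fst c)" "homeomorphism (fst c) (snd c ` fst c) (snd c) (inv_into (fst c)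
      (snd c))"
proof -
  have "case c of (U, z) \<Rightarrow> open U \<and> open (z ` U) \<and> homeomorphism U (z ` U) z (inv_into U z)"
    using assms unfolding complex_atlas_def by blast
  then show "open (fst c)" "open (snd c ` fst c)"
    "homeomorphism (fst c) (snd c ` fst c) (snd c) (inv_into (fst c) (snd c))"
    by (simp_all add: split_def)
qed

lemma chart_inv:
  "complex_atlas \<A> \<Longrightarrow> c \<in> \<A> \<Longrightarrow> x \<in> fst c \<Longrightarrow> inv_into (fst c) (snd c) (snd c x) = x"
  using atlas_chart(3) homeomorphism_apply1 by blast

lemma chart_rep_apply:
  "complex_atlas \<A> \<Longrightarrow> c \<in> \<A> \<Longrightarrow> x \<in> fst c \<Longrightarrow> chart_rep c c' f (snd c x) = snd c' (f x)"
  by (simp add: chart_rep_def chart_inv)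

lemma open_chart_image:
  assumes "complex_atlas \<A>" "c \<in> \<A>" "open X"
  shows "open (snd c ` (fst c \<inter> X))"
proof -
  have "snd c ` (fst c \<inter> X) = snd c ` fst c \<inter> inv_into (fst c) (snd c) -` X"
    using chart_inv[OF assms(1,2)] by auto
  moreover have "continuous_on (snd c ` fst c) (inv_into (fst c) (snd c))"
    using atlas_chart(3)[OF assms(1,2)] homeomorphism_def by blast
  ultimately show ?thesis
    using continuous_open_preimage[OF _ atlas_chart(2)[OF assms(1,2)] assms(3)] by simp
qed

lemma kaehler_chart_of:
  assumes "kaehler_manifold \<A> g" "c \<in> \<A>" "open W" "W \<subseteq> snd c ` fst c"
  shows "kaehler_chart (g c) W"
proof -
  have at: "complex_atlas \<A>" using assms by (simp add: kaehler_manifold_def)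
  have k: "smooth_on (g c) (snd c ` fst c)"
    "\<forall>p\<in>snd c ` fst c. (\<forall>i j. g c p $ j $ i = cnj (g c p $ i $ j)) \<and>
           (\<forall>v. v \<noteq> 0 \<longrightarrow> Re (\<Sum>i j. g c p $ i $ j * v $ i * cnj (v $ j)) > 0) \<and>
           (\<forall>vs. ext_d (kaehler_form (g c)) p vs = 0)"
    using assms(1,2) unfolding kaehler_manifold_def by blast+
  show ?thesis
  proof
    show "open W" by fact
    show "smooth_on (g c) W" by (rule smooth_on_mono[OF k(1) assms(4)])
    show "g c p $ j $ i = cnj (g c p $ i $ j)" if "p \<in> W" for p i j using k(2) that assms(4) by blast
    show "Re (\<Sum>i j. g c p $ i $ j * v $ i * cnj (v $ j)) > 0" if "p \<in> W" "v \<noteq> 0" for p v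
      using k(2) that assms(4) by blast
    show "ext_d (kaehler_form (g c)) p vs = 0" if "p \<in> W" for p vs using k(2) that assms(4) by blast
  qed
qed

text \<open>\<open>X\<close> and \<open>V\<close> permit smaller domains than whole charts, so that
  two pairs of charts can be compared on their overlap.\<close>

lemma kaehler_map_of:
  assumes M: "kaehler_manifold \<A> g" and N: "kaehler_manifold \<B> h" and f: "smooth_map \<A> \<B> f"
    and c: "c \<in> \<A>" and c': "c' \<in> \<B>" and X: "open X" "X \<subseteq> f -` fst c'"
    and V: "open V" "V \<subseteq> snd c' ` fst c'" "\<And>x. x \<in> fst c \<inter> X \<Longrightarrow> snd c' (f x) \<in> V"
  shows "kaehler_map (g c) (snd c ` (fst c \<inter> X)) (h c') V (chart_rep c c' f)"
proof -
  have at: "complex_atlas \<A>" using M by (simp add: kaehler_manifold_def)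
  have "smooth_on (chart_rep c c' f) (snd c ` (fst c \<inter> f -` fst c'))"
    using f c c' unfolding smooth_map_def by blast
  then have sm: "smooth_on (chart_rep c c' f) (snd c ` (fst c \<inter> X))"
    by (rule smooth_on_mono) (use X in auto)
  show ?thesis
  proof (intro kaehler_map.intro kaehler_map_axioms.intro)
    show "kaehler_chart (g c) (snd c ` (fst c \<inter> X))"
      by (rule kaehler_chart_of[OF M c open_chart_image[OF at c X(1)]]) auto
    show "kaehler_chart (h c') V" by (rule kaehler_chart_of[OF N c' V(1,2)])
    show "smooth_on (chart_rep c c' f) (snd c ` (fst c \<inter> X))" by (rule sm)
    show "chart_rep c c' f p \<in> V" if "p \<in> snd c ` (fst c \<inter> X)" for p
      using that V(3) chart_rep_apply[OF at c, of _ c' f] by auto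
  qed
qed

lemma metric_change_of:
  assumes M: "kaehler_manifold \<A> g" and c: "c \<in> \<A>" and d: "d \<in> \<A>" and X: "open X" "X \<subseteq> fst d"
    and V: "open V" "V \<subseteq> snd d ` fst d" "\<And>x. x \<in> fst c \<inter> X \<Longrightarrow> snd d x \<in> V"
  shows "metric_change (g c) (snd c ` (fst c \<inter> X)) (g d) V (chart_rep c d id)"
proof -
  have at: "complex_atlas \<A>" using M by (simp add: kaehler_manifold_def)
  have "holomorphic_map_on (chart_rep c d id) (snd c ` (fst c \<inter> fst d))"
    using at c d unfolding complex_atlas_def by blast
  then have hol: "holomorphic_map_on (chart_rep c d id) (snd c ` (fst c \<inter> X))"
    unfolding holomorphic_map_on_def using X smooth_on_mono[of _ _ "snd c ` (fst c \<inter> X)"] by blast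
  have metric: "\<forall>x\<in>fst c \<inter> fst d. \<forall>i j. g c (snd c x) $ i $ j =
      (\<Sum>k l. g d (snd d x) $ k $ l * jac (chart_rep c d id) k i (snd c x)
          * cnj (jac (chart_rep c d id) l j (snd c x)))"
    using M c d unfolding kaehler_manifold_def jac_def Let_def by blast
  show ?thesis
  proof (intro metric_change.intro metric_change_axioms.intro)
    show "kaehler_chart (g c) (snd c ` (fst c \<inter> X))"
      by (rule kaehler_chart_of[OF M c open_chart_image[OF at c X(1)]]) auto
    show "kaehler_chart (g d) V" by (rule kaehler_chart_of[OF M d V(1,2)])
    show "holomorphic_map_on (chart_rep c d id) (snd c ` (fst c \<inter> X))" by (rule hol)
    show "chart_rep c d id p \<in> V" if "p \<in> snd c ` (fst c \<inter> X)" for p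
      using that V(3) chart_rep_apply[OF at c, of _ d id] by auto
    show "g c p $ i $ j = (\<Sum>k l. g d (chart_rep c d id p) $ k $ l
        * jac (chart_rep c d id) k i p * cnj (jac (chart_rep c d id) l j p))"
      if "p \<in> snd c ` (fst c \<inter> X)" for p i j
    proof -
      obtain x where x: "x \<in> fst c" "x \<in> X" "p = snd c x" using \<open>p \<in> snd c ` (fst c \<inter> X)\<close> by auto
      then have "x \<in> fst c \<inter> fst d" using X(2) by auto
      then show ?thesis using metric chart_rep_apply[OF at c x(1), of d id] x(3) by simp
    qed
  qed
qed

lemma curvature_form_independent:
  assumes M: "kaehler_manifold \<A> g" and N: "kaehler_manifold \<B> h" and f: "smooth_map \<A> \<B> f"
    and c: "c \<in> \<A>" "d \<in> \<A>" and c': "c' \<in> \<B>" "d' \<in> \<B>"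
    and x: "x \<in> fst c" "x \<in> fst d" "f x \<in> fst c'" "f x \<in> fst d'"
    and Q: "Cochain (curvature_form (g d) (h d') (chart_rep d d' f) (snd d x)) = cst Q * omegak k (g d (snd d x))"
  shows "Cochain (curvature_form (g c) (h c') (chart_rep c c' f) (snd c x)) = cst Q * omegak k (g c (snd c x))"
proof -
  have at: "complex_atlas \<A>" "complex_atlas \<B>" using M N by (simp_all add: kaehler_manifold_def)
  have cont: "continuous_on UNIV f" using f by (simp add: smooth_map_def)
  note op = atlas_chart(1)[OF at(1) c(1)] atlas_chart(1)[OF at(1) c(2)]
    atlas_chart(1)[OF at(2) c'(1)] atlas_chart(1)[OF at(2) c'(2)]
  \<comment> \<open>The points mapped into both target charts. Intersecting with both source charts
    makes all transition maps defined; the image of \<open>c'\<close> stays whole since it only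
    receives values.\<close>
  define Y where "Y = f -` (fst c' \<inter> fst d')"
  have opY: "open Y" unfolding Y_def using op cont by (intro open_vimage) auto
  define W where "W = snd c ` (fst c \<inter> (fst d \<inter> Y))"
  define W' where "W' = snd d ` (fst d \<inter> (fst c \<inter> Y))"
  define V' where "V' = snd d' ` (fst d' \<inter> fst c')"
  have opW': "open W'" unfolding W'_def using op opY by (intro open_chart_image[OF at(1) c(2)]) auto
  have opV': "open V'" unfolding V'_def using op by (intro open_chart_image[OF at(2) c'(2)]) auto
  have C: "kaehler_map (g c) W (h c') (snd c' ` fst c') (chart_rep c c' f)"
    unfolding W_def using op opY atlas_chart(2)[OF at(2) c'(1)]
    by (intro kaehler_map_of[OF M N f c(1) c'(1)]) (auto simp: Y_def)
  have D: "kaehler_map (g d) W' (h d') V' (chart_rep d d' f)"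
    unfolding W'_def using op opY opV'
    by (intro kaehler_map_of[OF M N f c(2) c'(2)]) (auto simp: Y_def V'_def)
  have T: "metric_change (g c) W (g d) W' (chart_rep c d id)"
    unfolding W_def using op opY opW' by (intro metric_change_of[OF M c]) (auto simp: W'_def)
  have S: "metric_change (h d') V' (h c') (snd c' ` fst c') (chart_rep d' c' id)"
    unfolding V'_def using op atlas_chart(2)[OF at(2) c'(1)]
    by (intro metric_change_of[OF N c'(2,1)]) auto
  have F: "chart_rep c c' f p = chart_rep d' c' id (chart_rep d d' f (chart_rep c d id p))" if "p \<in> W" for p
    using that by (auto simp: W_def Y_def chart_rep_apply[OF at(1)] chart_rep_apply[OF at(2)] c c')
  have p: "snd c x \<in> W" using x by (auto simp: W_def Y_def)
  have \<tau>: "chart_rep c d id (snd c x) = snd d x" using chart_rep_apply[OF at(1) c(1) x(1), of d id] by simp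
  interpret T: metric_change "g c" W "g d" W' "chart_rep c d id" by (rule T)
  have "Cochain (curvature_form (g c) (h c') (chart_rep c c' f) (snd c x))
      = pull (push (chart_rep c d id) (snd c x))
         (Cochain (curvature_form (g d) (h d') (chart_rep d d' f) (chart_rep c d id (snd c x))))"
    by (rule curvature_form_change[OF C D T S _ p]) (rule F)
  then show ?thesis
    unfolding T.pull_omegak[OF p] \<tau> Q by simp
qed

theorem theorem3p23:
  fixes \<A> :: "('a::{t2_space,second_countable_topology}, 'n::finite) chart set"
    and g :: "('a, 'n) chart \<Rightarrow> 'n metric"
    and \<B> :: "('b::{t2_space,second_countable_topology}, 'm::finite) chart set"
    and h :: "('b, 'm) chart \<Rightarrow> 'm metric"
    and f :: "'a \<Rightarrow> 'b"
  assumes "CARD('n) \<ge> 2"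
    and "kaehler_manifold \<A> g"
    and "kaehler_manifold \<B> h"
    and "smooth_map \<A> \<B> f"
    and "harmonic_map \<A> g \<B> h f"
  shows "(\<exists>!Q. defines_Q \<A> g \<B> h f Q) \<and>
    (\<forall>Q. defines_Q \<A> g \<B> h f Q \<longrightarrow>
      (\<forall>c\<in>\<A>. \<forall>c'\<in>\<B>. \<forall>x\<in>fst c \<inter> f -` fst c'. \<forall>vs.
        (let F = chart_rep c c' f; p = snd c x in
          wedge
            (ext_d (bracket (h c') F (delbar_E' (h c') F (del_map F))
               (\<lambda>i q us. delbar_map F i q us - del_map F i q us)))
            (omega_n2 (g c)) p vs
          = of_real (8 * form11_norm2 (g c) (h c') F (del_E' (h c') F (delbar_map F)) p + 2 * Q x)
              * volume_form (g c) p vs)))"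
proof -
  note n = assms(1) and M = assms(2) and N = assms(3) and f = assms(4)
  have at: "complex_atlas \<A>" "complex_atlas \<B>" using M N by (simp_all add: kaehler_manifold_def)
  have cont: "continuous_on UNIV f" using f by (simp add: smooth_map_def)
  let ?curv = "\<lambda>c c' x. Cochain (curvature_form (g c) (h c') (chart_rep c c' f) (snd c x))"
  let ?vol = "\<lambda>c x. omegak CARD('n) (g c (snd c x))"
  have km: "kaehler_map (g c) (snd c ` (fst c \<inter> f -` fst c')) (h c') (snd c' ` fst c') (chart_rep c c' f)"
    if "c \<in> \<A>" "c' \<in> \<B>" for c c'
    using atlas_chart[OF at(2) that(2)] open_vimage[OF _ cont]
    by (intro kaehler_map_of[OF M N f that]) auto
  have mem: "snd c x \<in> snd c ` (fst c \<inter> f -` fst c')" if "x \<in> fst c \<inter> f -` fst c'" for c x and c' :: "('b, 'm) chart"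
    using that by blast
  have charts: "\<exists>c\<in>\<A>. \<exists>c'\<in>\<B>. x \<in> fst c \<inter> f -` fst c'" for x
  proof -
    have "(\<Union>c\<in>\<A>. fst c) = UNIV" "(\<Union>c\<in>\<B>. fst c) = UNIV"
      using at unfolding complex_atlas_def by (auto simp: split_def)
    then show ?thesis by blast
  qed
  have dQ: "defines_Q \<A> g \<B> h f Q \<longleftrightarrow> (\<forall>c\<in>\<A>. \<forall>c'\<in>\<B>. \<forall>x\<in>fst c \<inter> f -` fst c'.
      ?curv c c' x = cst (of_real (Q x)) * ?vol c x)" for Q
  proof -
    have "(\<forall>vs. of_real (Q x) * volume_form (g c) (snd c x) vs = curvature_form (g c) (h c') (chart_rep c c' f) (snd c x) vs)
      \<longleftrightarrow> ?curv c c' x = cst (of_real (Q x)) * ?vol c x" for c c' x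
    proof -
      have "volume_form (g c) (snd c x) vs = ev (?vol c x) vs" for vs
        by (metis Cochain_volume_form ev_Cochain)
      moreover have "a = b \<longleftrightarrow> (\<forall>vs. ev b vs = ev a vs)" for a b :: "'n tvec cochain"
        by (auto intro: cochain_eqI)
      ultimately show ?thesis by simp
    qed
    then show ?thesis unfolding defines_Q_def by blast
  qed
  \<comment> \<open>The value at \<open>x\<close> is read off in one pair of charts and carried over
    to all others by \<open>curvature_form_independent\<close>.\<close>
  have ex: "\<exists>r::real. \<forall>c\<in>\<A>. \<forall>c'\<in>\<B>. x \<in> fst c \<inter> f -` fst c' \<longrightarrow> ?curv c c' x = cst (of_real r) * ?vol c x" for x
  proof -
    obtain d d' where d: "d \<in> \<A>" "d' \<in> \<B>" "x \<in> fst d \<inter> f -` fst d'" using charts by blast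
    interpret kaehler_map "g d" "snd d ` (fst d \<inter> f -` fst d')" "h d'" "snd d' ` fst d'" "chart_rep d d' f"
      by (rule km[OF d(1,2)])
    obtain r where "?curv d d' x = cst (of_real r) * ?vol d x"
      using curvature_form_real_multiple[OF mem[OF d(3)] n] by blast
    then have "?curv c c' x = cst (of_real r) * ?vol c x"
      if "c \<in> \<A>" "c' \<in> \<B>" "x \<in> fst c \<inter> f -` fst c'" for c c'
      using curvature_form_independent[OF M N f that(1) d(1) that(2) d(2)] that(3) d(3) by blast
    then show ?thesis by blast
  qed
  then obtain Q where Q: "\<And>x c c'. c \<in> \<A> \<Longrightarrow> c' \<in> \<B> \<Longrightarrow> x \<in> fst c \<inter> f -` fst c' \<Longrightarrow>
      ?curv c c' x = cst (of_real (Q x)) * ?vol c x"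
    by metis
  \<comment> \<open>Some pair of charts covers each point, and there the nonvanishing volume form
    determines the factor.\<close>
  have uniq: "Q' = Q" if "defines_Q \<A> g \<B> h f Q'" for Q'
  proof
    fix x
    obtain d d' where d: "d \<in> \<A>" "d' \<in> \<B>" "x \<in> fst d \<inter> f -` fst d'" using charts by blast
    interpret kaehler_map "g d" "snd d ` (fst d \<inter> f -` fst d')" "h d'" "snd d' ` fst d'" "chart_rep d d' f"
      by (rule km[OF d(1,2)])
    interpret G: hermitian "g d (snd d x)" by (rule M.hermitian_metric[OF mem[OF d(3)]])
    have "cst (of_real (Q' x)) * ?vol d x = cst (of_real (Q x)) * ?vol d x"
      using Q[OF d] that d unfolding dQ by metis
    then have "complex_of_real (Q' x) = of_real (Q x)"
      using G.cst_vol_cancel unfolding G.vol_def G.omk_omegak by blast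
    then show "Q' x = Q x" by simp
  qed
  have "defines_Q \<A> g \<B> h f Q" unfolding dQ using Q by blast
  then have exuniq: "\<exists>!Q. defines_Q \<A> g \<B> h f Q" using uniq by blast
  have main: "let F = chart_rep c c' f; p = snd c x in
          wedge
            (ext_d (bracket (h c') F (delbar_E' (h c') F (del_map F))
               (\<lambda>i q us. delbar_map F i q us - del_map F i q us)))
            (omega_n2 (g c)) p vs
          = of_real (8 * form11_norm2 (g c) (h c') F (del_E' (h c') F (delbar_map F)) p + 2 * Q' x)
              * volume_form (g c) p vs"
    if Q': "defines_Q \<A> g \<B> h f Q'" and c: "c \<in> \<A>" and c': "c' \<in> \<B>" and x: "x \<in> fst c \<inter> f -` fst c'"
    for Q' c c' x vs
  proof -
    interpret kaehler_map "g c" "snd c ` (fst c \<inter> f -` fst c')" "h c'" "snd c' ` fst c'" "chart_rep c c' f"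
      by (rule km[OF c c'])
    have t: "tension (g c) (h c') (chart_rep c c' f) (Inl i) (snd c x) [] = 0" for i
      using assms(5) c c' x unfolding harmonic_map_def by blast
    have q: "?curv c c' x = cst (of_real (Q' x)) * ?vol c x" using Q' c c' x unfolding dQ by blast
    have v: "volume_form (g c) (snd c x) vs = ev (?vol c x) vs"
      by (metis Cochain_volume_form ev_Cochain)
    from arg_cong[OF local_identity[OF mem[OF x] n t q], of "\<lambda>a. ev a vs"] show ?thesis
      unfolding Let_def v ev_Cochain ev_cst_mult .
  qed
  show ?thesis using exuniq main by blast
qed

end
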